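(* Consider the eigenvalue problem $D^4u=\lambda D^2u$ on $-1\le x\le 1$ with $u(\pm1)=Du(\pm1)=0$, where $D=d/dx$, and its degree-$n$ Gegenbauer tau approximation of index $\gamma>-1/2$, $n\ge 4$. If $1/2<\gamma\le 7/2$, then for every $n\ge 4$ all the eigenvalues of the Gegenbauer tau approximation are real, negative, and distinct. This range of $\gamma$ is sharp: for every $\gamma$ with $-1/2<\gamma<1/2$ and every $n\ge 4$ the Gegenbauer tau approximation has a (spurious) real positive eigenvalue; and for every $\gamma>7/2$ the Gegenbauer tau approximation has complex (non-real) eigenvalues for all sufficiently large $n$.
   Context: For $\gamma>-1/2$ let $W^{(\gamma)}(x)=(1-x^2)^{\gamma-1/2}$ on $(-1,1)$. The Gegenbauer tau approximation of degree $n$ and index $\gamma$ to the problem $D^4u=\lambda D^2u$, $u(\pm1)=Du(\pm1)=0$, is the following finite-dimensional eigenvalue problem: find $\lambda\in\mathbb{C}$ and a nonzero polynomial $u_n(x)$ (complex coefficients, degree at most $n$) such that $u_n(\pm1)=Du_n(\pm1)=0$ and $$\int_{-1}^1\big(\lambda D^2u_n(x)-D^4u_n(x)\big)\,q(x)\,W^{(\gamma)}(x)\,dx=0\quad\text{for all polynomials } q \text{ of degree at most } n-4.$$ Such $\lambda$ are the eigenvalues of the approximation. Choosing bases of the $(n-3)$-dimensional space of trial polynomials $u_n$ and of the $(n-3)$-dimensional space of test polynomials $q$, this is a generalized matrix eigenvalue problem $Aa=\lambda Ba$ of size $n-3$; "distinct" means that the roots of $\det(A-\lambda B)$ are all simple.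 *)

theory Defs
  imports "HOL-Analysis.Analysis" "Jordan_Normal_Form.Determinant"
begin

hide_const (open) Determinants.det

definition gegenbauer_weight :: "real \<Rightarrow> real \<Rightarrow> real" where
  "gegenbauer_weight \<gamma> x = (1 - x\<^sup>2) powr (\<gamma> - 1/2)"

definition weighted_integral :: "real \<Rightarrow> complex poly \<Rightarrow> complex" where
  "weighted_integral \<gamma> p =
     (LINT x:{-1<..<1}|lborel. poly p (of_real x) * of_real (gegenbauer_weight \<gamma> x))"

definition trial_space :: "nat \<Rightarrow> complex poly set" where
  "trial_space n = {u. degree u \<le> n \<and> poly u 1 = 0 \<and> poly u (-1) = 0 \<and>
                       poly (pderiv u) 1 = 0 \<and> poly (pderiv u) (-1) = 0}"

text \<open>The truncated subtraction below is harmless: the degree is at least 4 wherever the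
  approximation is considered.\<close>

definition test_space :: "nat \<Rightarrow> complex poly set" where
  "test_space n = {q. degree q \<le> n - 4}"

definition tau_eigenvalue :: "real \<Rightarrow> nat \<Rightarrow> complex \<Rightarrow> bool" where
  "tau_eigenvalue \<gamma> n l \<longleftrightarrow>
     (\<exists>u\<in>trial_space n. u \<noteq> 0 \<and>
        (\<forall>q\<in>test_space n.
           weighted_integral \<gamma> ((Polynomial.smult l ((pderiv ^^ 2) u) - (pderiv ^^ 4) u) * q) = 0))"

definition basis_family :: "nat \<Rightarrow> (nat \<Rightarrow> complex poly) \<Rightarrow> complex poly set \<Rightarrow> bool" where
  "basis_family m b V \<longleftrightarrow>
     inj_on b {..<m} \<and> \<not> Modules.module.dependent Polynomial.smult (b ` {..<m}) \<and>
     Modules.module.span Polynomial.smult (b ` {..<m}) = V"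

text \<open>For a trial function with coefficient vector \<open>a\<close> in the basis \<open>\<phi>\<close>, testing against the
  basis \<open>\<psi>\<close> gives \<open>A a = \<lambda> B a\<close>, where \<open>A\<close> and \<open>B\<close> are the matrices of the fourth and of the
  second derivative: rows belong to test functions, columns to trial functions.\<close>

definition tau_matrix ::
    "nat \<Rightarrow> real \<Rightarrow> nat \<Rightarrow> (nat \<Rightarrow> complex poly) \<Rightarrow> (nat \<Rightarrow> complex poly) \<Rightarrow> complex mat" where
  "tau_matrix k \<gamma> n \<phi> \<psi> =
     mat (n - 3) (n - 3) (\<lambda>(i, j). weighted_integral \<gamma> ((pderiv ^^ k) (\<phi> j) * \<psi> i))"

text \<open>The determinant of \<open>A - \<lambda> B\<close> as a polynomial in \<open>\<lambda>\<close>.\<close>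

definition tau_char_poly ::
    "real \<Rightarrow> nat \<Rightarrow> (nat \<Rightarrow> complex poly) \<Rightarrow> (nat \<Rightarrow> complex poly) \<Rightarrow> complex poly" where
  "tau_char_poly \<gamma> n \<phi> \<psi> =
     det (map_mat (\<lambda>a. [:a:]) (tau_matrix 4 \<gamma> n \<phi> \<psi>)
          - [:0, 1:] \<cdot>\<^sub>m map_mat (\<lambda>b. [:b:]) (tau_matrix 2 \<gamma> n \<phi> \<psi>))"

definition tau_eigenvalues_distinct :: "real \<Rightarrow> nat \<Rightarrow> bool" where
  "tau_eigenvalues_distinct \<gamma> n \<longleftrightarrow>
     (\<forall>\<phi> \<psi>. basis_family (n - 3) \<phi> (trial_space n) \<longrightarrow>
            basis_family (n - 3) \<psi> (test_space n) \<longrightarrow>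
            rsquarefree (tau_char_poly \<gamma> n \<phi> \<psi>))"

end

theory Submission
  imports Defs "HOL-Computational_Algebra.Computational_Algebra" "HOL-Real_Asymp.Real_Asymp"
begin

text \<open>
Put \<open>\<beta> = \<gamma> - 1/2\<close>, \<open>x = 1 - 2 t\<close> and \<open>z = 1 / (4 \<lambda>)\<close>. The residual of a trial function has degree at
most \<open>n - 2\<close> and is orthogonal to all polynomials of degree at most \<open>n - 4\<close>, so it is a combination
of the Gegenbauer polynomials of degrees \<open>n - 3\<close> and \<open>n - 2\<close>. These have opposite parity, and the
problem splits. For the Gegenbauer polynomial of degree \<open>m\<close> let \<open>G\<close> be the multiple of its
primitive with \<open>G(0) = 1\<close>, a terminating hypergeometric polynomial. Then \<open>F = \<Sum> z^k D^(2k) G\<close>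
solves \<open>F - z F'' = G\<close>, and a primitive of \<open>F\<close> (for odd \<open>m\<close>, of \<open>F - F(0)\<close>) has the right residual.
By parity the four boundary conditions collapse to one polynomial equation in \<open>z\<close>, with left side
\<open>even_mode \<beta> m\<close> or \<open>odd_mode \<beta> m\<close> (\<open>even_eigenfunction\<close>, \<open>odd_eigenfunction\<close>). Only the passage from
roots to eigenvalues is proved directly. The converse is a count: the characteristic polynomial is
nonzero, because \<open>\<lambda> = 0\<close> is not an eigenvalue, and has degree at most \<open>n - 3\<close>, so \<open>n - 3\<close> distinct
eigenvalues exhaust its roots and make them simple (\<open>tau_spectrum\<close>).

For \<open>0 < \<beta> \<le> 3\<close> both mode polynomials come from one polynomial \<open>\<psi>\<close> by two operators of the form
\<open>z d/dz - \<kappa>\<close>. Such an operator keeps the property that all roots are negative and simple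
(\<open>neg_simple_shifted_euler\<close>). The two modes share one of the operators; a common root would be
a double root of the polynomial obtained from \<open>\<psi>\<close> by that operator (\<open>mode_roots\<close>). So everything rests
on \<open>\<psi>\<close> itself (\<open>neg_simple_psi\<close>). It is the even part, or after a shift of \<open>\<beta>\<close> by one the odd part up
to a factor, of a polynomial \<open>\<Phi>_(N,b)\<close> with \<open>0 < b \<le> 2\<close>, and by the Hermite-Biehler theorem the even
and odd parts of a Hurwitz polynomial have negative simple roots. The Hurwitz property of
\<open>\<Phi>_(N,b)\<close> is followed from \<open>b = 2\<close> downwards: zeros depend continuously on \<open>b\<close>, and none can cross
the imaginary axis. The tool is a resolvent. If \<open>\<Phi>_(N,b)(\<eta>) = 0\<close>, the solution of \<open>y + \<eta> y' = R\<close>,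
where \<open>R\<close> is the Jacobi polynomial with parameters \<open>(b - 1, b - 3)\<close>, vanishes at \<open>0\<close>. Multiplying
the equation by suitable functions and integrating against a Jacobi weight evaluates one integral in
two ways: it is bounded below by an energy, and above by the near-orthogonality of \<open>R\<close>, and the two
bounds are incompatible (\<open>no_axis_zero_nonneg_index\<close>, \<open>no_axis_zero_negative_index\<close>, \<open>phi_2_no_right_zero\<close>).

For \<open>-1 < \<beta> < 0\<close> the coefficients of \<open>even_mode \<beta> m\<close> carry the factor \<open>1 / (\<beta>)_(2k)\<close>, which is negative
for \<open>k \<ge> 1\<close>, while the constant term is \<open>1\<close>; hence there is a positive root, and a positive eigenvalue.

For \<open>\<beta> > 3\<close> the rescaled even modes converge, uniformly on bounded parts of the negative axis, to
\<open>\<Sum> \<zeta>^k / (\<beta>)_(2k)\<close>. A multiple of this function at \<open>\<zeta> = - x\<^sup>2\<close> is the integral of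
\<open>(1 - t)^(\<beta> - 4) (1 - cos (x t))\<close> over \<open>[0, 1]\<close>, divided by \<open>x\<^sup>2\<close>: it is positive on the whole negative
axis and decays only like \<open>1 / \<bar>\<zeta>\<bar>\<close>. A polynomial with constant term \<open>1\<close> and only negative roots, all
of them to the left of \<open>- T\<close>, is at most \<open>exp (- c T)\<close> at \<open>- T\<close>, where \<open>c\<close> is its linear coefficient.
The two facts contradict each other for large \<open>T\<close>, so for all large degrees some root is not real
(\<open>even_mode_nonreal_root\<close>).
\<close>

section \<open>Polynomials with negative simple roots\<close>

abbreviation cp :: "real poly \<Rightarrow> complex poly" where "cp \<equiv> map_poly complex_of_real"

lemma cp_pderiv: "cp (pderiv p) = pderiv (cp p)"
  by (simp add: poly_eq_iff coeff_map_poly coeff_pderiv)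

lemma cp_pCons: "cp (pCons a p) = pCons (of_real a) (cp p)"
  by (rule map_poly_pCons) simp

lemma cp_add: "cp (p + q) = cp p + cp q"
  by (simp add: poly_eq_iff coeff_map_poly)

lemma cp_smult: "cp (Polynomial.smult a p) = Polynomial.smult (of_real a) (cp p)"
  by (simp add: poly_eq_iff coeff_map_poly)

lemma cp_mult: "cp (p * q) = cp p * cp q"
  by (simp add: poly_eq_iff coeff_map_poly coeff_mult)

lemma cp_prod: "cp (prod f X) = (\<Prod>x\<in>X. cp (f x))"
  by (induction X rule: infinite_finite_induct) (simp_all add: cp_mult)

lemma poly_cp_real: "poly (cp p) (of_real x) = of_real (poly p x)"
  by (simp add: poly_altdef coeff_map_poly degree_map_poly)

lemma poly_cp_cnj: "poly (cp p) (cnj z) = cnj (poly (cp p) z)"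
  by (simp add: poly_altdef coeff_map_poly)

lemma degree_cp [simp]: "degree (cp p) = degree p"
  by (simp add: degree_map_poly)

lemma cp_inject: "cp p = cp q \<longleftrightarrow> p = q"
  by (simp add: poly_eq_iff coeff_map_poly)

lemma cp_eq_0_iff [simp]: "cp p = 0 \<longleftrightarrow> p = 0"
  by (simp add: map_poly_eq_0_iff)

text \<open>
The explicit product avoids speaking of multiplicities; the roots are the numbers \<open>- x\<close> for \<open>x \<in> X\<close>.
\<close>

definition neg_simple :: "real poly \<Rightarrow> bool" where
  "neg_simple p \<longleftrightarrow> (\<exists>X c. finite X \<and> c \<noteq> 0 \<and> (\<forall>x\<in>X. 0 < x) \<and> p = Polynomial.smult c (\<Prod>x\<in>X. [:x, 1:]))"

lemma neg_simpleI:
  assumes "p \<noteq> 0"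
  assumes root: "\<And>z. poly (cp p) z = 0 \<Longrightarrow> Im z = 0 \<and> Re z < 0 \<and> poly (pderiv (cp p)) z \<noteq> 0"
  shows "neg_simple p"
proof -
  define Z where "Z = {z. poly (cp p) z = 0}"
  have fin: "finite Z" unfolding Z_def using assms(1) by (intro poly_roots_finite) simp
  define X where "X = (\<lambda>z. - Re z) ` Z"
  have bij: "bij_betw (\<lambda>x. complex_of_real (- x)) X Z"
    unfolding X_def
  proof (rule bij_betw_byWitness[where f' = "\<lambda>z. - Re z"])
    have *: "complex_of_real (Re z) = z" if "z \<in> Z" for z
      using root[of z] that by (simp add: Z_def complex_eq_iff)
    show "(\<lambda>x. complex_of_real (- x)) ` (\<lambda>z. - Re z) ` Z \<subseteq> Z"
      using * by (auto simp: image_image)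
    show "\<forall>z\<in>Z. complex_of_real (- (- Re z)) = z" using * by simp
  qed auto
  have "rsquarefree (cp p)" using root by (auto simp: rsquarefree_roots)
  from complex_poly_decompose_rsquarefree[OF this]
  have "cp p = Polynomial.smult (lead_coeff (cp p)) (\<Prod>z\<in>Z. [:- z, 1:])" by (simp add: Z_def)
  also have "(\<Prod>z\<in>Z. [:- z, 1:]) = (\<Prod>x\<in>X. [:of_real x, 1:])"
    using prod.reindex_bij_betw[OF bij, of "\<lambda>z. [:- z, 1:]"] by simp
  also have "\<dots> = cp (\<Prod>x\<in>X. [:x, 1:])"
    by (simp add: cp_prod cp_pCons)
  also have "Polynomial.smult (lead_coeff (cp p)) \<dots> = cp (Polynomial.smult (lead_coeff p) (\<Prod>x\<in>X. [:x, 1:]))"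
    by (simp add: cp_smult coeff_map_poly)
  finally have "p = Polynomial.smult (lead_coeff p) (\<Prod>x\<in>X. [:x, 1:])"
    by (metis cp_inject)
  moreover have "finite X" "\<forall>x\<in>X. 0 < x" using fin root by (auto simp: X_def Z_def)
  ultimately show ?thesis using assms(1) unfolding neg_simple_def
    by (metis leading_coeff_0_iff)
qed

text \<open>
The operator \<open>z d/dz - \<kappa>\<close>, which multiplies the coefficient of \<open>z^k\<close> by \<open>k - \<kappa>\<close>.
\<close>

definition shifted_euler :: "real \<Rightarrow> real poly \<Rightarrow> real poly" where
  "shifted_euler \<kappa> p = pCons 0 (pderiv p) - Polynomial.smult \<kappa> p"

lemma coeff_shifted_euler [simp]: "coeff (shifted_euler \<kappa> p) k = (of_nat k - \<kappa>) * coeff p k"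
  by (cases k) (simp_all add: shifted_euler_def coeff_pderiv algebra_simps)

lemma poly_shifted_euler: "poly (shifted_euler \<kappa> p) z = z * poly (pderiv p) z - \<kappa> * poly p z"
  by (simp add: shifted_euler_def)

lemma cp_shifted_euler: "cp (shifted_euler \<kappa> p) = pCons 0 (pderiv (cp p)) - Polynomial.smult (of_real \<kappa>) (cp p)"
  by (rule poly_eqI) (auto simp add: coeff_map_poly coeff_pCons coeff_pderiv algebra_simps split: nat.split)

text \<open>
For a product \<open>p\<close> of linear factors \<open>z + x\<close> one has \<open>z p' - \<kappa> p = p h\<close> with
\<open>h(z) = deg p - \<kappa> - \<Sum> x / (z + x)\<close>. The imaginary part of \<open>h\<close> has the sign of that of \<open>z\<close>, so the zeros
of \<open>h\<close> are real, and \<open>h' > 0\<close> on the real line makes them simple. For \<open>z \<ge> 0\<close> the sum lies between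
\<open>0\<close> and \<open>deg p\<close>, so \<open>h\<close> cannot vanish there under either alternative for \<open>\<kappa>\<close>.
\<close>

lemma neg_simple_shifted_euler:
  assumes p: "neg_simple p" and \<kappa>: "\<kappa> < 0 \<or> (0 < \<kappa> \<and> real (degree p) \<le> \<kappa>)"
  shows "neg_simple (shifted_euler \<kappa> p)"
proof -
  from p obtain X c where X: "finite X" "c \<noteq> 0" "\<forall>x\<in>X. 0 < x"
    and p_eq: "p = Polynomial.smult c (\<Prod>x\<in>X. [:x, 1:])" unfolding neg_simple_def by blast
  define n where "n = real (card X)"
  have deg: "degree p = card X"
    using X by (simp add: p_eq degree_prod_eq_sum_degree)
  have cpp: "cp p = Polynomial.smult (of_real c) (\<Prod>x\<in>X. [:of_real x, 1:])"
    by (simp add: p_eq cp_smult cp_prod cp_pCons)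
  define h where "h = (\<lambda>z::complex. of_real (n - \<kappa>) - (\<Sum>x\<in>X. of_real x / (z + of_real x)))"
  define G where "G = cp (shifted_euler \<kappa> p)"
  have polyp: "poly (cp p) z = of_real c * (\<Prod>x\<in>X. z + of_real x)" for z
    by (simp add: cpp poly_prod add.commute)
  have p0: "poly (cp p) z = 0 \<longleftrightarrow> (\<exists>x\<in>X. z = - of_real x)" for z
    using X by (auto simp: polyp prod_zero_iff eq_neg_iff_add_eq_0)
  have dp: "poly (pderiv (cp p)) z = of_real c * (\<Sum>x\<in>X. \<Prod>y\<in>X-{x}. z + of_real y)" for z
    by (simp add: cpp pderiv_smult pderiv_prod poly_sum poly_prod pderiv_pCons add.commute)
  have G_eq: "poly G z = poly (cp p) z * h z" if "poly (cp p) z \<noteq> 0" for z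
  proof -
    have nz: "z + of_real x \<noteq> 0" if "x \<in> X" for x
      using p0 \<open>poly (cp p) z \<noteq> 0\<close> that by (auto simp: eq_neg_iff_add_eq_0)
    have "(\<Prod>y\<in>X-{x}. z + of_real y) = (\<Prod>y\<in>X. z + of_real y) / (z + of_real x)" if "x \<in> X" for x
      using nz that X(1) by (simp add: prod.remove[of X x])
    then have "poly (pderiv (cp p)) z = poly (cp p) z * (\<Sum>x\<in>X. 1 / (z + of_real x))"
      unfolding dp polyp by (simp add: sum_distrib_left mult.assoc)
    then have "poly G z = poly (cp p) z * ((\<Sum>x\<in>X. z / (z + of_real x)) - of_real \<kappa>)"
      by (simp add: G_def cp_shifted_euler algebra_simps sum_distrib_left)
    also have "(\<Sum>x\<in>X. z / (z + of_real x)) = (\<Sum>x\<in>X. 1 - of_real x / (z + of_real x))"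
      by (rule sum.cong) (use nz in \<open>auto simp: field_simps\<close>)
    also have "\<dots> = of_real n - (\<Sum>x\<in>X. of_real x / (z + of_real x))"
      by (simp add: n_def sum_subtractf)
    finally show ?thesis by (simp add: h_def algebra_simps)
  qed
  have "poly p 0 \<noteq> 0" using p0[of 0] X(3) poly_cp_real[of p 0] by auto
  then have "coeff (shifted_euler \<kappa> p) 0 \<noteq> 0" using \<kappa> by (auto simp add: poly_0_coeff_0)
  then have Gn: "shifted_euler \<kappa> p \<noteq> 0" by (metis coeff_0)
  have dp_nz: "poly (pderiv (cp p)) z \<noteq> 0" if "poly (cp p) z = 0" for z
  proof -
    from that p0 obtain x where x: "x \<in> X" "z = - of_real x" by blast
    have "(\<Sum>y\<in>X. \<Prod>w\<in>X-{y}. z + of_real w) = (\<Prod>w\<in>X-{x}. z + complex_of_real w)"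
      using X(1) x by (subst sum.remove[of X x]) (auto intro!: sum.neutral prod_zero bexI[of _ x])
    also have "\<dots> \<noteq> 0" using X(1) x by (auto simp: add_eq_0_iff simp flip: of_real_minus)
    finally show ?thesis using X(2) by (simp add: dp)
  qed
  show ?thesis
  proof (rule neg_simpleI[OF Gn])
    fix z assume "poly (cp (shifted_euler \<kappa> p)) z = 0"
    then have Gz: "poly G z = 0" by (simp add: G_def)
    have pz: "poly (cp p) z \<noteq> 0"
    proof
      assume 0: "poly (cp p) z = 0"
      then have "z \<noteq> 0" using p0 X(3) by fastforce
      moreover have "z * poly (pderiv (cp p)) z = 0" using Gz 0 by (simp add: G_def cp_shifted_euler)
      ultimately show False using dp_nz[OF 0] by simp
    qed
    then have hz: "h z = 0" using G_eq Gz by simp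
    have nz: "z + of_real x \<noteq> 0" if "x \<in> X" for x
      using p0 pz that by (auto simp: eq_neg_iff_add_eq_0)
    have Xne: "X \<noteq> {}"
      using hz \<kappa> by (auto simp: h_def n_def)
    have Im_term: "Im (of_real x / (z + of_real x)) = - Im z * (x / (cmod (z + of_real x))\<^sup>2)" for x
      unfolding cmod_power2 by (simp add: Im_divide)
    have "Im (h z) = Im z * (\<Sum>x\<in>X. x / (cmod (z + of_real x))\<^sup>2)"
      by (simp add: h_def Im_sum Im_term sum_negf sum_distrib_left)
    moreover have "(\<Sum>x\<in>X. x / (cmod (z + of_real x))\<^sup>2) > 0"
      using X Xne nz by (intro sum_pos) auto
    ultimately have Imz: "Im z = 0" using hz by simp
    then have z_eq: "z = of_real (Re z)" by (simp add: complex_eq_iff)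
    have nz': "Re z + x \<noteq> 0" if "x \<in> X" for x
    proof
    assume "Re z + x = 0"
    then have "z + of_real x = 0" using Imz by (simp add: complex_eq_iff)
    with nz[OF that] show False by simp
  qed
    have hr: "n - \<kappa> - (\<Sum>x\<in>X. x / (Re z + x)) = 0"
    proof -
      have "h z = of_real (n - \<kappa> - (\<Sum>x\<in>X. x / (Re z + x)))"
        unfolding h_def by (subst z_eq) simp
      then show ?thesis using hz by (metis of_real_eq_0_iff)
    qed
    have Rez: "Re z < 0"
    proof (rule ccontr)
      assume "\<not> Re z < 0"
      then have Rez: "0 \<le> Re z" by simp
      have pos: "(\<Sum>x\<in>X. x / (Re z + x)) > 0"
        using X Xne Rez by (intro sum_pos divide_pos_pos) (auto intro: add_nonneg_pos)
      have le: "(\<Sum>x\<in>X. x / (Re z + x)) \<le> (\<Sum>x\<in>X. 1)"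
      proof (rule sum_mono)
        fix x assume "x \<in> X"
        then have "0 < x" "0 < Re z + x" using X Rez by (auto intro: add_nonneg_pos)
        then show "x / (Re z + x) \<le> 1" using Rez by (simp add: divide_le_eq)
      qed
      show False using \<kappa> hr pos le by (auto simp: n_def deg)
    qed
    have "poly (pderiv G) z \<noteq> 0"
    proof
      assume dG: "poly (pderiv G) z = 0"
      define d where "d = (\<Sum>x\<in>X. complex_of_real x / (z + of_real x)\<^sup>2)"
      have hd: "(h has_field_derivative d) (at z)"
        unfolding h_def d_def
        by (auto intro!: derivative_eq_intros simp: nz power2_eq_square sum_negf[symmetric] intro!: sum.cong)
      have "((\<lambda>w. poly (cp p) w * h w) has_field_derivative
              (poly (pderiv (cp p)) z * h z + d * poly (cp p) z)) (at z)"
        by (rule DERIV_cong[OF DERIV_mult'[OF poly_DERIV hd]]) (simp add: algebra_simps)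
      moreover have "eventually (\<lambda>w. w \<in> {w. poly (cp p) w \<noteq> 0}) (nhds z)"
        by (intro eventually_nhds_in_open open_Collect_neq continuous_intros) (use pz in auto)
      then have "eventually (\<lambda>w. poly (cp p) w * h w = poly G w) (nhds z)"
        by eventually_elim (simp add: G_eq)
      ultimately have "(poly G has_field_derivative (poly (pderiv (cp p)) z * h z + d * poly (cp p) z)) (at z)"
        by (subst (asm) DERIV_cong_ev[OF refl _ refl]) auto
      from DERIV_unique[OF this poly_DERIV] dG hz have "d * poly (cp p) z = 0" by simp
      then have d0: "d = 0" using pz by simp
      have "d = of_real (\<Sum>x\<in>X. x / (Re z + x)\<^sup>2)" unfolding d_def by (subst z_eq) simp
      then have "(\<Sum>x\<in>X. x / (Re z + x)\<^sup>2) = 0" using d0 by (metis of_real_eq_0_iff)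
      moreover have "(\<Sum>x\<in>X. x / (Re z + x)\<^sup>2) > 0"
        using X Xne nz' by (intro sum_pos) auto
      ultimately show False by simp
    qed
    then show "Im z = 0 \<and> Re z < 0 \<and> poly (pderiv (cp (shifted_euler \<kappa> p))) z \<noteq> 0"
      using Imz Rez by (simp add: G_def)
  qed
qed

lemma neg_simple_roots:
  assumes "neg_simple p"
  shows "p \<noteq> 0" "finite {x. poly p x = 0}" "card {x. poly p x = 0} = degree p"
    "poly p x = 0 \<Longrightarrow> x < 0" "poly p x = 0 \<Longrightarrow> poly (pderiv p) x \<noteq> 0"
proof -
  from assms obtain X c where X: "finite X" "c \<noteq> 0" "\<forall>x\<in>X. 0 < x"
    and p_eq: "p = Polynomial.smult c (\<Prod>x\<in>X. [:x, 1:])" unfolding neg_simple_def by blast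
  have deg: "degree p = card X" using X by (simp add: p_eq degree_prod_eq_sum_degree)
  have p0: "poly p x = 0 \<longleftrightarrow> - x \<in> X" for x
  proof -
    have "poly p x = c * (\<Prod>y\<in>X. x + y)" by (simp add: p_eq poly_prod add.commute)
    then show ?thesis using X by (auto simp: add_eq_0_iff)
  qed
  have roots: "{x. poly p x = 0} = uminus ` X" by (auto simp: p0 image_iff intro!: bexI[of _ "- x" for x])
  show "p \<noteq> 0" using X by (simp add: p_eq)
  show "finite {x. poly p x = 0}" "card {x. poly p x = 0} = degree p"
    using X(1) by (auto simp: roots deg card_image inj_on_def)
  show "x < 0" if "poly p x = 0" using that X(3) p0[of x] by auto
  show "poly (pderiv p) x \<noteq> 0" if 0: "poly p x = 0"
  proof -
    let ?x = "- x"
    have x: "?x \<in> X" using 0 p0 by blast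
    have "poly (pderiv p) x = c * (\<Sum>y\<in>X. \<Prod>w\<in>X-{y}. x + w)"
      by (simp add: p_eq pderiv_smult pderiv_prod poly_sum poly_prod pderiv_pCons add.commute)
    also have "(\<Sum>y\<in>X. \<Prod>w\<in>X-{y}. x + w) = (\<Prod>w\<in>X-{?x}. x + w)"
      using X(1) x by (subst sum.remove[of X ?x]) (auto intro!: sum.neutral prod_zero bexI[of _ ?x])
    finally show ?thesis using X x by (auto simp: add_eq_0_iff)
  qed
qed

section \<open>Hurwitz polynomials and the Hermite-Biehler theorem\<close>

definition even_part :: "real poly \<Rightarrow> real poly" where
  "even_part p = (\<Sum>k\<le>degree p. monom (coeff p (2 * k)) k)"

definition odd_part :: "real poly \<Rightarrow> real poly" where
  "odd_part p = (\<Sum>k\<le>degree p. monom (coeff p (2 * k + 1)) k)"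

lemma coeff_even_part [simp]: "coeff (even_part p) k = coeff p (2 * k)"
  by (cases "k \<le> degree p") (auto simp: even_part_def coeff_sum coeff_eq_0)

lemma coeff_odd_part [simp]: "coeff (odd_part p) k = coeff p (2 * k + 1)"
  by (cases "k \<le> degree p") (auto simp: odd_part_def coeff_sum coeff_eq_0)

lemma parity_decomposition:
  "p = pcompose (even_part p) [:0, 0, 1:] + pCons 0 (pcompose (odd_part p) [:0, 0, 1:])"
proof -
  have c: "coeff (pcompose q [:0, 0, 1:]) n = (if even n then coeff q (n div 2) else 0)" for q :: "real poly" and n
  proof (induction q arbitrary: n)
    case (pCons a q)
    show ?case
    proof (cases n rule: nat.exhaust)
      case (Suc m)
      then show ?thesis by (cases m) (simp_all add: pcompose_pCons pCons.IH)
    qed (simp add: pcompose_pCons)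
  qed simp
  show ?thesis
    by (rule poly_eqI) (auto simp: c coeff_pCons elim!: evenE split: nat.split)
qed

lemma cp_pcompose: "cp (pcompose p q) = pcompose (cp p) (cp q)"
  by (induction p) (simp_all add: cp_pCons pcompose_pCons cp_mult cp_add)

lemma cp_parity:
  "cp p = pcompose (cp (even_part p)) [:0, 0, 1:] + pCons 0 (pcompose (cp (odd_part p)) [:0, 0, 1:])"
  using arg_cong[OF parity_decomposition[of p], of cp] by (simp add: cp_add cp_pCons cp_pcompose)

lemma poly_parity:
  "poly (cp p) y = poly (cp (even_part p)) (y\<^sup>2) + y * poly (cp (odd_part p)) (y\<^sup>2)"
  using arg_cong[OF cp_parity[of p], of "\<lambda>q. poly q y"] by (simp add: poly_pcompose power2_eq_square)

lemma poly_pderiv_parity: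
  "poly (pderiv (cp p)) y = 2 * y * poly (pderiv (cp (even_part p))) (y\<^sup>2)
     + poly (cp (odd_part p)) (y\<^sup>2) + 2 * y\<^sup>2 * poly (pderiv (cp (odd_part p))) (y\<^sup>2)"
  using arg_cong[OF cp_parity[of p], of "\<lambda>q. poly (pderiv q) y"]
  by (simp add: poly_pcompose power2_eq_square pderiv_add pderiv_pCons pderiv_pcompose algebra_simps)

definition hurwitz :: "real poly \<Rightarrow> bool" where
  "hurwitz p \<longleftrightarrow> p \<noteq> 0 \<and> (\<forall>y. 0 \<le> Re y \<longrightarrow> poly (cp p) y \<noteq> 0)"

lemma hurwitz_factorization:
  assumes "hurwitz p"
  obtains A where "cp p = Polynomial.smult (of_real (lead_coeff p)) (\<Prod>x\<in>#A. [:- x, 1:])"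
    "size A = degree p" "\<And>x. x \<in># A \<Longrightarrow> Re x < 0"
proof -
  have "cp p \<noteq> 0" using assms by (simp add: hurwitz_def)
  from alg_closed_imp_factorization[OF this]
  obtain A where A: "size A = degree (cp p)" "cp p = Polynomial.smult (lead_coeff (cp p)) (\<Prod>x\<in>#A. [:- x, 1:])"
    by blast
  have "Re x < 0" if "x \<in># A" for x
  proof (rule ccontr)
    assume "\<not> Re x < 0"
    have "poly (\<Prod>x\<in>#A. [:- x, 1:]) x = 0"
      using that by (subst multi_member_split[OF that, THEN exE]) auto
    then have "poly (cp p) x = 0" by (subst A(2)) simp
    then show False using assms \<open>\<not> Re x < 0\<close> by (auto simp: hurwitz_def)
  qed
  then show ?thesis using A by (intro that[of A]) (auto simp: coeff_map_poly)
qed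

text \<open>
Factor by factor: a point of the right half-plane is farther than its mirror image from every root in
the left half-plane. The roots come in conjugate pairs, so \<open>- y\<close> may replace the mirror image \<open>- cnj y\<close>.
\<close>

lemma hurwitz_reflection_less:
  assumes "hurwitz p" "degree p > 0" "Re y > 0"
  shows "cmod (poly (cp p) (- y)) < cmod (poly (cp p) y)"
proof -
  from hurwitz_factorization[OF assms(1)] obtain A where
    A: "cp p = Polynomial.smult (of_real (lead_coeff p)) (\<Prod>x\<in>#A. [:- x, 1:])"
      "size A = degree p" "\<And>x. x \<in># A \<Longrightarrow> Re x < 0" by blast
  have less: "cmod (- cnj y - x) < cmod (y - x)" if "Re x < 0" for x
  proof -
    have "(cmod (- cnj y - x))\<^sup>2 < (cmod (y - x))\<^sup>2"
    proof -
      have "0 < Re y * (- Re x)" using that assms(3) by (intro mult_pos_pos) auto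
      then show ?thesis unfolding cmod_power2 by (simp add: power2_eq_square algebra_simps)
    qed
    then show ?thesis by (rule power_less_imp_less_base) simp
  qed
  have "cmod (poly (\<Prod>x\<in>#B. [:- x, 1:]) (- cnj y)) < cmod (poly (\<Prod>x\<in>#B. [:- x, 1:]) y) \<or> B = {#}"
    if "\<And>x. x \<in># B \<Longrightarrow> Re x < 0" for B
    using that
  proof (induction B)
    case (add x B)
    have lt: "cmod (- cnj y - x) < cmod (y - x)" using add.prems by (intro less) auto
    have IH: "cmod (poly (\<Prod>x\<in>#B. [:- x, 1:]) (- cnj y)) < cmod (poly (\<Prod>x\<in>#B. [:- x, 1:]) y) \<or> B = {#}"
      using add by auto
    then have "cmod (poly (\<Prod>x\<in>#B. [:- x, 1:]) (- cnj y)) * cmod (- cnj y - x)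
      < cmod (poly (\<Prod>x\<in>#B. [:- x, 1:]) y) * cmod (y - x)"
    proof
      assume "B = {#}"
      then show ?thesis using lt by simp
    next
      assume "cmod (poly (\<Prod>x\<in>#B. [:- x, 1:]) (- cnj y)) < cmod (poly (\<Prod>x\<in>#B. [:- x, 1:]) y)"
      then show ?thesis using lt by (intro mult_strict_mono) (auto intro: le_less_trans[OF norm_ge_zero])
    qed
    moreover have "poly (\<Prod>x\<in>#add_mset x B. [:- x, 1:]) w = poly (\<Prod>x\<in>#B. [:- x, 1:]) w * (w - x)" for w
      by (simp only: image_mset_add_mset prod_mset.add_mset poly_mult) simp
    ultimately show ?case by (simp only: norm_mult simp_thms)
  qed simp
  from this[of A] A assms(2) have
    "cmod (poly (\<Prod>x\<in>#A. [:- x, 1:]) (- cnj y)) < cmod (poly (\<Prod>x\<in>#A. [:- x, 1:]) y)" by auto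
  then have "cmod (poly (cp p) (- cnj y)) < cmod (poly (cp p) y)"
    using assms(1) by (subst (1 2) A(1)) (auto simp: norm_mult hurwitz_def)
  also have "- cnj y = cnj (- y)" by simp
  finally show ?thesis by (simp only: poly_cp_cnj complex_mod_cnj)
qed

text \<open>
Each summand \<open>1 / (y - x)\<close> of the logarithmic derivative has positive real part when \<open>Re x < Re y\<close>.
\<close>

lemma hurwitz_log_derivative_pos:
  assumes "hurwitz p" "degree p > 0" "Re y = 0"
  shows "Re (poly (pderiv (cp p)) y / poly (cp p) y) > 0"
proof -
  from hurwitz_factorization[OF assms(1)] obtain A where
    A: "cp p = Polynomial.smult (of_real (lead_coeff p)) (\<Prod>x\<in>#A. [:- x, 1:])"
      "size A = degree p" "\<And>x. x \<in># A \<Longrightarrow> Re x < 0" by blast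
  have "poly (\<Prod>x\<in>#B. [:- x, 1:]) y \<noteq> 0 \<and>
     (0 < Re (poly (pderiv (\<Prod>x\<in>#B. [:- x, 1:])) y / poly (\<Prod>x\<in>#B. [:- x, 1:]) y) \<or> B = {#})"
    if "\<And>x. x \<in># B \<Longrightarrow> Re x < 0" for B
    using that
  proof (induction B)
    case (add x B)
    let ?P = "\<Prod>x\<in>#B. [:- x, 1:]"
    have IH: "poly ?P y \<noteq> 0" "0 < Re (poly (pderiv ?P) y / poly ?P y) \<or> B = {#}" using add by auto
    have x: "Re x < 0" using add.prems by auto
    then have yx: "y - x \<noteq> 0" using assms(3) by (auto simp: complex_eq_iff)
    have pos: "Re (1 / (y - x)) > 0"
    proof -
      have "0 < (Re x)\<^sup>2 + (Im y - Im x)\<^sup>2" using x by (simp add: sum_power2_gt_zero_iff)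
      then have "Re x / ((Re x)\<^sup>2 + (Im y - Im x)\<^sup>2) < 0" using x by (intro divide_neg_pos)
      then show ?thesis using assms(3) by (simp add: Re_divide)
    qed
    have "poly (pderiv (?P * [:- x, 1:])) y / poly (?P * [:- x, 1:]) y = poly (pderiv ?P) y / poly ?P y + 1 / (y - x)"
    proof -
      have "poly (pderiv (?P * [:- x, 1:])) y = poly ?P y + (y - x) * poly (pderiv ?P) y"
        by (simp only: pderiv_mult poly_add poly_mult) (simp add: pderiv_pCons)
      moreover have "poly (?P * [:- x, 1:]) y = poly ?P y * (y - x)" by (simp only: poly_mult) simp
      ultimately show ?thesis using IH(1) yx by (simp add: field_simps)
    qed
    then have "0 < Re (poly (pderiv (?P * [:- x, 1:])) y / poly (?P * [:- x, 1:]) y)"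
      using IH(2) pos by auto
    moreover have "(\<Prod>x\<in>#add_mset x B. [:- x, 1:]) = ?P * [:- x, 1:]" by (simp add: mult.commute)
    moreover have "poly (?P * [:- x, 1:]) y \<noteq> 0" using IH(1) yx by (simp only: poly_mult) simp
    ultimately show ?case by metis
  qed simp
  from this[of A] A assms(2) have
    "0 < Re (poly (pderiv (\<Prod>x\<in>#A. [:- x, 1:])) y / poly (\<Prod>x\<in>#A. [:- x, 1:]) y)" by auto
  then show ?thesis
    using assms(1) by (subst (1 2) A(1)) (auto simp: pderiv_smult hurwitz_def)
qed

lemma real_point_of_imaginary_square:
  assumes "Re y = 0"
  shows "y\<^sup>2 = of_real (- (Im y)\<^sup>2)" "y = \<i> * of_real (Im y)"
  using assms by (auto simp: complex_eq_iff power2_eq_square)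

text \<open>
Write \<open>p(y) = E(y\<^sup>2) + y O(y\<^sup>2)\<close>. If \<open>E(y\<^sup>2) = 0\<close>, then \<open>p(y)\<close> and \<open>p(- y)\<close> have the same modulus, and
the strict reflection inequality forces \<open>y\<close> onto the imaginary axis, that is, \<open>y\<^sup>2\<close> onto the negative
axis. At a double root of \<open>E\<close> the logarithmic derivative of \<open>p\<close> would be purely imaginary.
\<close>

theorem hermite_biehler_even:
  assumes "hurwitz p"
  shows "neg_simple (even_part p)"
proof (cases "degree p = 0")
  case True
  have "even_part p = [:coeff p 0:]" by (simp add: even_part_def True monom_altdef)
  moreover have "coeff p 0 \<noteq> 0" using True assms by (metis hurwitz_def leading_coeff_0_iff)
  ultimately show ?thesis unfolding neg_simple_def by (intro exI[of _ "{}"] exI[of _ "coeff p 0"]) simp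
next
  case False
  then have deg: "degree p > 0" by simp
  have "poly (cp p) 0 \<noteq> 0" using assms by (auto simp: hurwitz_def)
  then have c0: "coeff p 0 \<noteq> 0" by (simp add: poly_0_coeff_0 coeff_map_poly)
  let ?E = "even_part p" and ?O = "odd_part p"
  show ?thesis
  proof (rule neg_simpleI)
    show "?E \<noteq> 0"
    proof
      assume "?E = 0"
      then have "coeff ?E 0 = 0" by (simp only: coeff_0)
      with c0 show False by simp
    qed
    fix z assume z: "poly (cp ?E) z = 0"
    define y where "y = csqrt z"
    have y2: "y\<^sup>2 = z" and Rey: "Re y \<ge> 0" using csqrt_principal[of z] by (auto simp: y_def)
    have z0: "z \<noteq> 0"
    proof
      assume "z = 0"
      with z have "coeff ?E 0 = 0" by (simp add: poly_0_coeff_0 coeff_map_poly)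
      with c0 show False by simp
    qed
    have py: "poly (cp p) y = y * poly (cp ?O) z" "poly (cp p) (- y) = - y * poly (cp ?O) z"
      using poly_parity[of p y] poly_parity[of p "- y"] z by (simp_all add: y2)
    have "Re y = 0"
    proof (rule ccontr)
      assume "Re y \<noteq> 0"
      then show False using hurwitz_reflection_less[OF assms deg, of y] Rey py by (simp add: norm_mult)
    qed
    note im = real_point_of_imaginary_square[OF this]
    define w where "w = - (Im y)\<^sup>2"
    have zw: "z = of_real w" using im(1) y2 by (simp add: w_def)
    have w: "w < 0" using z0 zw by (auto simp: w_def)
    have O: "poly ?O w \<noteq> 0" and yn: "y \<noteq> 0"
      using assms py(1) Rey by (auto simp: hurwitz_def zw poly_cp_real)
    have "poly (pderiv ?E) w \<noteq> 0"
    proof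
      assume 0: "poly (pderiv ?E) w = 0"
      have "poly (pderiv (cp p)) y = of_real (poly ?O w + 2 * w * poly (pderiv ?O) w)"
        unfolding poly_pderiv_parity[of p y] y2 zw unfolding cp_pderiv[symmetric] poly_cp_real 0 by simp
      moreover have "poly (cp p) y = \<i> * of_real (Im y * poly ?O w)"
        by (simp only: py(1) zw poly_cp_real) (subst im(2), simp)
      ultimately have "Re (poly (pderiv (cp p)) y / poly (cp p) y) = 0"
        by (simp add: Re_divide)
      then show False using hurwitz_log_derivative_pos[OF assms deg \<open>Re y = 0\<close>] by simp
    qed
    then have "poly (pderiv (cp ?E)) z \<noteq> 0" by (simp add: zw poly_cp_real flip: cp_pderiv)
    then show "Im z = 0 \<and> Re z < 0 \<and> poly (pderiv (cp ?E)) z \<noteq> 0" using zw w by simp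
  qed
qed

text \<open>
The same argument as for the even part; the degree must be positive for the odd part to be nonzero.
\<close>

theorem hermite_biehler_odd:
  assumes "hurwitz p" "degree p > 0"
  shows "neg_simple (odd_part p)"
proof -
  note deg = assms(2)
  let ?E = "even_part p" and ?O = "odd_part p"
  have c1: "coeff p 1 \<noteq> 0"
  proof
    assume "coeff p 1 = 0"
    then have "poly (pderiv (cp p)) 0 = 0"
      by (simp add: poly_0_coeff_0 coeff_pderiv coeff_map_poly)
    then show False using hurwitz_log_derivative_pos[OF assms, of 0] by simp
  qed
  show ?thesis
  proof (rule neg_simpleI)
    show "?O \<noteq> 0"
    proof
      assume "?O = 0"
      then have "coeff ?O 0 = 0" by (simp only: coeff_0)
      with c1 show False by simp
    qed
    fix z assume z: "poly (cp ?O) z = 0"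
    define y where "y = csqrt z"
    have y2: "y\<^sup>2 = z" and Rey: "Re y \<ge> 0" using csqrt_principal[of z] by (auto simp: y_def)
    have z0: "z \<noteq> 0"
    proof
      assume "z = 0"
      with z have "coeff ?O 0 = 0" by (simp add: poly_0_coeff_0 coeff_map_poly)
      with c1 show False by simp
    qed
    have py: "poly (cp p) y = poly (cp ?E) z" "poly (cp p) (- y) = poly (cp ?E) z"
      using poly_parity[of p y] poly_parity[of p "- y"] z by (simp_all add: y2)
    have "Re y = 0"
    proof (rule ccontr)
      assume "Re y \<noteq> 0"
      then show False using hurwitz_reflection_less[OF assms, of y] Rey py by (simp add: norm_mult)
    qed
    note im = real_point_of_imaginary_square[OF this]
    define w where "w = - (Im y)\<^sup>2"
    have zw: "z = of_real w" using im(1) y2 by (simp add: w_def)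
    have w: "w < 0" using z0 zw by (auto simp: w_def)
    have E: "poly ?E w \<noteq> 0"
      using assms py(1) Rey by (auto simp: hurwitz_def zw poly_cp_real)
    have zO: "poly ?O w = 0" using z by (simp add: zw poly_cp_real)
    have "poly (pderiv ?O) w \<noteq> 0"
    proof
      assume 0: "poly (pderiv ?O) w = 0"
      have "poly (pderiv (cp p)) y = 2 * y * of_real (poly (pderiv ?E) w)"
        unfolding poly_pderiv_parity[of p y] y2 zw unfolding cp_pderiv[symmetric] poly_cp_real 0 zO by simp
      also have "\<dots> = \<i> * of_real (2 * Im y * poly (pderiv ?E) w)"
        by (subst im(2)) simp
      finally have "poly (pderiv (cp p)) y = \<i> * of_real (2 * Im y * poly (pderiv ?E) w)" .
      moreover have "poly (cp p) y = of_real (poly ?E w)"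
        by (simp only: py(1) zw poly_cp_real)
      ultimately have "Re (poly (pderiv (cp p)) y / poly (cp p) y) = 0"
        by (simp add: Re_divide)
      then show False using hurwitz_log_derivative_pos[OF assms \<open>Re y = 0\<close>] by simp
    qed
    then have "poly (pderiv (cp ?O)) z \<noteq> 0" by (simp add: zw poly_cp_real flip: cp_pderiv)
    then show "Im z = 0 \<and> Re z < 0 \<and> poly (pderiv (cp ?O)) z \<noteq> 0" using zw w by simp
  qed
qed

lemma cmod_prod_mset_ge:
  assumes "\<And>x. x \<in># A \<Longrightarrow> r \<le> cmod (y - x)" "0 \<le> r"
  shows "r ^ size A \<le> cmod (poly (\<Prod>x\<in>#A. [:- x, 1:]) y)"
  using assms(1)
proof (induction A)
  case (add x A)
  have "poly (\<Prod>x\<in>#add_mset x A. [:- x, 1:]) y = (y - x) * poly (\<Prod>x\<in>#A. [:- x, 1:]) y"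
    by (simp only: image_mset_add_mset prod_mset.add_mset poly_mult) simp
  moreover have "r * r ^ size A \<le> cmod (y - x) * cmod (poly (\<Prod>x\<in>#A. [:- x, 1:]) y)"
    using add assms(2) by (intro mult_mono) auto
  ultimately show ?case by (simp add: norm_mult)
qed simp

text \<open>
Suppose that there are zeros in the closed right half-plane for some parameter, and consider the last
such parameter \<open>bs\<close>, with zero \<open>ys\<close> off the axis. For every later parameter all zeros lie to the left,
so each linear factor at \<open>ys\<close> has modulus at least \<open>Re ys\<close>. This lower bound survives in the limit
and contradicts the vanishing at \<open>bs\<close>. Continuity of individual zeros is thus never needed.
\<close>

theorem hurwitz_homotopy:
  fixes c :: "nat \<Rightarrow> real \<Rightarrow> real"
  assumes cont: "\<And>j. j \<le> N \<Longrightarrow> continuous_on {b0..b1} (c j)"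
    and lead: "\<And>b. b \<in> {b0..b1} \<Longrightarrow> c N b \<noteq> 0"
    and axis: "\<And>b w. b \<in> {b0..b1} \<Longrightarrow> (\<Sum>j\<le>N. of_real (c j b) * (\<i> * of_real w) ^ j) \<noteq> 0"
    and start: "\<And>y. 0 < Re y \<Longrightarrow> (\<Sum>j\<le>N. of_real (c j b1) * y ^ j) \<noteq> 0"
    and b: "b \<in> {b0..b1}" and y: "0 \<le> Re y"
  shows "(\<Sum>j\<le>N. of_real (c j b) * y ^ j) \<noteq> 0"
proof
  define F where "F = (\<lambda>b y. \<Sum>j\<le>N. complex_of_real (c j b) * y ^ j)"
  assume "(\<Sum>j\<le>N. of_real (c j b) * y ^ j) = 0"
  then have Fby: "F b y = 0" by (simp add: F_def)
  have axis': "Re y \<noteq> 0" if "b \<in> {b0..b1}" "F b y = 0" for b y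
  proof
    assume "Re y = 0"
    then have "y = \<i> * of_real (Im y)" by (simp add: complex_eq_iff)
    then show False using axis[OF that(1), of "Im y"] that(2) by (simp add: F_def)
  qed
  have "continuous_on {b0..b1} (\<lambda>b. (\<Sum>j<N. \<bar>c j b\<bar>) / \<bar>c N b\<bar>)"
    using lead by (intro continuous_intros cont) auto
  then have "bounded ((\<lambda>b. (\<Sum>j<N. \<bar>c j b\<bar>) / \<bar>c N b\<bar>) ` {b0..b1})"
    by (intro compact_imp_bounded compact_continuous_image) auto
  then obtain M where M: "\<And>b. b \<in> {b0..b1} \<Longrightarrow> (\<Sum>j<N. \<bar>c j b\<bar>) / \<bar>c N b\<bar> \<le> M"
    unfolding bounded_iff by fastforce
  define R where "R = max 1 M"
  have bound: "cmod y \<le> R" if b: "b \<in> {b0..b1}" and F0: "F b y = 0" for b y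
  proof (cases "cmod y \<le> 1")
    case False
    then have y1: "1 < cmod y" by simp
    have "N \<noteq> 0" using F0 lead[OF b] by (auto simp: F_def intro!: Nat.gr0I)
    then obtain n where n: "N = Suc n" by (cases N) auto
    have "of_real (c N b) * y ^ N = - (\<Sum>j<N. of_real (c j b) * y ^ j)"
      using F0 by (simp add: F_def lessThan_Suc_atMost[symmetric] eq_neg_iff_add_eq_0 add.commute)
    then have "\<bar>c N b\<bar> * cmod y ^ N = cmod (\<Sum>j<N. of_real (c j b) * y ^ j)"
      by (metis norm_minus_cancel norm_mult norm_of_real norm_power)
    also have "\<dots> \<le> (\<Sum>j<N. \<bar>c j b\<bar> * cmod y ^ n)"
      using y1 by (intro order.trans[OF norm_sum] sum_mono)
        (auto simp: norm_mult norm_power n intro!: mult_left_mono power_increasing)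
    finally have "\<bar>c N b\<bar> * cmod y * cmod y ^ n \<le> (\<Sum>j<N. \<bar>c j b\<bar>) * cmod y ^ n"
      by (simp add: n mult_ac flip: sum_distrib_right del: sum.lessThan_Suc)
    then have "\<bar>c N b\<bar> * cmod y \<le> (\<Sum>j<N. \<bar>c j b\<bar>)"
    proof (rule mult_right_le_imp_le)
      show "0 < cmod y ^ n" using y1 by (intro zero_less_power) linarith
    qed
    then have "cmod y \<le> (\<Sum>j<N. \<bar>c j b\<bar>) / \<bar>c N b\<bar>"
      using lead[OF b] by (simp add: le_divide_eq mult.commute)
    then show ?thesis using M[OF b] by (simp add: R_def)
  qed (simp add: R_def)
  define S where "S = {b0..b1} \<times> (cball 0 R \<inter> {y. 0 \<le> Re y})"
  define K where "K = S \<inter> (\<lambda>p. F (fst p) (snd p)) -` {0}"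
  have compS: "compact S" unfolding S_def
    by (intro compact_Times compact_Int_closed closed_halfspace_Re_ge) auto
  have contF: "continuous_on S (\<lambda>p. F (fst p) (snd p))"
    unfolding F_def S_def
    by (intro continuous_intros continuous_on_compose2[OF cont continuous_on_fst]) auto
  have "closed K" unfolding K_def using compS
    by (intro continuous_closed_preimage contF compact_imp_closed) auto
  then have "compact K" using compS unfolding K_def by (metis compact_Int_closed inf.left_idem)
  then have comp: "compact (fst ` K)" by (intro compact_continuous_image continuous_on_fst continuous_on_id)
  have "(b, y) \<in> K" using b y Fby bound[OF b Fby] by (simp add: K_def S_def)
  then have "fst ` K \<noteq> {}" by blast
  from compact_attains_sup[OF comp this] obtain bs where bs: "bs \<in> fst ` K" "\<forall>t\<in>fst ` K. t \<le> bs" by blast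
  then obtain ys where ys: "(bs, ys) \<in> K" by auto
  then have bsI: "bs \<in> {b0..b1}" and Fys: "F bs ys = 0" and "0 \<le> Re ys" by (auto simp: K_def S_def)
  then have Reys: "0 < Re ys" using axis'[OF bsI Fys] by simp
  have "bs \<noteq> b1" using start[OF Reys] Fys by (auto simp: F_def)
  then have less: "bs < b1" using bsI by simp
  have lower: "\<bar>c N t\<bar> * Re ys ^ N \<le> cmod (F t ys)" if t: "t \<in> {bs<..b1}" for t
  proof -
    have tI: "t \<in> {b0..b1}" using t bsI by auto
    define p where "p = (\<Sum>j\<le>N. monom (complex_of_real (c j t)) j)"
    have poly_p: "poly p z = F t z" for z by (simp add: p_def F_def poly_sum poly_monom)
    have coeff_p: "coeff p j = (if j \<le> N then of_real (c j t) else 0)" for j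
      by (simp add: p_def coeff_sum)
    have degp: "degree p = N"
      using lead[OF tI] by (intro antisym degree_le le_degree) (auto simp: coeff_p)
    then have "p \<noteq> 0" using lead[OF tI] coeff_p[of N] by auto
    from alg_closed_imp_factorization[OF this] obtain A where
      A: "size A = N" "p = Polynomial.smult (of_real (c N t)) (\<Prod>x\<in>#A. [:- x, 1:])"
      by (auto simp: degp coeff_p)
    have "Re ys \<le> cmod (ys - x)" if "x \<in># A" for x
    proof -
      have "poly p x = 0"
        using that by (subst A(2)) (auto dest: multi_member_split)
      then have F0: "F t x = 0" by (simp add: poly_p)
      have "Re x < 0"
      proof (rule ccontr)
        assume "\<not> Re x < 0"
        then have "(t, x) \<in> K" using tI F0 bound[OF tI F0] by (simp add: K_def S_def)
        then show False using bs(2) t by force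
      qed
      then show ?thesis using complex_Re_le_cmod[of "ys - x"] by simp
    qed
    then have "Re ys ^ N \<le> cmod (poly (\<Prod>x\<in>#A. [:- x, 1:]) ys)"
      using cmod_prod_mset_ge[of A "Re ys" ys] Reys A(1) by simp
    moreover have "cmod (F t ys) = \<bar>c N t\<bar> * cmod (poly (\<Prod>x\<in>#A. [:- x, 1:]) ys)"
      by (simp only: poly_p[symmetric]) (subst A(2), simp add: norm_mult)
    ultimately show ?thesis by (simp add: mult_left_mono)
  qed
  let ?flt = "at bs within {bs..b1}"
  have nt: "?flt \<noteq> bot" using less by (simp add: at_within_Icc_at_right)
  have lim_c: "((c j) \<longlongrightarrow> c j bs) ?flt" if "j \<le> N" for j
  proof (rule tendsto_within_subset)
    show "((c j) \<longlongrightarrow> c j bs) (at bs within {b0..b1})"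
      using cont[OF that] bsI by (auto simp: continuous_on_def)
  qed (use bsI in auto)
  have "((\<lambda>t. \<bar>c N t\<bar> * Re ys ^ N) \<longlongrightarrow> \<bar>c N bs\<bar> * Re ys ^ N) ?flt"
    by (intro tendsto_intros lim_c) simp
  moreover have "((\<lambda>t. cmod (F t ys)) \<longlongrightarrow> cmod (F bs ys)) ?flt"
    unfolding F_def by (intro tendsto_intros lim_c) simp
  moreover have "eventually (\<lambda>t. \<bar>c N t\<bar> * Re ys ^ N \<le> cmod (F t ys)) ?flt"
    using lower by (auto simp: eventually_at_filter)
  ultimately have "\<bar>c N bs\<bar> * Re ys ^ N \<le> cmod (F bs ys)"
    using tendsto_le[OF nt] by blast
  then have "\<bar>c N bs\<bar> * Re ys ^ N \<le> 0" using Fys by simp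
  moreover have "\<bar>c N bs\<bar> * Re ys ^ N > 0" using lead[OF bsI] Reys by simp
  ultimately show False by simp
qed

section \<open>Integrals of polynomials against Jacobi weights\<close>

lemma poly_linear_induct:
  assumes "\<And>p q. P p \<Longrightarrow> P q \<Longrightarrow> P (p + q)" "\<And>c k. P (monom c k)"
  shows "P (p :: 'a::comm_ring_1 poly)"
proof -
  have "P (\<Sum>i\<in>A. monom (coeff p i) i)" if "finite A" for A
    using that by (induction A rule: finite_induct) (use assms assms(2)[of 0 0] in \<open>auto\<close>)
  from this[of "{..degree p}"] show ?thesis by (simp add: poly_as_sum_of_monoms)
qed

text \<open>
The integral of a polynomial against the Jacobi weight \<open>t^(a - 1) (1 - t)^(b - 1)\<close> on the unit interval.
\<close>

definition jac :: "real \<Rightarrow> real \<Rightarrow> real poly \<Rightarrow> real" where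
  "jac a b h = integral {0..1} (\<lambda>t. poly h t * (t powr (a - 1) * (1 - t) powr (b - 1)))"

lemma jac_has_integral:
  assumes "a > 0" "b > 0"
  shows "((\<lambda>t. poly h t * (t powr (a - 1) * (1 - t) powr (b - 1))) has_integral
           (\<Sum>k\<le>degree h. coeff h k * Beta (a + real k) b)) {0..1}"
proof -
  have "((\<lambda>t. \<Sum>k\<le>degree h. coeff h k * (t powr (a + real k - 1) * (1 - t) powr (b - 1))) has_integral
           (\<Sum>k\<le>degree h. coeff h k * Beta (a + real k) b)) {0..1}"
    using assms by (intro has_integral_sum has_integral_mult_right has_integral_Beta_real) auto
  then show ?thesis
  proof (rule has_integral_eq[rotated])
    fix t :: real assume "t \<in> {0..1}"
    then have "t powr (a + real k - 1) = t ^ k * t powr (a - 1)" for k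
      by (cases "t = 0") (auto simp: powr_add[symmetric] powr_realpow[symmetric] algebra_simps)
    then show "(\<Sum>k\<le>degree h. coeff h k * (t powr (a + real k - 1) * (1 - t) powr (b - 1))) =
      poly h t * (t powr (a - 1) * (1 - t) powr (b - 1))"
      by (simp add: poly_altdef sum_distrib_left sum_distrib_right mult_ac)
  qed
qed

lemma jac_integrable:
  "(a::real) > 0 \<Longrightarrow> (b::real) > 0 \<Longrightarrow> (\<lambda>t. poly h t * (t powr (a - 1) * (1 - t) powr (b - 1))) integrable_on {0..1}"
  using jac_has_integral[of a b h] by (auto simp: integrable_on_def)

lemma jac_add: "a > 0 \<Longrightarrow> b > 0 \<Longrightarrow> jac a b (g + h) = jac a b g + jac a b h"
  unfolding jac_def by (subst integral_add[symmetric]) (auto intro: jac_integrable simp: algebra_simps)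

lemma jac_smult: "jac a b (Polynomial.smult c h) = c * jac a b h"
  unfolding jac_def by (subst integral_mult_right[symmetric]) (simp add: mult_ac)

lemma jac_diff: "a > 0 \<Longrightarrow> b > 0 \<Longrightarrow> jac a b (g - h) = jac a b g - jac a b h"
  using jac_add[of a b g "Polynomial.smult (-1) h"] jac_smult[of a b "-1" h] by simp

lemma jac_0 [simp]: "jac a b 0 = 0" by (simp add: jac_def)

lemma jac_sum: "a > 0 \<Longrightarrow> b > 0 \<Longrightarrow> jac a b (sum f A) = (\<Sum>x\<in>A. jac a b (f x))"
  by (induction A rule: infinite_finite_induct) (auto simp: jac_add)

lemma jac_coeffs: "a > 0 \<Longrightarrow> b > 0 \<Longrightarrow> jac a b h = (\<Sum>k\<le>degree h. coeff h k * Beta (a + real k) b)"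
  unfolding jac_def by (rule integral_unique[OF jac_has_integral])

lemma jac_monom: "a > 0 \<Longrightarrow> b > 0 \<Longrightarrow> jac a b (monom c k) = c * Beta (a + real k) b"
  by (cases "c = 0") (auto simp: jac_coeffs degree_monom_eq intro!: sum.neutral trans[OF sum.remove[of _ k]])

lemma jac_shift_left: "jac a b (pCons 0 h) = jac (a + 1) b h"
  unfolding jac_def
proof (rule integral_cong)
  fix t :: real assume "t \<in> {0..1}"
  then have "t * t powr (a - 1) = t powr a"
    by (cases "t = 0") (auto simp: powr_mult_base)
  then show "poly (pCons 0 h) t * (t powr (a - 1) * (1 - t) powr (b - 1)) =
    poly h t * (t powr (a + 1 - 1) * (1 - t) powr (b - 1))"
    by (simp add: mult_ac)
qed

lemma jac_shift_right: "jac a b ([:1, -1:] * h) = jac a (b + 1) h"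
  unfolding jac_def
proof (rule integral_cong)
  fix t :: real assume "t \<in> {0..1}"
  then have 1: "(1 - t) * (1 - t) powr (b - 1) = (1 - t) powr b"
    by (cases "t = 1") (auto simp: powr_mult_base)
  have "poly ([:1, -1:] * h) t = (1 - t) * poly h t" by (simp add: algebra_simps)
  then have "poly ([:1, -1:] * h) t * (t powr (a - 1) * (1 - t) powr (b - 1)) =
    poly h t * (t powr (a - 1) * ((1 - t) * (1 - t) powr (b - 1)))" by (simp only: mult_ac)
  then show "poly ([:1, -1:] * h) t * (t powr (a - 1) * (1 - t) powr (b - 1)) =
    poly h t * (t powr (a - 1) * (1 - t) powr (b + 1 - 1))"
    using 1 by simp
qed

lemma jac_shift_right_power: "jac a b (h * [:1, -1:] ^ k) = jac a (b + real k) h"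
proof (induction k arbitrary: b)
  case (Suc k)
  have "jac a b (h * [:1, -1:] ^ Suc k) = jac a b ([:1, -1:] * (h * [:1, -1:] ^ k))"
    by (simp only: power_Suc mult_ac)
  then show ?case by (simp only: jac_shift_right Suc) (simp add: algebra_simps)
qed simp

lemma jac_nonneg:
  assumes "a > 0" "b > 0" "\<And>t. 0 < t \<Longrightarrow> t < 1 \<Longrightarrow> 0 \<le> poly h t"
  shows "0 \<le> jac a b h"
proof -
  have "jac a b h = integral {0<..<1} (\<lambda>t. poly h t * (t powr (a - 1) * (1 - t) powr (b - 1)))"
    unfolding jac_def by (rule integral_open_interval_real)
  also have "\<dots> \<ge> 0" using assms(3) by (intro integral_nonneg integrable_on_Icc_iff_Ioo[THEN iffD1] jac_integrable assms) auto
  finally show ?thesis .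
qed

lemma jac_pos:
  assumes "a > 0" "b > 0" "\<And>t. 0 < t \<Longrightarrow> t < 1 \<Longrightarrow> 0 \<le> poly h t" "h \<noteq> 0"
  shows "0 < jac a b h"
proof -
  let ?f = "\<lambda>t. poly h t * (t powr (a - 1) * (1 - t) powr (b - 1))"
  have int: "?f integrable_on {0..1}" by (rule jac_integrable[OF assms(1,2)])
  have intl: "?f integrable_on {0<..<1}" using int by (simp add: integrable_on_Icc_iff_Ioo)
  have "integral {1/4..3/4} ?f \<le> integral {0<..<1} ?f"
    using assms(3) by (intro integral_subset_le intl integrable_on_subinterval[OF int]) auto
  also have "\<dots> = jac a b h" unfolding jac_def by (rule integral_open_interval_real[symmetric])
  finally have le: "integral {1/4..3/4} ?f \<le> jac a b h" .
  have cont: "continuous_on {1/4..3/4} ?f" by (intro continuous_intros) auto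
  have nn: "0 \<le> integral {1/4..3/4} ?f"
    using assms(3) by (intro integral_nonneg integrable_continuous_real cont) auto
  have "integral {1/4..3/4} ?f \<noteq> 0"
  proof
    assume "integral {1/4..3/4} ?f = 0"
    then have int0: "(?f has_integral 0) (cbox (1/4) (3/4))"
      using integrable_integral[OF integrable_continuous_real[OF cont]] by simp
    have "poly h t = 0" if t: "t \<in> {1/4..3/4}" for t
    proof -
      have "?f t = 0"
      proof (rule has_integral_0_cbox_imp_0[OF _ _ int0])
        show "continuous_on (cbox (1/4) (3/4)) ?f" using cont by simp
        show "0 \<le> ?f x" if "x \<in> box (1/4) (3/4)" for x using that assms(3)[of x] by auto
      qed (use t in auto)
      moreover have "t powr (a - 1) \<noteq> 0" "(1 - t) powr (b - 1) \<noteq> 0" using t by auto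
      ultimately show ?thesis by (metis mult_eq_0_iff)
    qed
    then have "{1/4..3/4} \<subseteq> {t. poly h t = 0}" by auto
    then have "finite {1/4..3/4::real}" using poly_roots_finite[OF assms(4)] finite_subset by blast
    then show False by (simp add: infinite_Icc)
  qed
  then show ?thesis using le nn by linarith
qed

text \<open>
The integrand is the derivative of \<open>t^a (1 - t)^b h(t)\<close>, which vanishes at both ends. On monomials
this is the functional equation of the Beta function.
\<close>

lemma jac_integration_by_parts:
  assumes "a > 0" "b > 0"
  shows "jac a b (Polynomial.smult a ([:1, -1:] * h) - Polynomial.smult b (pCons 0 h) + pCons 0 ([:1, -1:] * pderiv h)) = 0"
proof (induction h rule: poly_linear_induct)
  case (1 p q)
  let ?E = "\<lambda>h. Polynomial.smult a ([:1, -1:] * h) - Polynomial.smult b (pCons 0 h) + pCons 0 ([:1, -1:] * pderiv h)"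
  have "?E (p + q) = ?E p + ?E q"
    by (rule poly_ext) (simp add: pderiv_add algebra_simps)
  then show ?case using 1 assms by (simp only: jac_add)
next
  case (2 c k)
  have eq: "Polynomial.smult a ([:1, -1:] * monom c k) - Polynomial.smult b (pCons 0 (monom c k))
      + pCons 0 ([:1, -1:] * pderiv (monom c k))
    = monom (c * (a + real k)) k - monom (c * (a + b + real k)) (Suc k)"
    by (rule poly_eqI) (auto simp: coeff_pCons pderiv_monom algebra_simps split: nat.splits)
  have "(a + real k + b) * Beta (a + real k + 1) b = (a + real k) * Beta (a + real k) b"
    using assms by (intro Beta_plus1_left) (auto dest: nonpos_Ints_nonpos)
  then have "c * ((a + real k + b) * Beta (a + real k + 1) b) = c * ((a + real k) * Beta (a + real k) b)"
    by simp
  then show ?case unfolding eq using assms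
    by (simp add: jac_diff jac_monom algebra_simps)
qed

lemma jac_derivative: "jac 1 1 (pderiv h) = poly h 1 - poly h 0"
proof (induction h rule: poly_linear_induct)
  case (1 p q)
  then show ?case by (simp add: pderiv_add jac_add)
next
  case (2 c k)
  show ?case
  proof (cases k)
    case (Suc j)
    have "(1 + real j) * Beta (1 + real j) 1 = 1"
    proof -
      define x where "x = 1 + real j"
      have "x > 0" by (simp add: x_def)
      then have "Gamma (x + 1) = x * Gamma x"
        by (intro Gamma_plus1) (auto dest: nonpos_Ints_nonpos)
      moreover have "Gamma x \<noteq> 0" using Gamma_real_pos[OF \<open>x > 0\<close>] by linarith
      ultimately show ?thesis using \<open>x > 0\<close> by (simp add: Beta_def flip: x_def)
    qed
    then show ?thesis by (simp add: pderiv_monom jac_monom Suc poly_monom mult_ac)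
  qed (simp add: pderiv_monom poly_monom)
qed

section \<open>A Jacobi polynomial and the resolvent of the derivative\<close>

text \<open>
The hypergeometric polynomial \<open>2F1(- N, N + 2 \<alpha> - 1; \<alpha> + 1; t)\<close>, up to a factor the Jacobi polynomial
with parameters \<open>(\<alpha>, \<alpha> - 2)\<close> at \<open>1 - 2 t\<close>. For \<open>\<alpha> \<le> 1\<close> its weight \<open>t^\<alpha> (1 - t)^(\<alpha> - 2)\<close> is not
integrable; this is why only integrals against less singular weights are used below, for which
orthogonality fails in the last few degrees.
\<close>

definition jacobi :: "nat \<Rightarrow> real \<Rightarrow> real poly" where
  "jacobi N \<alpha> = (\<Sum>j\<le>N. monom (pochhammer (- real N) j * pochhammer (real N + 2 * \<alpha> - 1) j
      / (fact j * pochhammer (\<alpha> + 1) j)) j)"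

lemma coeff_jacobi:
  "coeff (jacobi N \<alpha>) j = pochhammer (- real N) j * pochhammer (real N + 2 * \<alpha> - 1) j
      / (fact j * pochhammer (\<alpha> + 1) j)"
proof (cases "j \<le> N")
  case False
  then have "pochhammer (- real N) j = 0" by (simp add: pochhammer_of_nat_eq_0_iff)
  with False show ?thesis by (simp add: jacobi_def coeff_sum)
qed (simp add: jacobi_def coeff_sum)

lemma coeff_jacobi_Suc:
  assumes "\<alpha> > -1"
  shows "coeff (jacobi N \<alpha>) (Suc j) * ((\<alpha> + 1 + real j) * (real j + 1)) =
    coeff (jacobi N \<alpha>) j * ((real j - real N) * (real N + 2 * \<alpha> - 1 + real j))"
proof -
  have "pochhammer (\<alpha> + 1) j > 0" "\<alpha> + 1 + real j > 0" using assms by (auto intro: pochhammer_pos)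
  then show ?thesis by (simp add: coeff_jacobi pochhammer_Suc fact_Suc) (simp add: divide_simps)
qed

lemma degree_jacobi_le: "degree (jacobi N \<alpha>) \<le> N"
  by (rule degree_le) (simp add: coeff_jacobi pochhammer_of_nat_eq_0_iff)

lemma lead_jacobi:
  assumes "\<alpha> > -1" "N \<ge> 3 \<or> (N \<ge> 2 \<and> \<alpha> > - 1/2)"
  shows "(-1) ^ N * coeff (jacobi N \<alpha>) N > 0"
proof -
  have "pochhammer (- real N) N = (-1) ^ N * fact N" by (rule pochhammer_same)
  moreover have "pochhammer (real N + 2 * \<alpha> - 1) N > 0" using assms by (intro pochhammer_pos) auto
  moreover have "pochhammer (\<alpha> + 1) N > 0" using assms by (intro pochhammer_pos) auto
  ultimately show ?thesis by (simp add: coeff_jacobi)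
qed

lemma Beta_add_nat:
  assumes "a > 0" "c > (0::real)"
  shows "Beta (a + real j) c = Beta a c * pochhammer a j / pochhammer (a + c) j"
proof (induction j)
  case (Suc j)
  have "(a + real j + c) * Beta (a + real j + 1) c = (a + real j) * Beta (a + real j) c"
    using assms by (intro Beta_plus1_left) (auto dest: nonpos_Ints_nonpos)
  moreover have "a + real j + c > 0" "pochhammer (a + c) j > 0"
    using assms by (auto intro: pochhammer_pos)
  ultimately have "Beta (a + real j + 1) c = (a + real j) * Beta (a + real j) c / (a + real j + c)"
    by (simp add: field_simps)
  then show ?case by (simp add: Suc pochhammer_Suc mult_ac add_ac)
qed simp

text \<open>
Termwise integration leaves a terminating sum that the Chu-Vandermonde identity evaluates.
\<close>

lemma jac_jacobi:
  assumes "\<alpha> > -1" "c > 0"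
  shows "jac (\<alpha> + 1) c (jacobi N \<alpha>) =
    Beta (\<alpha> + 1) c * pochhammer (c + 2 - \<alpha> - real N) N / pochhammer (\<alpha> + 1 + c) N"
proof -
  have nz: "pochhammer (\<alpha> + 1) j \<noteq> 0" for j using assms by (intro less_imp_neq[symmetric] pochhammer_pos) auto
  have "jac (\<alpha> + 1) c (jacobi N \<alpha>) = (\<Sum>j\<le>N. pochhammer (- real N) j * pochhammer (real N + 2 * \<alpha> - 1) j
      / (fact j * pochhammer (\<alpha> + 1) j) * (Beta (\<alpha> + 1) c * pochhammer (\<alpha> + 1) j / pochhammer (\<alpha> + 1 + c) j))"
    unfolding jacobi_def using assms by (simp add: jac_sum jac_monom Beta_add_nat)
  also have "\<dots> = Beta (\<alpha> + 1) c * (\<Sum>j=0..N. pochhammer (real N + 2 * \<alpha> - 1) j * pochhammer (- real N) j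
      / (of_nat (fact j) * pochhammer (\<alpha> + 1 + c) j))"
    unfolding sum_distrib_left atMost_atLeast0 using nz by (intro sum.cong) (auto simp: field_simps)
  also have "(\<Sum>j=0..N. pochhammer (real N + 2 * \<alpha> - 1) j * pochhammer (- real N) j
      / (of_nat (fact j) * pochhammer (\<alpha> + 1 + c) j)) =
      pochhammer (\<alpha> + 1 + c - (real N + 2 * \<alpha> - 1)) N / pochhammer (\<alpha> + 1 + c) N"
    using assms by (intro Vandermonde_pochhammer) auto
  also have "\<alpha> + 1 + c - (real N + 2 * \<alpha> - 1) = c + 2 - \<alpha> - real N" by simp
  finally show ?thesis by simp
qed

lemma jac_jacobi_power:
  assumes "\<alpha> > -1" "c > 0"
  shows "jac (\<alpha> + 1) c (jacobi N \<alpha> * [:1, -1:] ^ k) =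
    Beta (\<alpha> + 1) (c + real k) * pochhammer (c + real k + 2 - \<alpha> - real N) N / pochhammer (\<alpha> + 1 + c + real k) N"
  using assms jac_jacobi[of \<alpha> "c + real k" N] by (simp add: jac_shift_right_power add_ac)

text \<open>
Powers of \<open>1 - t\<close> are the convenient test functions, because multiplying by one of them only shifts the
second weight parameter.
\<close>

lemma monom_eq_sum_reflected:
  "monom (1::real) k = (\<Sum>i\<le>k. Polynomial.smult (real (k choose i) * (-1) ^ i) ([:1, -1:] ^ i))"
proof (rule poly_ext)
  fix t :: real
  have "t ^ k = ((- (1 - t)) + 1) ^ k" by simp
  also have "\<dots> = (\<Sum>i\<le>k. real (k choose i) * (- (1 - t)) ^ i)"
    unfolding binomial_ring by simp
  also have "\<dots> = (\<Sum>i\<le>k. real (k choose i) * (-1) ^ i * (1 - t) ^ i)"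
    by (intro sum.cong refl) (metis mult.assoc power_minus)
  finally show "poly (monom 1 k) t = poly (\<Sum>i\<le>k. Polynomial.smult (real (k choose i) * (-1) ^ i) ([:1, -1:] ^ i)) t"
    by (simp add: poly_monom poly_sum)
qed

lemma jac_mult_monom:
  assumes "a > 0" "c > 0"
  shows "jac a c (R * monom 1 k) = (\<Sum>i\<le>k. real (k choose i) * (-1) ^ i * jac a c (R * [:1, -1:] ^ i))"
  unfolding monom_eq_sum_reflected[of k] using assms
  by (simp add: sum_distrib_left jac_sum jac_smult mult.assoc)

lemma jac_mult_coeffs:
  assumes "a > 0" "c > 0" "degree T \<le> N"
  shows "jac a c (R * T) = (\<Sum>k\<le>N. coeff T k * jac a c (R * monom 1 k))"
proof -
  have "T = (\<Sum>k\<le>N. Polynomial.smult (coeff T k) (monom 1 k))"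
    using poly_as_sum_of_monoms'[OF assms(3)] by (simp add: smult_monom)
  then have "R * T = (\<Sum>k\<le>N. Polynomial.smult (coeff T k) (R * monom 1 k))"
    by (metis (no_types, lifting) mult_smult_right sum.cong sum_distrib_left)
  then show ?thesis using assms by (simp add: jac_sum jac_smult)
qed

lemma pderiv_sum_gen: "pderiv (sum f A) = (\<Sum>x\<in>A. pderiv (f x))" for f :: "_ \<Rightarrow> 'a :: field_char_0 poly"
  by (induction A rule: infinite_finite_induct) (simp_all add: pderiv_add)

text \<open>
The solution of \<open>y + \<eta> y' = R\<close> is \<open>y = \<Sum> (- \<eta>)^j R^(j)\<close>; \<open>p\<close> and \<open>q\<close> are its real and imaginary parts.
Its value at \<open>0\<close> is a polynomial in \<open>\<eta>\<close> whose coefficients are prescribed by \<open>R\<close>, so a zero of that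
polynomial is the same as a solution vanishing at \<open>0\<close>.
\<close>

lemma resolvent:
  fixes R :: "real poly" and \<eta> :: complex
  assumes "degree R \<le> N"
  obtains p q where "degree p \<le> N" "degree q \<le> N"
    "p + Polynomial.smult (Re \<eta>) (pderiv p) - Polynomial.smult (Im \<eta>) (pderiv q) = R"
    "q + Polynomial.smult (Re \<eta>) (pderiv q) + Polynomial.smult (Im \<eta>) (pderiv p) = 0"
    "Complex (coeff p 0) (coeff q 0) = (\<Sum>j\<le>N. (- \<eta>) ^ j * of_real (fact j * coeff R j))"
proof -
  define D where "D = (\<lambda>j. (pderiv ^^ j) R)"
  have D_Suc: "pderiv (D j) = D (Suc j)" for j by (simp add: D_def)
  have DN: "D (Suc N) = 0"
    unfolding D_def by (rule poly_eqI) (use assms in \<open>simp only: coeff_higher_pderiv\<close>, simp add: coeff_eq_0)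
  have degD: "degree (D j) \<le> N" for j
    using assms by (simp add: D_def degree_higher_pderiv)
  define z where "z = (\<lambda>j. (- \<eta>) ^ j)"
  have Re_z: "Re (z (Suc j)) = - (Re \<eta> * Re (z j) - Im \<eta> * Im (z j))"
    and Im_z: "Im (z (Suc j)) = - (Re \<eta> * Im (z j) + Im \<eta> * Re (z j))" for j
    by (simp_all add: z_def)
  define p where "p = (\<Sum>j\<le>N. Polynomial.smult (Re (z j)) (D j))"
  define q where "q = (\<Sum>j\<le>N. Polynomial.smult (Im (z j)) (D j))"
  have dp: "pderiv p = (\<Sum>j\<le>N. Polynomial.smult (Re (z j)) (D (Suc j)))"
    by (simp add: p_def pderiv_sum_gen pderiv_smult D_Suc)
  have dq: "pderiv q = (\<Sum>j\<le>N. Polynomial.smult (Im (z j)) (D (Suc j)))"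
    by (simp add: q_def pderiv_sum_gen pderiv_smult D_Suc)
  have tele: "(\<Sum>j\<le>N. Polynomial.smult (f (Suc j)) (D (Suc j))) = (\<Sum>j\<le>N. Polynomial.smult (f j) (D j)) - Polynomial.smult (f 0) R" for f
  proof -
    have "(\<Sum>j\<le>Suc N. Polynomial.smult (f j) (D j)) = Polynomial.smult (f 0) (D 0) + (\<Sum>j\<le>N. Polynomial.smult (f (Suc j)) (D (Suc j)))"
      by (rule sum.atMost_Suc_shift)
    then show ?thesis by (simp add: DN) (simp add: D_def)
  qed
  have "Polynomial.smult (Re \<eta>) (pderiv p) - Polynomial.smult (Im \<eta>) (pderiv q)
      = (\<Sum>j\<le>N. Polynomial.smult (- Re (z (Suc j))) (D (Suc j)))"
    unfolding dp dq Re_z by (rule poly_ext) (simp add: poly_sum sum_distrib_left left_diff_distrib mult.assoc flip: sum_subtractf)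
  also have "\<dots> = R - p" unfolding p_def using tele[of "\<lambda>j. - Re (z j)"] by (simp add: z_def sum_negf)
  finally have 1: "p + Polynomial.smult (Re \<eta>) (pderiv p) - Polynomial.smult (Im \<eta>) (pderiv q) = R"
    by (simp add: algebra_simps)
  have "Polynomial.smult (Re \<eta>) (pderiv q) + Polynomial.smult (Im \<eta>) (pderiv p)
      = (\<Sum>j\<le>N. Polynomial.smult (- Im (z (Suc j))) (D (Suc j)))"
    unfolding dp dq Im_z by (rule poly_ext) (simp add: poly_sum sum_distrib_left distrib_right mult.assoc add.commute flip: sum.distrib)
  also have "\<dots> = - q" unfolding q_def using tele[of "\<lambda>j. - Im (z j)"] by (simp add: z_def sum_negf)
  finally have 2: "q + Polynomial.smult (Re \<eta>) (pderiv q) + Polynomial.smult (Im \<eta>) (pderiv p) = 0"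
    by (simp add: algebra_simps)
  have D0: "coeff (D j) 0 = fact j * coeff R j" for j
    by (simp add: D_def coeff_higher_pderiv pochhammer_fact)
  have 3: "Complex (coeff p 0) (coeff q 0) = (\<Sum>j\<le>N. (- \<eta>) ^ j * of_real (fact j * coeff R j))"
    by (rule complex_eqI) (simp_all add: p_def q_def coeff_sum D0 z_def del: of_real_mult)
  have "degree p \<le> N" "degree q \<le> N"
    unfolding p_def q_def by (intro degree_sum_le order.trans[OF degree_smult_le degD]; simp)+
  then show ?thesis using that 1 2 3 by blast
qed

section \<open>Energy estimates on the imaginary axis\<close>

lemma Beta_pos_real: "a > 0 \<Longrightarrow> b > 0 \<Longrightarrow> Beta a b > (0::real)"
  by (simp add: Beta_def)

lemma jac_jacobi_step:
  assumes \<alpha>: "\<alpha> > -1" and c: "c > 0" and y: "c + 2 - \<alpha> - real N > 0"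
  shows "jac (\<alpha> + 1) (c + 1) (jacobi N \<alpha>) = jac (\<alpha> + 1) c (jacobi N \<alpha>) *
    (c * (c + 2 - \<alpha>) / ((c + 2 - \<alpha> - real N) * (\<alpha> + 1 + c + real N)))"
proof -
  define x y where "x = \<alpha> + 1 + c" and "y = c + 2 - \<alpha> - real N"
  have pos: "x > 0" "y > 0" using assms by (auto simp: x_def y_def)
  have p: "pochhammer (z + 1) N = pochhammer z N * (z + real N) / z" if "z > 0" for z :: real
    using pochhammer_rec[of z N] pochhammer_Suc[of z N] that by (simp add: field_simps)
  have "(\<alpha> + 1 + c) * Beta (\<alpha> + 1) (c + 1) = c * Beta (\<alpha> + 1) c"
    using c by (intro Beta_plus1_right) (auto dest: nonpos_Ints_nonpos)
  then have B: "Beta (\<alpha> + 1) (c + 1) = c * Beta (\<alpha> + 1) c / x"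
    using pos by (simp add: x_def field_simps)
  have px: "pochhammer x N > 0" using pos by (intro pochhammer_pos)
  have "jac (\<alpha> + 1) (c + 1) (jacobi N \<alpha>) = Beta (\<alpha> + 1) (c + 1) * pochhammer (y + 1) N / pochhammer (x + 1) N"
    using jac_jacobi[of \<alpha> "c + 1" N] assms by (simp add: x_def y_def algebra_simps)
  also have "\<dots> = (Beta (\<alpha> + 1) c * pochhammer y N / pochhammer x N) * (c * (y + real N) / (y * (x + real N)))"
    unfolding B p[OF pos(1)] p[OF pos(2)] using pos px by (simp add: divide_simps)
  also have "Beta (\<alpha> + 1) c * pochhammer y N / pochhammer x N = jac (\<alpha> + 1) c (jacobi N \<alpha>)"
    using jac_jacobi[of \<alpha> c N] assms by (simp add: x_def y_def algebra_simps)
  finally show ?thesis by (simp add: x_def y_def)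
qed

text \<open>
The energy \<open>a\<^sup>2 + w\<^sup>2 a'\<^sup>2\<close> has derivative \<open>2 a' R\<close>. The conditions at \<open>0\<close> allow a factor \<open>t\<^sup>2\<close> to be
split off from the energy and a factor \<open>t\<close> from \<open>a'\<close>. Integrating by parts against a weight times a
multiplier \<open>Q\<close> turns \<open>\<integral> a' R Q\<close> into a weighted integral of the energy; \<open>Q\<close> is free and will be
chosen to make its weight nonnegative.
\<close>

lemma energy_identity:
  fixes a R Q :: "real poly"
  assumes \<alpha>: "\<alpha> > -1" and \<beta>: "\<beta> > 0"
    and ode: "a + Polynomial.smult (w\<^sup>2) (pderiv (pderiv a)) = R"
    and a0: "coeff a 0 = 0" and a1: "coeff a 1 = 0"
  obtains d Z where "pderiv a = pCons 0 d"
    "a\<^sup>2 + Polynomial.smult (w\<^sup>2) ((pderiv a)\<^sup>2) = [:0, 0, 1:] * Z"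
    "2 * jac (\<alpha> + 1) \<beta> ([:1, -1:] * R * d * Q) =
       jac (\<alpha> + 1) \<beta> (Z * (Q * [:1 - \<alpha>, \<alpha> - 1 + \<beta>:] - [:0, 1, -1:] * pderiv Q))"
    "\<And>t. 0 \<le> poly Z t" "a \<noteq> 0 \<Longrightarrow> Z \<noteq> 0"
proof -
  obtain e0 a' where a': "a = pCons e0 a'" by (rule pCons_cases)
  obtain e1 e where e: "a' = pCons e1 e" by (rule pCons_cases)
  have a_eq: "a = pCons 0 (pCons 0 e)" using a0 a1 by (simp add: a' e)
  obtain d0 d where d': "pderiv a = pCons d0 d" by (rule pCons_cases)
  have "d0 = 0" using a1 arg_cong[OF d', of "\<lambda>p. coeff p 0"] by (simp add: coeff_pderiv)
  then have d: "pderiv a = pCons 0 d" using d' by simp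
  define Z where "Z = (pCons 0 e)\<^sup>2 + Polynomial.smult (w\<^sup>2) (d\<^sup>2)"
  have Y: "a\<^sup>2 + Polynomial.smult (w\<^sup>2) ((pderiv a)\<^sup>2) = [:0, 0, 1:] * Z"
    unfolding d by (subst a_eq, rule poly_ext) (simp add: Z_def algebra_simps power2_eq_square)
  have dY: "pderiv (a\<^sup>2 + Polynomial.smult (w\<^sup>2) ((pderiv a)\<^sup>2)) = 2 * pderiv a * R"
    unfolding ode[symmetric]
    by (rule poly_ext) (simp add: pderiv_add pderiv_smult power2_eq_square pderiv_mult algebra_simps)
  have Zd: "2 * poly Z t + t * poly (pderiv Z) t = 2 * poly R t * poly d t" for t
  proof -
    have "pderiv ([:0, 0, 1:] * Z) = 2 * pCons 0 d * R" using dY unfolding Y unfolding d .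
    moreover have "pderiv ([:0, 0, 1:] * Z) = pCons 0 (2 * Z + pCons 0 (pderiv Z))"
      by (rule poly_ext) (simp add: pderiv_mult pderiv_pCons algebra_simps)
    moreover have "2 * pCons 0 d * R = pCons 0 (2 * d * R)"
      by (rule poly_ext) (simp add: algebra_simps)
    ultimately have "2 * Z + pCons 0 (pderiv Z) = 2 * d * R" by simp
    from arg_cong[OF this, of "\<lambda>p. poly p t"] show ?thesis by (simp add: algebra_simps)
  qed
  have "Polynomial.smult (\<alpha> + 1) ([:1, -1:] * (Z * Q)) - Polynomial.smult \<beta> (pCons 0 (Z * Q)) + pCons 0 ([:1, -1:] * pderiv (Z * Q))
    = Polynomial.smult 2 ([:1, -1:] * R * d * Q) - Z * (Q * [:1 - \<alpha>, \<alpha> - 1 + \<beta>:] - [:0, 1, -1:] * pderiv Q)"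
  proof (rule poly_ext)
    fix t
    define z z' q q' r d' where "z = poly Z t" and "z' = poly (pderiv Z) t" and "q = poly Q t"
      and "q' = poly (pderiv Q) t" and "r = poly R t" and "d' = poly d t"
    have 0: "2 * z + t * z' = 2 * r * d'" using Zd[of t] by (simp add: z_def z'_def r_def d'_def)
    have "(\<alpha> + 1) * ((1 - t) * (z * q)) - \<beta> * (t * (z * q)) + t * ((1 - t) * (z' * q + z * q')) -
      (2 * ((1 - t) * r * d' * q) - z * (q * ((1 - \<alpha>) + t * (\<alpha> - 1 + \<beta>)) - t * (1 - t) * q'))
      = (1 - t) * q * ((2 * z + t * z') - 2 * r * d')"
      by (simp add: algebra_simps)
    then have "(\<alpha> + 1) * ((1 - t) * (z * q)) - \<beta> * (t * (z * q)) + t * ((1 - t) * (z' * q + z * q')) =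
      2 * ((1 - t) * r * d' * q) - z * (q * ((1 - \<alpha>) + t * (\<alpha> - 1 + \<beta>)) - t * (1 - t) * q')"
      using 0 by simp
    then show "poly (Polynomial.smult (\<alpha> + 1) ([:1, -1:] * (Z * Q)) - Polynomial.smult \<beta> (pCons 0 (Z * Q)) + pCons 0 ([:1, -1:] * pderiv (Z * Q))) t
      = poly (Polynomial.smult 2 ([:1, -1:] * R * d * Q) - Z * (Q * [:1 - \<alpha>, \<alpha> - 1 + \<beta>:] - [:0, 1, -1:] * pderiv Q)) t"
      by (simp add: pderiv_mult z_def z'_def q_def q'_def r_def d'_def algebra_simps)
  qed
  then have "jac (\<alpha> + 1) \<beta> (Polynomial.smult 2 ([:1, -1:] * R * d * Q) - Z * (Q * [:1 - \<alpha>, \<alpha> - 1 + \<beta>:] - [:0, 1, -1:] * pderiv Q)) = 0"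
    using jac_integration_by_parts[of "\<alpha> + 1" \<beta> "Z * Q"] \<alpha> \<beta> by simp
  then have "2 * jac (\<alpha> + 1) \<beta> ([:1, -1:] * R * d * Q) =
       jac (\<alpha> + 1) \<beta> (Z * (Q * [:1 - \<alpha>, \<alpha> - 1 + \<beta>:] - [:0, 1, -1:] * pderiv Q))"
    using \<alpha> \<beta> by (simp add: jac_diff jac_smult)
  moreover have "0 \<le> poly Z t" for t by (simp add: Z_def)
  moreover have "Z \<noteq> 0" if "a \<noteq> 0"
  proof
    assume "Z = 0"
    then have "poly a t = 0" for t
      using arg_cong[OF Y, of "\<lambda>p. poly p t"] by (simp add: add_nonneg_eq_0_iff)
    then show False using that poly_all_0_iff_0 by blast
  qed
  ultimately show ?thesis using that d Y by blast
qed

text \<open>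
The integral of \<open>R\<close> against the weight with parameters \<open>(\<alpha> + 1, \<alpha>)\<close> kills all test polynomials of degree
at most \<open>N - 2\<close>. Hence \<open>\<integral> a' R Q\<close> depends on two leading coefficients only and can be compared with
\<open>S = \<integral> R\<^sup>2\<close>: it is at most \<open>\<alpha> S\<close>. But \<open>R = a + w\<^sup>2 a''\<close> is orthogonal to \<open>a''\<close>, so \<open>S\<close> is at most
\<open>\<integral> a\<^sup>2\<close>, and the energy side of the identity exceeds \<open>2 \<alpha> S\<close>.
\<close>

lemma no_axis_zero_nonneg_index:
  fixes \<alpha> w :: real
  assumes \<alpha>: "0 < \<alpha>" "\<alpha> \<le> 1" and N: "N \<ge> 2" and w: "w \<noteq> 0"
    and deg: "degree a \<le> N" and ode: "a + Polynomial.smult (w\<^sup>2) (pderiv (pderiv a)) = jacobi N \<alpha>"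
    and a0: "coeff a 0 = 0" and a1: "coeff a 1 = 0"
  shows False
proof -
  obtain n where n: "N = n + 2" using N by (metis add.commute le_Suc_ex)
  define R where "R = jacobi N \<alpha>"
  \<comment> \<open>This multiplier makes the energy weight minus \<open>2 \<alpha> t\<^sup>2\<close> a multiple of \<open>1 - \<alpha>\<close>, so that nothing is lost at \<open>\<alpha> = 1\<close>.\<close>
  define Q where "Q = [:1, 2 - \<alpha>:]"
  have \<alpha>1: "\<alpha> > -1" using \<alpha> by simp
  obtain d Z where d: "pderiv a = pCons 0 d"
    and Y: "a\<^sup>2 + Polynomial.smult (w\<^sup>2) ((pderiv a)\<^sup>2) = [:0, 0, 1:] * Z"
    and E: "2 * jac (\<alpha> + 1) \<alpha> ([:1, -1:] * R * d * Q) =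
       jac (\<alpha> + 1) \<alpha> (Z * (Q * [:1 - \<alpha>, \<alpha> - 1 + \<alpha>:] - [:0, 1, -1:] * pderiv Q))"
    and Z: "\<And>t. 0 \<le> poly Z t"
    using energy_identity[OF \<alpha>1 \<alpha>(1) ode a0 a1, of Q] unfolding R_def by metis
  define V where "V = (\<lambda>i. jac (\<alpha> + 1) \<alpha> (R * [:1, -1:] ^ i))"
  have V: "V i = Beta (\<alpha> + 1) (\<alpha> + real i) * pochhammer (real i + 2 - real N) N / pochhammer (2 * \<alpha> + 1 + real i) N" for i
    unfolding V_def R_def using jac_jacobi_power[OF \<alpha>1 \<alpha>(1), of N i] by (simp add: add_ac)
  have V0: "V i = 0" if "i \<le> n" for i
  proof -
    have "pochhammer (real i + 2 - real N) N = 0"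
      using that by (subst pochhammer_eq_0_iff) (auto simp: n intro!: exI[of _ "n - i"])
    then show ?thesis by (simp add: V)
  qed
  define M where "M = real N + \<alpha>"
  have M: "M > 2" using N \<alpha> by (simp add: M_def)
  have Vpos: "V (Suc n) > 0"
    using \<alpha> by (auto simp: V n intro!: divide_pos_pos mult_pos_pos pochhammer_pos Beta_pos_real)
  have V1: "V (Suc (Suc n)) = (real N + 1) * (M - 1) / (2 * M) * V (Suc n)"
    using jac_jacobi_step[OF \<alpha>1, of "\<alpha> + real (Suc n)" N] \<alpha>
    unfolding V_def R_def jac_shift_right_power by (simp add: n M_def algebra_simps)
  have ell: "jac (\<alpha> + 1) \<alpha> (R * T) =
      (-1) ^ N * V (Suc n) * (coeff T N * ((real N + 1) * (M - 1) / (2 * M) - real N) - coeff T (Suc n))"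
    if "degree T \<le> N" for T
  proof -
    have mono: "jac (\<alpha> + 1) \<alpha> (R * monom 1 k) = (\<Sum>i\<le>k. real (k choose i) * (-1) ^ i * V i)" for k
      using \<alpha> by (subst jac_mult_monom) (auto simp: V_def)
    have z: "jac (\<alpha> + 1) \<alpha> (R * monom 1 k) = 0" if "k \<le> n" for k
      unfolding mono using that by (intro sum.neutral) (auto simp: V0)
    have z0: "(\<Sum>i\<le>n. real (k choose i) * (-1) ^ i * V i) = 0" for k
      by (intro sum.neutral) (auto simp: V0)
    have 1: "jac (\<alpha> + 1) \<alpha> (R * monom 1 (Suc n)) = - ((-1) ^ N) * V (Suc n)"
      unfolding mono by (simp add: z0 n)
    have 2: "jac (\<alpha> + 1) \<alpha> (R * monom 1 N) = (-1) ^ N * V (Suc n) * ((real N + 1) * (M - 1) / (2 * M) - real N)"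
      unfolding mono by (simp add: z0 n V1[unfolded n]) (simp add: algebra_simps)
    have "jac (\<alpha> + 1) \<alpha> (R * T) = (\<Sum>k\<le>N. coeff T k * jac (\<alpha> + 1) \<alpha> (R * monom 1 k))"
      using that \<alpha> by (intro jac_mult_coeffs) auto
    also have "\<dots> = coeff T (Suc n) * jac (\<alpha> + 1) \<alpha> (R * monom 1 (Suc n)) + coeff T N * jac (\<alpha> + 1) \<alpha> (R * monom 1 N)"
      using z by (simp add: n)
    finally show ?thesis unfolding 1 2 by (simp add: algebra_simps)
  qed
  define \<rho> where "\<rho> = (-1) ^ N * coeff R N"
  have \<rho>: "\<rho> > 0" unfolding \<rho>_def R_def using \<alpha> N by (intro lead_jacobi) auto
  have cRN: "coeff R N = (-1) ^ N * \<rho>" by (simp add: \<rho>_def power_mult_distrib[symmetric])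
  have cR1: "coeff R (Suc n) = - (M * real N / (2 * (M - 1))) * coeff R N"
  proof -
    have "coeff R N * (M * real N) = coeff R (Suc n) * (- (2 * (M - 1)))"
      using coeff_jacobi_Suc[OF \<alpha>1, of N "Suc n"] by (simp add: R_def n M_def algebra_simps)
    then show ?thesis using M by (simp add: field_simps)
  qed
  have c_ode: "coeff a k + w\<^sup>2 * ((real k + 2) * (real k + 1)) * coeff a (k + 2) = coeff R k" for k
    using arg_cong[OF ode, of "\<lambda>p. coeff p k"] by (simp add: R_def coeff_pderiv algebra_simps)
  have caN: "coeff a N = coeff R N" "coeff a (Suc n) = coeff R (Suc n)"
    using c_ode[of N] c_ode[of "Suc n"] deg by (simp_all add: n coeff_eq_0)
  define S where "S = jac (\<alpha> + 1) \<alpha> (R * R)"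
  have degR: "degree R \<le> N" by (simp add: R_def degree_jacobi_le)
  define T where "T = [:1, -1:] * d * Q"
  have T: "pCons 0 T = [:1, 1 - \<alpha>, \<alpha> - 2:] * pderiv a"
    unfolding d by (rule poly_ext) (simp add: T_def Q_def algebra_simps)
  have cT: "coeff T k = coeff (pderiv a) (Suc k) + (1 - \<alpha>) * coeff (pderiv a) k + (\<alpha> - 2) * (case k of 0 \<Rightarrow> 0 | Suc j \<Rightarrow> coeff (pderiv a) j)" for k
    using arg_cong[OF T, of "\<lambda>p. coeff p (Suc k)"] by (simp add: coeff_pCons split: nat.splits)
  have da0: "coeff (pderiv a) k = 0" if "k \<ge> N" for k
    using that deg by (simp add: coeff_pderiv coeff_eq_0)
  have degT: "degree T \<le> N"
    by (rule degree_le) (auto simp: cT da0 split: nat.splits)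
  have daN: "coeff (pderiv a) (Suc n) = real N * coeff R N" "coeff (pderiv a) n = (real N - 1) * coeff R (Suc n)"
    using caN by (simp_all add: coeff_pderiv n)
  have ss: "(-1) ^ N * (-1) ^ N = (1::real)" by (simp flip: power_mult_distrib)
  have sgn1: "(-1) ^ N * v * (A * ((-1) ^ N * r) * G - X * ((-1) ^ N * r)) = v * r * (A * G - X)" for v A r G X :: real
  proof -
    have "(-1) ^ N * v * (A * ((-1) ^ N * r) * G - X * ((-1) ^ N * r)) = ((-1) ^ N * (-1) ^ N) * (v * r * (A * G - X))"
      by (simp only: algebra_simps)
    then show ?thesis by (simp only: ss mult_1)
  qed
  have sgn2: "(-1) ^ N * v * ((-1) ^ N * r * G - - g * ((-1) ^ N * r)) = v * r * (G + g)" for v r G g :: real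
  proof -
    define s :: real where "s = (-1) ^ N"
    have "s * v * (s * r * G - - g * (s * r)) = (s * s) * (v * r * (G + g))"
      by (simp add: algebra_simps)
    then show ?thesis unfolding s_def by (simp only: ss mult_1)
  qed
  have ellT: "jac (\<alpha> + 1) \<alpha> ([:1, -1:] * R * d * Q) = V (Suc n) * \<rho> *
      ((\<alpha> - 2) * real N * ((real N + 1) * (M - 1) / (2 * M) - real N)
        - ((1 - \<alpha>) * real N - (\<alpha> - 2) * (real N - 1) * (M * real N / (2 * (M - 1)))))"
  proof -
    have "[:1, -1:] * R * d * Q = R * T" unfolding T_def by (simp only: ac_simps)
    then have "jac (\<alpha> + 1) \<alpha> ([:1, -1:] * R * d * Q) =
      (-1) ^ N * V (Suc n) * (coeff T N * ((real N + 1) * (M - 1) / (2 * M) - real N) - coeff T (Suc n))"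
      using ell[OF degT] by simp
    also have "coeff T N = (\<alpha> - 2) * real N * coeff R N" by (simp add: cT da0 n daN[unfolded n])
    also have "coeff T (Suc n) = ((1 - \<alpha>) * real N - (\<alpha> - 2) * (real N - 1) * (M * real N / (2 * (M - 1)))) * coeff R N"
      by (simp add: cT da0 n daN[unfolded n] cR1[unfolded n] algebra_simps)
    finally show ?thesis unfolding cRN by (simp only: sgn1)
  qed
  have ellS: "S = V (Suc n) * \<rho> * ((real N + 1) * (M - 1) / (2 * M) - real N + M * real N / (2 * (M - 1)))"
    unfolding S_def ell[OF degR] cR1 cRN by (simp only: sgn2)
  have le: "jac (\<alpha> + 1) \<alpha> ([:1, -1:] * R * d * Q) \<le> \<alpha> * S"
  proof -
    have NM: "real N = M - \<alpha>" by (simp add: M_def)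
    have "\<alpha> * S - jac (\<alpha> + 1) \<alpha> ([:1, -1:] * R * d * Q) =
      V (Suc n) * \<rho> * ((1 - \<alpha>) * (2 * M * (M - 1) * (real N - 1) - \<alpha> * (1 - \<alpha>)) / (2 * M * (M - 1)))"
    proof -
      have "\<alpha> * ((real N + 1) * (M - 1) / (2 * M) - real N + M * real N / (2 * (M - 1))) -
        ((\<alpha> - 2) * real N * ((real N + 1) * (M - 1) / (2 * M) - real N)
        - ((1 - \<alpha>) * real N - (\<alpha> - 2) * (real N - 1) * (M * real N / (2 * (M - 1))))) =
        (1 - \<alpha>) * (2 * M * (M - 1) * (real N - 1) - \<alpha> * (1 - \<alpha>)) / (2 * M * (M - 1))"
        unfolding NM using M by (simp add: divide_simps) (simp add: algebra_simps)
      from arg_cong[OF this, of "\<lambda>x. V (Suc n) * \<rho> * x"] show ?thesis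
        unfolding ellS ellT by (simp add: algebra_simps)
    qed
    moreover have "0 \<le> 2 * M * (M - 1) * (real N - 1) - \<alpha> * (1 - \<alpha>)"
    proof -
      have "1 * 1 * 1 \<le> 2 * M * (M - 1) * (real N - 1)" using M N by (intro mult_mono) auto
      moreover have "\<alpha> * (1 - \<alpha>) \<le> 1 * 1" using \<alpha> by (intro mult_mono) auto
      ultimately show ?thesis by simp
    qed
    ultimately show ?thesis using Vpos \<rho> \<alpha> M
      by (smt (verit) divide_nonneg_nonneg mult_nonneg_nonneg)
  qed
  have "2 * \<alpha> * S < jac (\<alpha> + 1) \<alpha> (Z * (Q * [:1 - \<alpha>, \<alpha> - 1 + \<alpha>:] - [:0, 1, -1:] * pderiv Q))"
  proof -
    define B where "B = Q * [:1 - \<alpha>, \<alpha> - 1 + \<alpha>:] - [:0, 1, -1:] * pderiv Q"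
    define a2 where "a2 = pderiv (pderiv a)"
    have pa: "\<alpha> + 1 > 0" using \<alpha> by simp
    have "0 \<le> poly (Z * B - Polynomial.smult (2 * \<alpha>) ([:0, 0, 1:] * Z)) t" if t: "0 < t" "t < 1" for t
    proof -
      have "poly B t - 2 * \<alpha> * t\<^sup>2 = (1 - \<alpha>) * ((1 - t) * (1 - \<alpha> * t) + \<alpha> * t\<^sup>2)"
        by (simp add: B_def Q_def pderiv_pCons algebra_simps power2_eq_square)
      moreover have "\<alpha> * t \<le> 1" using \<alpha> t mult_le_one[of \<alpha> t] by simp
      ultimately have "0 \<le> poly B t - 2 * \<alpha> * t\<^sup>2" using \<alpha> t by simp
      then have "0 \<le> poly Z t * (poly B t - 2 * \<alpha> * t\<^sup>2)" using Z[of t] by simp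
      then show ?thesis by (simp add: algebra_simps power2_eq_square)
    qed
    then have "0 \<le> jac (\<alpha> + 1) \<alpha> (Z * B - Polynomial.smult (2 * \<alpha>) ([:0, 0, 1:] * Z))"
      using \<alpha> by (intro jac_nonneg) auto
    then have "0 \<le> jac (\<alpha> + 1) \<alpha> (Z * B) - 2 * \<alpha> * jac (\<alpha> + 1) \<alpha> ([:0, 0, 1:] * Z)"
      by (simp only: jac_diff[OF pa \<alpha>(1)] jac_smult)
    then have "2 * \<alpha> * jac (\<alpha> + 1) \<alpha> ([:0, 0, 1:] * Z) \<le> jac (\<alpha> + 1) \<alpha> (Z * B)" by simp
    moreover have "jac (\<alpha> + 1) \<alpha> ([:0, 0, 1:] * Z) = jac (\<alpha> + 1) \<alpha> (a\<^sup>2) + w\<^sup>2 * jac (\<alpha> + 1) \<alpha> ((pderiv a)\<^sup>2)"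
      by (simp only: Y[symmetric] jac_add[OF pa \<alpha>(1)] jac_smult)
    moreover have "0 \<le> jac (\<alpha> + 1) \<alpha> ((pderiv a)\<^sup>2)" using \<alpha> by (intro jac_nonneg) auto
    moreover have "S < jac (\<alpha> + 1) \<alpha> (a\<^sup>2)"
    proof -
      have "a = R - Polynomial.smult (w\<^sup>2) a2" using ode by (simp add: R_def a2_def algebra_simps)
      then have sq: "a\<^sup>2 = R * R - Polynomial.smult (2 * w\<^sup>2) (R * a2) + Polynomial.smult (w ^ 4) (a2\<^sup>2)"
        by (simp only:) (rule poly_ext, simp add: algebra_simps power2_eq_square power4_eq_xxxx)
      have zero: "jac (\<alpha> + 1) \<alpha> (R * a2) = 0"
      proof -
        have "degree a2 \<le> N" "coeff a2 N = 0" "coeff a2 (Suc n) = 0"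
          using deg by (auto simp: a2_def coeff_pderiv n coeff_eq_0 degree_pderiv)
        then show ?thesis by (subst ell) auto
      qed
      have pos: "0 < jac (\<alpha> + 1) \<alpha> (a2\<^sup>2)"
      proof (rule jac_pos)
        have "coeff a (Suc (Suc n)) = coeff R (Suc (Suc n))" using caN(1) by (simp add: n)
        then have "coeff a2 n = real N * (real N - 1) * coeff R N" by (simp add: a2_def coeff_pderiv n algebra_simps)
        also have "\<dots> \<noteq> 0" using \<rho> N by (auto simp: \<rho>_def)
        finally show "a2\<^sup>2 \<noteq> 0" by auto
      qed (use \<alpha> in auto)
      have "jac (\<alpha> + 1) \<alpha> (a\<^sup>2) = S - 2 * w\<^sup>2 * 0 + w ^ 4 * jac (\<alpha> + 1) \<alpha> (a2\<^sup>2)"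
        by (simp only: sq jac_add[OF pa \<alpha>(1)] jac_diff[OF pa \<alpha>(1)] jac_smult S_def zero)
      moreover have "0 < w ^ 4 * jac (\<alpha> + 1) \<alpha> (a2\<^sup>2)" using pos w by (simp add: zero_less_mult_iff)
      ultimately show ?thesis by simp
    qed
    ultimately show ?thesis unfolding B_def[symmetric]
      using \<alpha> by (smt (verit) mult_left_mono mult_nonneg_nonneg mult_strict_left_mono zero_le_power2)
  qed
  with E le show False by simp
qed

text \<open>
With \<open>N = k + 5\<close>, \<open>a = N - M\<close> and \<open>c = 1 - a\<close> nonnegative, homogenising in \<open>a\<close> and \<open>c\<close> by \<open>a + c = 1\<close> turns
the negative of the polynomial into one with nonnegative coefficients.
\<close>

lemma top_value_polynomial_nonpos:
  fixes N M :: real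
  assumes "N \<ge> 5" "N - 1 \<le> M" "M \<le> N"
  shows "-12*N^4 - 4*N^3*M^2 + 52*N^3*M - 12*N^3 + 12*N^2*M^3 - 86*N^2*M^2 + 38*N^2*M + 9*N^2 - 24*N*M^4 + 88*N*M^3 - 50*N*M^2 - 20*N*M + 9*N \<le> 0"
proof -
  define k a c where "k = N - 5" and "a = N - M" and "c = 1 - (N - M)"
  have nn: "k \<ge> 0" "a \<ge> 0" "c \<ge> 0" using assms by (auto simp: k_def a_def c_def)
  have NM: "N = k + 5" "M = k + 5 - a" and c: "c = 1 - a" by (auto simp: k_def a_def c_def)
  have "-12*N^4 - 4*N^3*M^2 + 52*N^3*M - 12*N^3 + 12*N^2*M^3 - 86*N^2*M^2 + 38*N^2*M + 9*N^2 - 24*N*M^4 + 88*N*M^3 - 50*N*M^2 - 20*N*M + 9*N = - (16*k^5*a^4 + 64*k^5*a^3*c + 96*k^5*a^2*c^2 + 64*k^5*a*c^3 + 16*k^5*c^4 + 290*k^4*a^4 + 1228*k^4*a^3*c + 1944*k^4*a^2*c^2 + 1364*k^4*a*c^3 + 358*k^4*c^4 + 2080*k^3*a^4 + 9312*k^3*a^3*c + 15568*k^3*a^2*c^2 + 11520*k^3*a*c^3 + 3184*k^3*c^4 + 7387*k^2*a^4 + 34898*k^2*a^3*c + 61622*k^2*a^2*c^2 + 48182*k^2*a*c^3 + 14071*k^2*c^4 + 13003*k*a^4 + 64672*k*a^3*c + 120556*k*a^2*c^2 + 99764*k*a*c^3 + 30901*k*c^4 + 9090*a^4 + 47410*a^3*c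 + 93230*a^2*c^2 + 81770*a*c^3 + 26980*c^4)"
    unfolding NM c by (simp add: algebra_simps eval_nat_numeral)
  moreover have "0 \<le> 16*k^5*a^4 + 64*k^5*a^3*c + 96*k^5*a^2*c^2 + 64*k^5*a*c^3 + 16*k^5*c^4 + 290*k^4*a^4 + 1228*k^4*a^3*c + 1944*k^4*a^2*c^2 + 1364*k^4*a*c^3 + 358*k^4*c^4 + 2080*k^3*a^4 + 9312*k^3*a^3*c + 15568*k^3*a^2*c^2 + 11520*k^3*a*c^3 + 3184*k^3*c^4 + 7387*k^2*a^4 + 34898*k^2*a^3*c + 61622*k^2*a^2*c^2 + 48182*k^2*a*c^3 + 14071*k^2*c^4 + 13003*k*a^4 + 64672*k*a^3*c + 120556*k*a^2*c^2 + 99764*k*a*c^3 + 30901*k*c^4 + 9090*a^4 + 47410*a^3*c + 93230*a^2*c^2 + 81770*a*c^3 + 26980*c^4"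
    using nn by (intro add_nonneg_nonneg mult_nonneg_nonneg zero_le_power) auto
  ultimately show ?thesis by linarith
qed

text \<open>
For \<open>\<alpha> \<le> 0\<close> the second weight parameter has to be raised to \<open>\<alpha> + 2\<close> for the integrals with \<open>R\<close>, so that four
leading coefficients survive orthogonality, and \<open>\<integral> a' R Q\<close> is an affine function of \<open>w\<^sup>2\<close>. Both of its
coefficients are non-positive from \<open>N = 5\<close> on, while the energy side is positive.
\<close>

lemma no_axis_zero_negative_index:
  fixes \<alpha> w :: real
  assumes \<alpha>: "-1 < \<alpha>" "\<alpha> \<le> 0" and N: "N \<ge> 5"
    and deg: "degree a \<le> N" and ode: "a + Polynomial.smult (w\<^sup>2) (pderiv (pderiv a)) = jacobi N \<alpha>"
    and a0: "coeff a 0 = 0" and a1: "coeff a 1 = 0"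
  shows False
proof -
  obtain m where n: "N = m + 4" and m: "m \<ge> 1" using N by (intro that[of "N - 4"]) auto
  define R where "R = jacobi N \<alpha>"
  \<comment> \<open>One multiplier for all \<open>\<alpha>\<close>: the energy weight is affine in \<open>\<alpha>\<close>, and it is nonnegative at \<open>\<alpha> = 0\<close> and at \<open>\<alpha> = - 1\<close>.\<close>
  define Q where "Q = [:1/8, 1/2, 1::real:]"
  have \<alpha>': "\<alpha> + 1 > 0" "\<alpha> + 2 > 0" using \<alpha> by auto
  obtain d Z where d: "pderiv a = pCons 0 d"
    and E: "2 * jac (\<alpha> + 1) (\<alpha> + 1) ([:1, -1:] * R * d * Q) =
       jac (\<alpha> + 1) (\<alpha> + 1) (Z * (Q * [:1 - \<alpha>, \<alpha> - 1 + (\<alpha> + 1):] - [:0, 1, -1:] * pderiv Q))"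
    and Z: "\<And>t. 0 \<le> poly Z t" and Zn: "a \<noteq> 0 \<Longrightarrow> Z \<noteq> 0"
    using energy_identity[OF \<alpha>(1) \<alpha>'(1) ode a0 a1, of Q] unfolding R_def by metis
  define V where "V = (\<lambda>i. jac (\<alpha> + 1) (\<alpha> + 2) (R * [:1, -1:] ^ i))"
  have V: "V i = Beta (\<alpha> + 1) (\<alpha> + 2 + real i) * pochhammer (real i + 4 - real N) N / pochhammer (2 * \<alpha> + 3 + real i) N" for i
    unfolding V_def R_def using jac_jacobi_power[OF \<alpha>(1) \<alpha>'(2), of N i] by (simp add: algebra_simps)
  have V0: "V i = 0" if "i \<le> m" for i
  proof -
    have "pochhammer (real i + 4 - real N) N = 0"
      using that by (subst pochhammer_eq_0_iff) (auto simp: n intro!: exI[of _ "m - i"])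
    then show ?thesis by (simp add: V)
  qed
  define M where "M = real N + \<alpha>"
  have M: "M > 4" using N \<alpha> by (simp add: M_def)
  define v where "v = V (m + 1)"
  have Vpos: "v > 0"
    using \<alpha> by (auto simp: v_def V n intro!: divide_pos_pos mult_pos_pos pochhammer_pos Beta_pos_real)
  \<comment> \<open>The numbers \<open>g\<close> are the values on successive powers of \<open>1 - t\<close>, relative to the first nonzero value \<open>v\<close>;
    the numbers \<open>l\<close> below are the corresponding values on powers of \<open>t\<close>.\<close>
  define g1 where "g1 = (real N + 1) * (M - 1) / (2 * M)"
  define g2 where "g2 = (real N + 1) * (real N + 2) * (M - 1) / (4 * (2 * M + 1))"
  define g3 where "g3 = (real N + 1) * (real N + 2) * (real N + 3) * (M - 1) / (24 * (2 * M + 1))"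
  have step: "V (Suc i) = V i * ((\<alpha> + 2 + real i) * (real i + 4) / ((real i + 4 - real N) * (2 * \<alpha> + 3 + real i + real N)))"
    if "i > m" for i
    using jac_jacobi_step[OF \<alpha>(1), of "\<alpha> + 2 + real i" N] \<alpha>' that
    unfolding V_def R_def jac_shift_right_power by (simp add: n algebra_simps)
  have V1: "V (m + 2) = v * g1" and V2: "V (m + 3) = v * g2" and V3: "V (m + 4) = v * g3"
  proof -
    have "V (m + 2) = V (m + 1) * ((M - 1) * (real N + 1) / (2 * M))"
      using step[of "m + 1"] by (simp add: n M_def algebra_simps)
    then show 1: "V (m + 2) = v * g1" by (simp add: v_def g1_def mult_ac)
    have "V (m + 3) = V (m + 2) * (M * (real N + 2) / (2 * (2 * M + 1)))"
      using step[of "m + 2"] by (simp add: n M_def algebra_simps eval_nat_numeral)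
    then show 2: "V (m + 3) = v * g2" unfolding 1 using M by (simp add: g1_def g2_def divide_simps)
    have "V (m + 4) = V (m + 3) * ((M + 1) * (real N + 3) / (3 * (2 * M + 2)))"
      using step[of "m + 3"] by (simp add: n M_def algebra_simps eval_nat_numeral)
    moreover have "(M + 1) * (real N + 3) / (3 * (2 * M + 2)) = (real N + 3) / 6"
      using M by (simp add: field_simps)
    ultimately have "V (m + 4) = V (m + 3) * ((real N + 3) / 6)" by (simp only:)
    then show "V (m + 4) = v * g3" unfolding 2 using M by (simp add: g2_def g3_def)
  qed
  define s where "s = (-1 :: real) ^ m"
  define l1 where "l1 = g1 - (real N - 2)"
  define l2 where "l2 = - (g2 - (real N - 1) * g1 + (real N - 1) * (real N - 2) / 2)"
  define l3 where "l3 = g3 - real N * g2 + real N * (real N - 1) / 2 * g1 - real N * (real N - 1) * (real N - 2) / 6"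
  have ch2: "real (Suc (Suc k) choose k) = (real k + 2) * (real k + 1) / 2" for k
    by (induction k) (simp_all add: field_simps)
  have ch3: "real (Suc (Suc (Suc k)) choose k) = (real k + 3) * (real k + 2) * (real k + 1) / 6" for k
  proof (induction k)
    case (Suc k)
    have "real (Suc (Suc (Suc (Suc k))) choose Suc k) = real (Suc (Suc (Suc k)) choose k) + real (Suc (Suc (Suc k)) choose Suc k)"
      by simp
    then show ?case unfolding Suc ch2 by (simp add: field_simps)
  qed simp
  have ell: "jac (\<alpha> + 1) (\<alpha> + 2) (R * T) = s * v * (coeff T N * l3 + coeff T (m + 3) * l2 + coeff T (m + 2) * l1 - coeff T (m + 1))"
    if "degree T \<le> N" for T
  proof -
    have mono: "jac (\<alpha> + 1) (\<alpha> + 2) (R * monom 1 k) = (\<Sum>i\<le>k. real (k choose i) * (-1) ^ i * V i)" for k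
      using \<alpha>' by (subst jac_mult_monom) (auto simp: V_def)
    have z: "jac (\<alpha> + 1) (\<alpha> + 2) (R * monom 1 k) = 0" if "k \<le> m" for k
      unfolding mono using that by (intro sum.neutral) (auto simp: V0)
    have z0: "(\<Sum>i\<le>m. real (k choose i) * (-1) ^ i * V i) = 0" for k
      by (intro sum.neutral) (auto simp: V0)
    have VS: "V (Suc m) = v" "V (Suc (Suc m)) = v * g1" "V (Suc (Suc (Suc m))) = v * g2" "V (Suc (Suc (Suc (Suc m)))) = v * g3"
      using V1 V2 V3 by (simp_all add: v_def eval_nat_numeral)
    have c2: "real (Suc (Suc (Suc m)) choose Suc m) = (real N - 1) * (real N - 2) / 2"
      and c3: "real (Suc (Suc (Suc (Suc m))) choose Suc m) = real N * (real N - 1) * (real N - 2) / 6"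
      and c4: "real (Suc (Suc (Suc (Suc m))) choose Suc (Suc m)) = real N * (real N - 1) / 2"
      unfolding ch2 ch3 by (simp_all add: n algebra_simps)
    have c1: "real (Suc k choose k) = real k + 1" for k by simp
    have 1: "jac (\<alpha> + 1) (\<alpha> + 2) (R * monom 1 (Suc m)) = - s * v"
      unfolding mono sum.atMost_Suc z0 VS by (simp add: s_def)
    have 2: "jac (\<alpha> + 1) (\<alpha> + 2) (R * monom 1 (Suc (Suc m))) = s * v * l1"
      unfolding mono sum.atMost_Suc z0 VS c1 binomial_n_n by (simp add: s_def l1_def n) (simp add: algebra_simps)
    have 3: "jac (\<alpha> + 1) (\<alpha> + 2) (R * monom 1 (Suc (Suc (Suc m)))) = s * v * l2"
      unfolding mono sum.atMost_Suc z0 VS c2 c1 binomial_n_n by (simp add: s_def l2_def) (simp add: n algebra_simps)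
    have 4: "jac (\<alpha> + 1) (\<alpha> + 2) (R * monom 1 (Suc (Suc (Suc (Suc m))))) = s * v * l3"
      unfolding mono sum.atMost_Suc z0 VS c3 c4 c1 binomial_n_n by (simp add: s_def l3_def) (simp add: n algebra_simps)
    have "jac (\<alpha> + 1) (\<alpha> + 2) (R * T) = (\<Sum>k\<le>Suc (Suc (Suc (Suc m))). coeff T k * jac (\<alpha> + 1) (\<alpha> + 2) (R * monom 1 k))"
      using that \<alpha>' by (intro jac_mult_coeffs) (auto simp: n)
    also have "\<dots> = coeff T (Suc m) * (- s * v) + coeff T (Suc (Suc m)) * (s * v * l1)
        + coeff T (Suc (Suc (Suc m))) * (s * v * l2) + coeff T (Suc (Suc (Suc (Suc m)))) * (s * v * l3)"
      unfolding sum.atMost_Suc 1 2 3 4 using z by simp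
    finally show ?thesis by (simp add: n eval_nat_numeral algebra_simps)
  qed
  define r where "r = coeff R N"
  have sr: "s * r > 0"
    using lead_jacobi[OF \<alpha>(1), of N] N by (simp add: r_def R_def s_def n power_add)
  \<comment> \<open>The numbers \<open>h\<close> are the coefficients of \<open>R\<close> below the leading one, relative to it.\<close>
  define h1 where "h1 = - (M * real N / (2 * (M - 1)))"
  define h2 where "h2 = M * real N * (real N - 1) / (4 * (2 * M - 3))"
  define h3 where "h3 = - (M * real N * (real N - 1) * (real N - 2) / (24 * (2 * M - 3)))"
  have cR3: "coeff R (m + 3) = h1 * r"
  proof -
    have "r * (M * real N) = coeff R (m + 3) * (- (2 * (M - 1)))"
      using coeff_jacobi_Suc[OF \<alpha>(1), of N "m + 3"] by (simp add: R_def r_def n M_def algebra_simps eval_nat_numeral)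
    then show ?thesis using M by (simp add: h1_def field_simps)
  qed
  have cR2: "coeff R (m + 2) = h2 * r"
  proof -
    have "h1 * r * ((M - 1) * (real N - 1)) = coeff R (m + 2) * (- (2 * (2 * M - 3)))"
      unfolding cR3[symmetric]
      using coeff_jacobi_Suc[OF \<alpha>(1), of N "m + 2"] by (simp add: R_def n M_def algebra_simps eval_nat_numeral)
    moreover have "h1 * r * ((M - 1) * (real N - 1)) = - (M * real N / 2 * r * (real N - 1))"
    proof -
      have e: "h1 * (M - 1) = - (M * real N / 2)" using M by (simp add: h1_def field_simps)
      have "h1 * r * ((M - 1) * (real N - 1)) = (h1 * (M - 1)) * r * (real N - 1)" by (simp only: mult_ac)
      then show ?thesis unfolding e by simp
    qed
    ultimately have "M * real N / 2 * r * (real N - 1) = coeff R (m + 2) * (2 * (2 * M - 3))" by linarith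
    then show ?thesis using M by (simp add: h2_def divide_simps) (simp add: algebra_simps)
  qed
  have cR1: "coeff R (m + 1) = h3 * r"
  proof -
    have "h2 * r * ((M - 2) * (real N - 2)) = coeff R (m + 1) * (- (3 * (2 * (M - 2))))"
      unfolding cR2[symmetric]
      using coeff_jacobi_Suc[OF \<alpha>(1), of N "m + 1"] by (simp add: R_def n M_def algebra_simps eval_nat_numeral)
    then have "(M - 2) * (h2 * r * (real N - 2) + 6 * coeff R (m + 1)) = 0" by (simp add: algebra_simps)
    then have "h2 * r * (real N - 2) + 6 * coeff R (m + 1) = 0" using M by simp
    then have "coeff R (m + 1) = - (h2 * r * (real N - 2)) / 6" by simp
    then show ?thesis using M by (simp add: h2_def h3_def divide_simps)
  qed
  have c_ode: "coeff a k + w\<^sup>2 * ((real k + 2) * (real k + 1)) * coeff a (k + 2) = coeff R k" for k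
    using arg_cong[OF ode, of "\<lambda>p. coeff p k"] by (simp add: R_def coeff_pderiv algebra_simps)
  have ca4: "coeff a (m + 4) = r" and ca3: "coeff a (m + 3) = h1 * r"
    using c_ode[of "m + 4"] c_ode[of "m + 3"] deg cR3 by (simp_all add: n r_def coeff_eq_0 eval_nat_numeral)
  have ca2: "coeff a (m + 2) = (h2 - w\<^sup>2 * (real N * (real N - 1))) * r"
    using c_ode[of "m + 2"] ca4 cR2 by (simp add: n algebra_simps eval_nat_numeral)
  have ca1: "coeff a (m + 1) = (h3 - w\<^sup>2 * ((real N - 1) * (real N - 2)) * h1) * r"
    using c_ode[of "m + 1"] ca3 cR1 by (simp add: n algebra_simps eval_nat_numeral)
  define T where "T = d * Q"
  have T: "pCons 0 T = Q * pderiv a"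
    unfolding d by (rule poly_ext) (simp add: T_def Q_def algebra_simps)
  have cT: "coeff T (Suc k) = coeff (pderiv a) (k + 2) / 8 + coeff (pderiv a) (k + 1) / 2 + coeff (pderiv a) k" for k
    using arg_cong[OF T, of "\<lambda>p. coeff p (Suc (Suc k))"] by (simp add: Q_def)
  have da0: "coeff (pderiv a) k = 0" if "k \<ge> N" for k
    using that deg by (simp add: coeff_pderiv coeff_eq_0)
  have degT: "degree T \<le> N"
  proof (rule degree_le, intro allI impI)
    fix i assume "N < i"
    then obtain k where "i = Suc k" "N \<le> k" by (cases i) auto
    then show "coeff T i = 0" by (simp add: cT da0)
  qed
  have da: "coeff (pderiv a) (m + 3) = real N * r" "coeff (pderiv a) (m + 2) = (real N - 1) * h1 * r"
    "coeff (pderiv a) (m + 1) = (real N - 2) * (h2 - w\<^sup>2 * (real N * (real N - 1))) * r"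
    "coeff (pderiv a) m = (real N - 3) * (h3 - w\<^sup>2 * ((real N - 1) * (real N - 2)) * h1) * r"
    using ca1 ca2 ca3 ca4 by (simp_all add: coeff_pderiv n eval_nat_numeral)
  \<comment> \<open>The coefficients of \<open>1\<close> and \<open>w\<^sup>2\<close> in the integral, as the differential equation expresses \<open>a\<close> by \<open>R\<close> and \<open>w\<^sup>2\<close>.\<close>
  define L0 where "L0 = real N * l3 + (real N - 1) * h1 * l2 + (real N - 2) * h2 * l1 - (real N - 3) * h3
     + (real N * l2 + (real N - 1) * h1 * l1 - (real N - 2) * h2) / 2 + (real N * l1 - (real N - 1) * h1) / 8"
  define L2 where "L2 = (real N - 1) * (real N - 2) * (- real N * l1 + (real N - 3) * h1 + real N / 2)"
  have ellT: "jac (\<alpha> + 1) (\<alpha> + 2) (R * T) = v * (s * r) * (L0 + w\<^sup>2 * L2)"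
  proof -
    have cT4: "coeff T N = real N * r"
      using cT[of "m + 3"] da da0 by (simp add: n eval_nat_numeral)
    have cT3: "coeff T (m + 3) = (real N * r) / 2 + (real N - 1) * h1 * r"
      using cT[of "m + 2"] da da0 by (simp add: n eval_nat_numeral)
    have cT2: "coeff T (m + 2) = (real N * r) / 8 + ((real N - 1) * h1 * r) / 2 + (real N - 2) * (h2 - w\<^sup>2 * (real N * (real N - 1))) * r"
      using cT[of "m + 1"] da da0 by (simp add: eval_nat_numeral)
    have cT1: "coeff T (m + 1) = ((real N - 1) * h1 * r) / 8 + ((real N - 2) * (h2 - w\<^sup>2 * (real N * (real N - 1))) * r) / 2
        + (real N - 3) * (h3 - w\<^sup>2 * ((real N - 1) * (real N - 2)) * h1) * r"
      using cT[of m] da da0 by (simp add: eval_nat_numeral)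
    show ?thesis unfolding ell[OF degT] cT4 cT3 cT2 cT1 L0_def L2_def by (simp add: field_simps)
  qed
  have N5: "real N \<ge> 5" "real N - 1 \<le> M" "M \<le> real N" using N \<alpha> by (auto simp: M_def)
  have "L2 \<le> 0"
  proof -
    have "- real N * l1 + (real N - 3) * h1 + real N / 2 = - (real N * (M\<^sup>2 - 5 * M + real N + 1)) / (2 * M * (M - 1))"
      using M by (simp add: l1_def g1_def h1_def divide_simps) (simp add: algebra_simps power2_eq_square)
    moreover have "0 \<le> M\<^sup>2 - 5 * M + real N + 1"
    proof -
      have "0 \<le> (M - 4) * (M - 1)" using M by (intro mult_nonneg_nonneg) auto
      then have "5 * M - 4 \<le> M\<^sup>2" by (simp add: algebra_simps power2_eq_square)
      then show ?thesis using N5 by linarith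
    qed
    ultimately have "- real N * l1 + (real N - 3) * h1 + real N / 2 \<le> 0" using M N by (simp add: divide_nonneg_pos)
    then show ?thesis unfolding L2_def using N5 by (intro mult_nonneg_nonpos) auto
  qed
  moreover have "L0 \<le> 0"
  proof -
    have eq: "L0 * (16 * (M * (M - 1) * (2 * M + 1) * (2 * M - 3))) = (-12*real N^4 - 4*real N^3*M^2 + 52*real N^3*M - 12*real N^3 + 12*real N^2*M^3 - 86*real N^2*M^2 + 38*real N^2*M + 9*real N^2 - 24*real N*M^4 + 88*real N*M^3 - 50*real N*M^2 - 20*real N*M + 9*real N)"
      using M unfolding L0_def l1_def l2_def l3_def g1_def g2_def g3_def h1_def h2_def h3_def
      by (simp add: divide_simps) (simp add: algebra_simps eval_nat_numeral)
    have "L0 * (16 * (M * (M - 1) * (2 * M + 1) * (2 * M - 3))) \<le> 0"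
      unfolding eq by (rule top_value_polynomial_nonpos[OF N5])
    moreover have "0 < 16 * (M * (M - 1) * (2 * M + 1) * (2 * M - 3))" using M by simp
    ultimately show ?thesis by (meson leD leI mult_pos_pos)
  qed
  ultimately have "jac (\<alpha> + 1) (\<alpha> + 2) (R * T) \<le> 0"
    unfolding ellT using Vpos sr by (intro mult_nonneg_nonpos) (auto simp: add_nonpos_nonpos mult_nonneg_nonpos)
  moreover have "jac (\<alpha> + 1) (\<alpha> + 1) ([:1, -1:] * R * d * Q) = jac (\<alpha> + 1) (\<alpha> + 2) (R * T)"
  proof -
    have "[:1, -1:] * R * d * Q = [:1, -1:] * (R * T)" unfolding T_def by (simp only: ac_simps)
    then show ?thesis by (simp only: jac_shift_right) (simp add: add.commute)
  qed
  moreover have "0 < jac (\<alpha> + 1) (\<alpha> + 1) (Z * (Q * [:1 - \<alpha>, \<alpha> - 1 + (\<alpha> + 1):] - [:0, 1, -1:] * pderiv Q))"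
  proof (rule jac_pos)
    define B where "B = Q * [:1 - \<alpha>, \<alpha> - 1 + (\<alpha> + 1):] - [:0, 1, -1:] * pderiv Q"
    have "a \<noteq> 0" using ca4 sr by auto
    moreover have "B \<noteq> 0"
    proof
      assume "B = 0"
      then have "coeff B 0 = 0" by simp
      then show False using \<alpha> by (simp add: B_def Q_def)
    qed
    ultimately show "Z * (Q * [:1 - \<alpha>, \<alpha> - 1 + (\<alpha> + 1):] - [:0, 1, -1:] * pderiv Q) \<noteq> 0"
      using Zn unfolding B_def by (simp only: mult_eq_0_iff) simp
    fix t :: real assume t: "0 < t" "t < 1"
    have "poly B t = (1 + \<alpha>) * (1/8 - 1/216 + (t - 1/6)\<^sup>2 * (2 * t + 1/6)) + (- \<alpha>) * (1 - t) * (1/4 + t/2)"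
      by (simp add: B_def Q_def pderiv_pCons field_simps power2_eq_square)
    moreover have "0 \<le> (1 + \<alpha>) * (1/8 - 1/216 + (t - 1/6)\<^sup>2 * (2 * t + 1/6))"
      using \<alpha> t by (intro mult_nonneg_nonneg[of "1 + \<alpha>"] add_nonneg_nonneg[of "1/8 - 1/216"] mult_nonneg_nonneg[of "(t - 1/6)\<^sup>2"]) auto
    moreover have "0 \<le> (- \<alpha>) * (1 - t) * (1/4 + t/2)"
      using \<alpha> t by (intro mult_nonneg_nonneg) auto
    ultimately have "0 \<le> poly B t" by linarith
    then show "0 \<le> poly (Z * (Q * [:1 - \<alpha>, \<alpha> - 1 + (\<alpha> + 1):] - [:0, 1, -1:] * pderiv Q)) t"
      using Z[of t] unfolding B_def[symmetric] by simp
  qed (use \<alpha>' in auto)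
  ultimately show False using E by linarith
qed

section \<open>A family of Hurwitz polynomials\<close>

lemma poly_eq_sum_atMost:
  fixes p :: "'a::comm_semiring_1 poly"
  assumes "degree p \<le> N"
  shows "poly p x = (\<Sum>i\<le>N. coeff p i * x ^ i)"
  unfolding poly_altdef using assms by (intro sum.mono_neutral_left) (auto simp: coeff_eq_0)

text \<open>
The polynomial with coefficients \<open>\<Prod>i<j. (N - i) (N + 2 b - 3 + i) / (b + i)\<close>. These are, up to sign,
the numbers \<open>j!\<close> times the coefficients of the Jacobi polynomial of index \<open>\<alpha> = b - 1\<close>, as the
resolvent requires.
\<close>

definition phi :: "nat \<Rightarrow> real \<Rightarrow> real poly" where
  "phi N b = (\<Sum>j\<le>N. monom ((-1) ^ j * pochhammer (- real N) j * pochhammer (real N + 2 * b - 3) j / pochhammer b j) j)"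

lemma coeff_phi:
  "coeff (phi N b) j = (-1) ^ j * pochhammer (- real N) j * pochhammer (real N + 2 * b - 3) j / pochhammer b j"
proof (cases "j \<le> N")
  case False
  then have "pochhammer (- real N) j = 0" by (simp add: pochhammer_of_nat_eq_0_iff)
  with False show ?thesis by (simp add: phi_def coeff_sum)
qed (simp add: phi_def coeff_sum)

lemma degree_phi_le: "degree (phi N b) \<le> N"
  by (rule degree_le) (simp add: coeff_phi pochhammer_of_nat_eq_0_iff)

lemma coeff_phi_jacobi: "coeff (phi N b) j = (-1) ^ j * (fact j * coeff (jacobi N (b - 1)) j)"
  by (simp add: coeff_phi coeff_jacobi algebra_simps)

lemma poly_phi: "poly (cp (phi N b)) y = (\<Sum>j\<le>N. of_real (coeff (phi N b) j) * y ^ j)"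
  using poly_eq_sum_atMost[of "cp (phi N b)" N y] degree_phi_le by (simp add: coeff_map_poly)

lemma phi_zero_resolvent:
  assumes "poly (cp (phi N b)) \<eta> = 0"
  obtains p q where "degree p \<le> N" "degree q \<le> N"
    "p + Polynomial.smult (Re \<eta>) (pderiv p) - Polynomial.smult (Im \<eta>) (pderiv q) = jacobi N (b - 1)"
    "q + Polynomial.smult (Re \<eta>) (pderiv q) + Polynomial.smult (Im \<eta>) (pderiv p) = 0"
    "coeff p 0 = 0" "coeff q 0 = 0"
proof -
  obtain p q where pq: "degree p \<le> N" "degree q \<le> N"
    "p + Polynomial.smult (Re \<eta>) (pderiv p) - Polynomial.smult (Im \<eta>) (pderiv q) = jacobi N (b - 1)"
    "q + Polynomial.smult (Re \<eta>) (pderiv q) + Polynomial.smult (Im \<eta>) (pderiv p) = 0"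
    and c: "Complex (coeff p 0) (coeff q 0) = (\<Sum>j\<le>N. (- \<eta>) ^ j * of_real (fact j * coeff (jacobi N (b - 1)) j))"
    using resolvent[OF degree_jacobi_le] by blast
  have "(- \<eta>) ^ j * of_real (fact j * coeff (jacobi N (b - 1)) j) = of_real (coeff (phi N b) j) * \<eta> ^ j" for j
    by (subst power_minus) (simp add: coeff_phi_jacobi)
  then have "Complex (coeff p 0) (coeff q 0) = poly (cp (phi N b)) \<eta>" unfolding c poly_phi by simp
  then have "coeff p 0 = 0" "coeff q 0 = 0" using assms by (simp_all add: complex_eq_iff)
  with pq show ?thesis by (rule that)
qed

text \<open>
On the imaginary axis \<open>q\<close> can be eliminated, and the real part satisfies \<open>p + w\<^sup>2 p'' = R\<close> with
\<open>p(0) = p'(0) = 0\<close>.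
\<close>

lemma phi_no_axis_zero:
  assumes b: "0 < b" "b \<le> 2" and N: "N \<ge> 2" "1 < b \<or> N \<ge> 5" and \<eta>: "Re \<eta> = 0"
  shows "poly (cp (phi N b)) \<eta> \<noteq> 0"
proof
  assume z: "poly (cp (phi N b)) \<eta> = 0"
  obtain p q where pq: "degree p \<le> N"
    "p - Polynomial.smult (Im \<eta>) (pderiv q) = jacobi N (b - 1)"
    "q + Polynomial.smult (Im \<eta>) (pderiv p) = 0"
    "coeff p 0 = 0" "coeff q 0 = 0"
    using phi_zero_resolvent[OF z] unfolding \<eta> by (metis add.right_neutral smult_0_left)
  have "\<eta> \<noteq> 0"
  proof
    assume "\<eta> = 0"
    then have "coeff (cp (phi N b)) 0 = 0" using z by (simp add: poly_0_coeff_0)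
    then show False by (simp add: coeff_map_poly coeff_phi)
  qed
  then have w: "Im \<eta> \<noteq> 0" using \<eta> by (simp add: complex_eq_iff)
  have q: "q = - Polynomial.smult (Im \<eta>) (pderiv p)" using pq(3) by (simp add: add_eq_0_iff)
  have ode: "p + Polynomial.smult ((Im \<eta>)\<^sup>2) (pderiv (pderiv p)) = jacobi N (b - 1)"
    using pq(2) unfolding q by (simp add: pderiv_minus pderiv_smult power2_eq_square)
  have p1: "coeff p 1 = 0" using pq(5) w unfolding q by (simp add: coeff_pderiv)
  show False
  proof (cases "1 < b")
    case True
    then show False using no_axis_zero_nonneg_index[OF _ _ N(1) w pq(1) ode pq(4) p1] b by simp
  next
    case False
    then show False using no_axis_zero_negative_index[OF _ _ _ pq(1) ode pq(4) p1] b N by simp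
  qed
qed

text \<open>
For \<open>b = 2\<close> the constant weight suffices. Pairing the complex equation with the conjugate solution gives
\<open>I + s B + w C = \<integral> R p\<close> and \<open>s C - w B = \<integral> R q\<close>, where \<open>I\<close> is the squared norm and \<open>2 B\<close> the squared
boundary value. Orthogonality makes the second right side zero and the first negative, which is
impossible for \<open>s > 0\<close>.
\<close>

lemma phi_2_no_right_zero:
  assumes N: "N \<ge> 2" and \<eta>: "0 < Re \<eta>"
  shows "poly (cp (phi N 2)) \<eta> \<noteq> 0"
proof
  assume z: "poly (cp (phi N 2)) \<eta> = 0"
  define s w where "s = Re \<eta>" and "w = Im \<eta>"
  have s: "s > 0" using \<eta> by (simp add: s_def)
  define R where "R = jacobi N 1"
  obtain p q where deg: "degree p \<le> N" "degree q \<le> N"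
    and 1: "p + Polynomial.smult s (pderiv p) - Polynomial.smult w (pderiv q) = R"
    and 2: "q + Polynomial.smult s (pderiv q) + Polynomial.smult w (pderiv p) = 0"
    and 0: "coeff p 0 = 0" "coeff q 0 = 0"
    using phi_zero_resolvent[OF z] unfolding s_def w_def R_def by auto
  define V where "V = (\<lambda>i. jac 2 1 (R * [:1, -1:] ^ i))"
  have V: "V i = Beta 2 (1 + real i) * pochhammer (real i + 2 - real N) N / pochhammer (3 + real i) N" for i
    unfolding V_def R_def using jac_jacobi_power[of 1 1 N i] by (simp add: algebra_simps)
  have V0: "V i = 0" if "i + 2 \<le> N" for i
  proof -
    have "pochhammer (real i + 2 - real N) N = 0"
      using that by (subst pochhammer_eq_0_iff) (auto intro!: exI[of _ "N - (i + 2)"])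
    then show ?thesis by (simp add: V)
  qed
  obtain m where n: "N = Suc m" using N by (cases N) auto
  have Vpos: "V m > 0"
    by (auto simp: V n intro!: divide_pos_pos mult_pos_pos pochhammer_pos Beta_pos_real)
  have mono: "jac 2 1 (R * monom 1 k) = (\<Sum>i\<le>k. real (k choose i) * (-1) ^ i * V i)" for k
    by (subst jac_mult_monom) (auto simp: V_def)
  have mono0: "jac 2 1 (R * monom 1 k) = 0" if "k < m" for k
    unfolding mono using that by (intro sum.neutral) (auto simp: V0 n)
  have monom: "jac 2 1 (R * monom 1 m) = (-1) ^ m * V m"
    unfolding mono by (subst sum.remove[of _ m]) (auto simp: V0 n intro!: sum.neutral)
  have ell: "jac 1 1 (R * h) = coeff h N * (-1) ^ m * V m" if h: "degree h \<le> N" "coeff h 0 = 0" for h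
  proof -
    obtain T where T: "h = pCons 0 T" using h(2) by (metis coeff_pCons_0 pCons_cases)
    have dT: "degree T \<le> m"
      using h(1) unfolding T n by (cases "T = 0") auto
    have "jac 1 1 (R * h) = jac 1 1 (pCons 0 (R * T))" by (simp add: T)
    also have "\<dots> = jac 2 1 (R * T)" by (simp add: jac_shift_left)
    also have "\<dots> = (\<Sum>k\<le>m. coeff T k * jac 2 1 (R * monom 1 k))"
      using dT by (intro jac_mult_coeffs) auto
    also have "\<dots> = coeff T m * ((-1) ^ m * V m)"
      by (subst sum.remove[of _ m]) (auto simp: mono0 monom intro!: sum.neutral)
    finally show ?thesis by (simp add: T n)
  qed
  have top: "coeff (pderiv h) N = 0" if "degree h \<le> N" for h :: "real poly"
    using that by (simp add: coeff_pderiv coeff_eq_0)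
  have "coeff q N = 0" using arg_cong[OF 2, of "\<lambda>h. coeff h N"] deg by (simp add: top)
  then have Rq: "jac 1 1 (R * q) = 0" using ell[OF deg(2) 0(2)] by simp
  have "coeff p N = coeff R N" using arg_cong[OF 1, of "\<lambda>h. coeff h N"] deg by (simp add: top)
  then have "jac 1 1 (R * p) = - ((-1) ^ N * coeff R N) * V m"
    using ell[OF deg(1) 0(1)] by (simp add: n)
  moreover have "(-1) ^ N * coeff R N > 0" unfolding R_def using N by (intro lead_jacobi) auto
  ultimately have Rp: "jac 1 1 (R * p) < 0" using Vpos by (simp add: mult_pos_pos)
  define B where "B = jac 1 1 (pderiv p * p + pderiv q * q)"
  define C where "C = jac 1 1 (pderiv p * q - pderiv q * p)"
  define I where "I = jac 1 1 (p\<^sup>2 + q\<^sup>2)"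
  have "R * p = (p\<^sup>2 + q\<^sup>2) + Polynomial.smult s (pderiv p * p + pderiv q * q) + Polynomial.smult w (pderiv p * q - pderiv q * p)"
  proof -
    have "R * p = (p + Polynomial.smult s (pderiv p) - Polynomial.smult w (pderiv q)) * p
        + (q + Polynomial.smult s (pderiv q) + Polynomial.smult w (pderiv p)) * q"
      unfolding 1 2 by simp
    then show ?thesis by (simp only:) (rule poly_ext, simp add: algebra_simps power2_eq_square)
  qed
  then have e1: "I + s * B + w * C = jac 1 1 (R * p)" by (simp add: jac_add jac_smult I_def B_def C_def)
  have "R * q = Polynomial.smult s (pderiv p * q - pderiv q * p) - Polynomial.smult w (pderiv p * p + pderiv q * q)"
  proof -
    have "R * q = (p + Polynomial.smult s (pderiv p) - Polynomial.smult w (pderiv q)) * q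
        - (q + Polynomial.smult s (pderiv q) + Polynomial.smult w (pderiv p)) * p"
      unfolding 1 2 by simp
    then show ?thesis by (simp only:) (rule poly_ext, simp add: algebra_simps power2_eq_square)
  qed
  then have e2: "s * C = w * B" using Rq by (simp add: jac_diff jac_smult B_def C_def)
  have "0 \<le> I" unfolding I_def by (rule jac_nonneg) auto
  moreover have "0 \<le> B"
  proof -
    have "2 * B = jac 1 1 (pderiv (p\<^sup>2 + q\<^sup>2))"
      unfolding B_def jac_smult[symmetric]
      by (rule arg_cong[of _ _ "jac 1 1"]) (simp add: power2_eq_square pderiv_add pderiv_mult, rule poly_ext, simp add: algebra_simps)
    also have "\<dots> = (poly p 1)\<^sup>2 + (poly q 1)\<^sup>2" using 0 by (simp add: jac_derivative flip: poly_0_coeff_0)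
    finally show ?thesis using zero_le_power2[of "poly p 1"] zero_le_power2[of "poly q 1"] by linarith
  qed
  moreover have "s * (I + s * B + w * C) = s * I + (s\<^sup>2 + w\<^sup>2) * B"
    using e2 by (simp add: algebra_simps power2_eq_square)
  ultimately have "0 \<le> s * (I + s * B + w * C)" using s by simp
  then show False using e1 Rp s by (simp add: zero_le_mult_iff)
qed

text \<open>
Continuation in \<open>b\<close> from \<open>b = 2\<close>. On the axis, values \<open>b > 1\<close> are covered for all \<open>N \<ge> 2\<close>, but smaller \<open>b\<close>
only for \<open>N \<ge> 5\<close>.
\<close>

theorem hurwitz_phi:
  assumes b: "0 < b" "b \<le> 2" and N: "N \<ge> 2" "1 < b \<or> N \<ge> 5"
  shows "hurwitz (phi N b)"
proof -
  have nz: "coeff (phi N b') N \<noteq> 0" if "b' \<in> {b..2}" for b'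
  proof -
    have "real N + 2 * b' - 3 > 0" using that b N by auto
    then have "pochhammer (real N + 2 * b' - 3) N > 0" "pochhammer b' N > 0"
      using that b by (auto intro!: pochhammer_pos)
    moreover have "pochhammer (- real N) N \<noteq> 0" by (simp add: pochhammer_of_nat_eq_0_iff)
    ultimately show ?thesis by (simp add: coeff_phi)
  qed
  have "(\<Sum>j\<le>N. of_real (coeff (phi N b) j) * y ^ j) \<noteq> 0" if y: "0 \<le> Re y" for y
  proof (rule hurwitz_homotopy[where ?b0.0 = b and ?b1.0 = 2 and b = b and c = "\<lambda>j b. coeff (phi N b) j"])
    show "continuous_on {b..2} (\<lambda>b. coeff (phi N b) j)" for j
    proof -
      have "pochhammer x j \<noteq> 0" if "x \<in> {b..2}" for x
        using that b by (intro less_imp_neq[symmetric] pochhammer_pos) auto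
      then show ?thesis unfolding coeff_phi pochhammer_prod
        by (intro continuous_intros) (auto simp: pochhammer_prod)
    qed
    show "(\<Sum>j\<le>N. complex_of_real (coeff (phi N b') j) * (\<i> * of_real w) ^ j) \<noteq> 0" if "b' \<in> {b..2}" for b' w
      using phi_no_axis_zero[of b' N "\<i> * of_real w"] that b N by (auto simp: poly_phi)
    show "(\<Sum>j\<le>N. complex_of_real (coeff (phi N 2) j) * y ^ j) \<noteq> 0" if "0 < Re y" for y
      using phi_2_no_right_zero[OF N(1) that] by (simp add: poly_phi)
  qed (use nz b y in auto)
  then show ?thesis using nz[of b] b unfolding hurwitz_def by (auto simp: poly_phi)
qed

section \<open>The polynomial behind both modes\<close>

definition psi :: "nat \<Rightarrow> real \<Rightarrow> real poly" where
  "psi N \<beta> = (\<Sum>k\<le>N. monom (pochhammer (- real N) (2 * k) * pochhammer (real N + 2 * \<beta> - 3) (2 * k) / pochhammer \<beta> (2 * k)) k)"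

lemma coeff_psi:
  "coeff (psi N \<beta>) k = pochhammer (- real N) (2 * k) * pochhammer (real N + 2 * \<beta> - 3) (2 * k) / pochhammer \<beta> (2 * k)"
proof (cases "k \<le> N")
  case False
  then have "pochhammer (- real N) (2 * k) = 0" by (simp add: pochhammer_of_nat_eq_0_iff)
  with False show ?thesis by (simp add: psi_def coeff_sum)
qed (simp add: psi_def coeff_sum)

lemma degree_psi:
  assumes "N = 2 * s + 1" "s \<ge> 1" "\<beta> > 0"
  shows "degree (psi N \<beta>) = s"
proof (rule antisym)
  have "pochhammer (- real N) (2 * i) = 0" if "s < i" for i
    unfolding pochhammer_of_nat_eq_0_iff using that assms(1) by simp
  then show "degree (psi N \<beta>) \<le> s"
    by (intro degree_le) (auto simp: coeff_psi)
  have "pochhammer (real N + 2 * \<beta> - 3) (2 * s) > 0" "pochhammer \<beta> (2 * s) > 0"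
    using assms by (auto intro!: pochhammer_pos)
  moreover have "pochhammer (- real N) (2 * s) \<noteq> 0"
    using assms(1) unfolding pochhammer_of_nat_eq_0_iff by simp
  ultimately show "s \<le> degree (psi N \<beta>)" by (intro le_degree) (simp add: coeff_psi)
qed

lemma neg_simple_smult:
  assumes "neg_simple p" "c \<noteq> 0"
  shows "neg_simple (Polynomial.smult c p)"
proof -
  from assms obtain X d where X: "finite X" "d \<noteq> 0" "\<forall>x\<in>X. 0 < x"
    and p_eq: "p = Polynomial.smult d (\<Prod>x\<in>X. [:x, 1:])" unfolding neg_simple_def by blast
  show ?thesis unfolding neg_simple_def
    using X assms(2) by (intro exI[of _ X] exI[of _ "c * d"]) (simp add: p_eq)
qed

text \<open>
The even part of \<open>\<Phi>_(N,\<beta>)\<close> works for \<open>\<beta> \<le> 2\<close>. For \<open>2 < \<beta> \<le> 3\<close> the parameter \<open>b = \<beta> - 1\<close> is again in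
range, and the odd part of \<open>\<Phi>_(N+1,\<beta>-1)\<close> is a multiple of \<open>\<psi>\<close>. For \<open>N = 3\<close> and small \<open>\<beta>\<close> the polynomial
is linear with positive coefficients.
\<close>

theorem neg_simple_psi:
  assumes \<beta>: "0 < \<beta>" "\<beta> \<le> 3" and N: "N = 3 \<or> N \<ge> 5"
  shows "neg_simple (psi N \<beta>)"
proof -
  consider "N = 3" "\<beta> \<le> 1" | "\<beta> \<le> 2" "1 < \<beta> \<or> N \<ge> 5" | "2 < \<beta>" using N by fastforce
  then show ?thesis
  proof cases
    case 1
    define c where "c = coeff (psi N \<beta>) 1"
    have "c > 0"
      using \<beta> by (simp add: c_def coeff_psi 1 eval_nat_numeral pochhammer_Suc)
    moreover have "psi N \<beta> = [:1, c:]"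
    proof (rule poly_eqI)
      fix k show "coeff (psi N \<beta>) k = coeff [:1, c:] k"
      proof (cases "k \<ge> 2")
        case True
        then obtain j where "k = Suc (Suc j)" by (metis add_2_eq_Suc le_Suc_ex)
        moreover have "pochhammer (- real N) (2 * k) = 0" unfolding pochhammer_of_nat_eq_0_iff using True 1 by simp
        ultimately show ?thesis by (simp add: coeff_psi)
      next
        case False
        then have "k = 0 \<or> k = 1" by auto
        then show ?thesis by (auto simp: c_def coeff_psi)
      qed
    qed
    ultimately show ?thesis unfolding neg_simple_def
      by (intro exI[of _ "{1 / c}"] exI[of _ c]) simp
  next
    case 2
    have "psi N \<beta> = even_part (phi N \<beta>)"
      by (rule poly_eqI) (simp add: coeff_psi coeff_phi)
    then show ?thesis using hermite_biehler_even[OF hurwitz_phi[of \<beta> N]] 2 \<beta> N by auto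
  next
    case 3
    define b where "b = \<beta> - 1"
    have b: "1 < b" "b \<le> 2" using 3 \<beta> by (auto simp: b_def)
    define A' where "A' = real N + 2 * \<beta> - 4"
    have A': "A' > 0" using 3 N by (auto simp: A'_def)
    have H: "hurwitz (phi (Suc N) b)" using b N by (intro hurwitz_phi) auto
    have co: "coeff (odd_part (phi (Suc N) b)) k = (real N + 1) * A' / b * coeff (psi N \<beta>) k" for k
    proof -
      have "coeff (odd_part (phi (Suc N) b)) k =
        - pochhammer (- real (Suc N)) (Suc (2 * k)) * pochhammer A' (Suc (2 * k)) / pochhammer b (Suc (2 * k))"
        by (simp add: coeff_phi b_def A'_def algebra_simps)
      moreover have "pochhammer (- real (Suc N)) (Suc (2 * k)) = - (real N + 1) * pochhammer (- real N) (2 * k)"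
        by (simp add: pochhammer_rec)
      moreover have "pochhammer A' (Suc (2 * k)) = A' * pochhammer (real N + 2 * \<beta> - 3) (2 * k)"
        by (simp add: pochhammer_rec A'_def algebra_simps)
      moreover have "pochhammer b (Suc (2 * k)) = b * pochhammer \<beta> (2 * k)"
        by (simp add: pochhammer_rec b_def)
      moreover have "pochhammer \<beta> (2 * k) > 0" using \<beta> by (auto intro: pochhammer_pos)
      ultimately show ?thesis using b by (simp only: coeff_psi) (simp add: field_simps)
    qed
    define K where "K = (real N + 1) * A' / b"
    have K: "K \<noteq> 0" using b A' by (simp add: K_def add_nonneg_eq_0_iff)
    have "coeff (odd_part (phi (Suc N) b)) 0 \<noteq> 0" using K unfolding co K_def[symmetric] by (simp add: coeff_psi)
    then have "degree (phi (Suc N) b) > 0"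
      by (metis coeff_eq_0 coeff_odd_part gr0I less_add_one mult_zero_right add_0 plus_1_eq_Suc)
    then have "neg_simple (odd_part (phi (Suc N) b))" using H by (intro hermite_biehler_odd)
    then have "neg_simple (Polynomial.smult (1 / K) (odd_part (phi (Suc N) b)))" using K by (intro neg_simple_smult) auto
    moreover have "psi N \<beta> = Polynomial.smult (1 / K) (odd_part (phi (Suc N) b))"
      using K by (intro poly_eqI) (simp only: coeff_smult co K_def[symmetric], simp)
    ultimately show ?thesis by simp
  qed
qed

section \<open>Mode polynomials\<close>

text \<open>
For even \<open>m\<close> the coefficients are the even derivatives at \<open>t = 0\<close> of the primitive, normalised by
\<open>G(0) = 1\<close>, of the Gegenbauer polynomial of degree \<open>m\<close>.
\<close>

definition even_mode :: "real \<Rightarrow> nat \<Rightarrow> real poly" where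
  "even_mode \<beta> m = (\<Sum>k\<le>m. monom (pochhammer (- real (m + 1)) (2 * k) * pochhammer (real m + 2 * \<beta>) (2 * k) / pochhammer \<beta> (2 * k)) k)"

text \<open>
Here the last two linear factors come from the additional condition that the trial function vanishes at
both ends, which is not automatic for odd residuals.
\<close>

definition odd_mode :: "real \<Rightarrow> nat \<Rightarrow> real poly" where
  "odd_mode \<beta> m = (\<Sum>k\<le>m. monom (pochhammer (- real (m + 2)) (2 * k) * pochhammer (real m + 2 * \<beta> - 1) (2 * k)
     * (real m + 1 - 2 * real k) * (real m + 2 * \<beta> + 2 * real k) / pochhammer \<beta> (2 * k)) k)"

lemma coeff_even_mode:
  "coeff (even_mode \<beta> m) k = pochhammer (- real (m + 1)) (2 * k) * pochhammer (real m + 2 * \<beta>) (2 * k) / pochhammer \<beta> (2 * k)"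
proof (cases "k \<le> m")
  case False
  then have "pochhammer (- real (m + 1)) (2 * k) = 0" unfolding pochhammer_of_nat_eq_0_iff by simp
  with False show ?thesis by (simp add: even_mode_def coeff_sum)
qed (simp add: even_mode_def coeff_sum)

lemma coeff_odd_mode:
  assumes "m \<ge> 1"
  shows "coeff (odd_mode \<beta> m) k = pochhammer (- real (m + 2)) (2 * k) * pochhammer (real m + 2 * \<beta> - 1) (2 * k)
     * (real m + 1 - 2 * real k) * (real m + 2 * \<beta> + 2 * real k) / pochhammer \<beta> (2 * k)"
proof (cases "k \<le> m")
  case False
  show ?thesis
  proof (cases "m = 1 \<and> k = 2")
    case True
    then show ?thesis by (simp add: odd_mode_def coeff_sum eval_nat_numeral pochhammer_Suc)
  next
    case F: False
    have "pochhammer (- real (m + 2)) (2 * k) = 0"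
      unfolding pochhammer_of_nat_eq_0_iff using False assms F by auto
    with False show ?thesis by (simp add: odd_mode_def coeff_sum)
  qed
qed (simp add: odd_mode_def coeff_sum)

lemma pochhammer_shift_two:
  "x * (x + 1) * pochhammer (x + 2) j = (x + real j) * (x + 1 + real j) * pochhammer (x::real) j"
proof -
  have "pochhammer x (Suc (Suc j)) = x * ((x + 1) * pochhammer (x + 1 + 1) j)" by (simp only: pochhammer_rec)
  moreover have "pochhammer x (Suc (Suc j)) = pochhammer x j * (x + real j) * (x + real (Suc j))" by (simp only: pochhammer_Suc)
  ultimately show ?thesis by (simp add: algebra_simps)
qed

lemma pochhammer_shift_two':
  assumes "x * (x + 1) \<noteq> (0::real)"
  shows "pochhammer (x + 2) j = (x + real j) * (x + 1 + real j) * pochhammer x j / (x * (x + 1))"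
  using assms by (metis pochhammer_shift_two nonzero_mult_div_cancel_left)

lemma degree_shifted_euler_le: "degree (shifted_euler \<kappa> p) \<le> degree p"
  by (rule degree_le) (simp add: coeff_eq_0)

text \<open>
The difference of the two polynomials is a multiple of \<open>g\<close>, so \<open>g\<close> and then \<open>z g'\<close> would vanish at \<open>z\<close>.
\<close>

lemma shifted_euler_no_common_root:
  assumes "neg_simple g" "\<kappa>1 \<noteq> \<kappa>2" "poly (shifted_euler \<kappa>1 g) z = 0" "poly (shifted_euler \<kappa>2 g) z = 0"
  shows False
proof -
  have "(\<kappa>2 - \<kappa>1) * poly g z = 0" using assms(3,4) by (auto simp: poly_shifted_euler algebra_simps)
  then have g: "poly g z = 0" using assms(2) by auto
  then show False using neg_simple_roots(4,5)[OF assms(1) g] assms(3) by (simp add: poly_shifted_euler)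
qed

text \<open>
With \<open>N = 2 s + 1\<close> and \<open>A = N + 2 \<beta> - 3\<close> the odd mode of degree \<open>2 s - 1\<close> arises from \<open>\<psi>\<close> by the factors
\<open>N - 1 - 2 k\<close> and \<open>A + 1 + 2 k\<close> on the coefficients, the even mode of degree \<open>2 s\<close> by \<open>A + 2 k\<close> and
\<open>A + 1 + 2 k\<close>, and the even mode of degree \<open>2 s - 2\<close> by \<open>N - 2 k\<close> and \<open>N - 1 - 2 k\<close>. For even \<open>n = 2 s + 2\<close> the
first and second occur, with \<open>s + (s - 1) = n - 3\<close> roots; for odd \<open>n = 2 s + 1\<close> the first and third, with
\<open>(s - 1) + (s - 1) = n - 3\<close> roots.
\<close>

theorem mode_roots:
  assumes \<beta>: "0 < \<beta>" "\<beta> \<le> 3" and n: "n \<ge> 4"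
  obtains me mo where "even me" "odd mo" "me + 3 = n \<or> me + 2 = n" "mo + 3 = n \<or> mo + 2 = n"
    "finite {z. poly (even_mode \<beta> me) z = 0 \<or> poly (odd_mode \<beta> mo) z = 0}"
    "card {z. poly (even_mode \<beta> me) z = 0 \<or> poly (odd_mode \<beta> mo) z = 0} = n - 3"
    "\<And>z. poly (even_mode \<beta> me) z = 0 \<or> poly (odd_mode \<beta> mo) z = 0 \<Longrightarrow> z < 0"
proof -
  note goal_rule = that
  define s where "s = (n - 1) div 2"
  have s: "s \<ge> 1" using n by (simp add: s_def)
  define N where "N = 2 * s + 1"
  define A where "A = real N + 2 * \<beta> - 3"
  have A: "A > 0" using \<beta> s by (simp add: A_def N_def)
  define P where "P = psi N \<beta>"
  have P: "neg_simple P" "degree P = s"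
    using \<beta> s degree_psi[of N s \<beta>] by (auto simp: P_def N_def intro!: neg_simple_psi)
  define mo where "mo = 2 * s - 1"
  have mo: "odd mo" "mo \<ge> 1" "real mo = real N - 2" "mo + 2 = N" using s by (auto simp: mo_def N_def)
  define g1 where "g1 = shifted_euler (- ((A + 1) / 2)) P"
  define g2 where "g2 = shifted_euler (real s) P"
  have g1: "neg_simple g1" "degree g1 \<le> s" unfolding g1_def using P A degree_shifted_euler_le[of _ P]
    by (auto intro!: neg_simple_shifted_euler)
  have g2: "neg_simple g2" "degree g2 \<le> s" unfolding g2_def using P s degree_shifted_euler_le[of _ P]
    by (auto intro!: neg_simple_shifted_euler)
  have rs: "real s = (real N - 1) / 2" by (simp add: N_def)
  have cP: "coeff P k = pochhammer (- real N) (2 * k) * pochhammer A (2 * k) / pochhammer \<beta> (2 * k)" for k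
    by (simp add: P_def coeff_psi A_def)
  have Y: "pochhammer \<beta> (2 * k) > 0" for k using \<beta> by (auto intro: pochhammer_pos)
  have od1: "odd_mode \<beta> mo = Polynomial.smult (-4) (shifted_euler (real s) g1)"
  proof (rule poly_eqI)
    fix k
    have "real mo + 2 * \<beta> - 1 = A" "real mo + 1 - 2 * real k = real N - 1 - 2 * real k"
      "real mo + 2 * \<beta> + 2 * real k = A + 1 + 2 * real k" using mo(3) by (simp_all add: A_def)
    then have "coeff (odd_mode \<beta> mo) k = pochhammer (- real N) (2 * k) * pochhammer A (2 * k)
       * (real N - 1 - 2 * real k) * (A + 1 + 2 * real k) / pochhammer \<beta> (2 * k)"
      by (simp only: coeff_odd_mode[OF mo(2)] mo(4))
    then show "coeff (odd_mode \<beta> mo) k = coeff (Polynomial.smult (-4) (shifted_euler (real s) g1)) k"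
      using Y[of k] by (simp add: g1_def cP rs field_simps)
  qed
  have od2: "odd_mode \<beta> mo = Polynomial.smult (-4) (shifted_euler (- ((A + 1) / 2)) g2)"
    unfolding od1 by (rule poly_eqI) (simp add: g1_def g2_def)
  have od: "neg_simple (odd_mode \<beta> mo)" unfolding od1 using g1 s
    by (intro neg_simple_smult neg_simple_shifted_euler) auto
  have dod: "degree (odd_mode \<beta> mo) = s - 1"
  proof -
    have "coeff (odd_mode \<beta> mo) (s - 1) \<noteq> 0"
    proof -
      have "coeff P s \<noteq> 0" "coeff P (s - 1) \<noteq> 0"
      proof -
        show "coeff P s \<noteq> 0" using P neg_simple_roots(1)[OF P(1)] by auto
        have "pochhammer (real N + 2 * \<beta> - 3) (2 * (s - 1)) > 0" "pochhammer \<beta> (2 * (s - 1)) > 0"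
          using \<beta> s by (auto intro!: pochhammer_pos simp: N_def)
        moreover have "pochhammer (- real N) (2 * (s - 1)) \<noteq> 0"
          unfolding pochhammer_of_nat_eq_0_iff by (simp add: N_def)
        ultimately show "coeff P (s - 1) \<noteq> 0" by (simp add: P_def coeff_psi)
      qed
      moreover have "real s - 1 + (A + 1) / 2 \<noteq> 0"
        using A s by (intro less_imp_neq[symmetric] add_nonneg_pos) auto
      ultimately show ?thesis unfolding od1 using s by (simp add: g1_def of_nat_diff)
    qed
    moreover have "degree (odd_mode \<beta> mo) \<le> s - 1"
    proof (rule degree_le, intro allI impI)
      fix i assume "s - 1 < i"
      then have "i = s \<or> i > s" by auto
      then show "coeff (odd_mode \<beta> mo) i = 0" unfolding od1 using P by (auto simp: g1_def coeff_eq_0)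
    qed
    ultimately show ?thesis by (metis antisym le_degree)
  qed
  have main: thesis
    if e: "even me" "me + 3 = n \<or> me + 2 = n" "mo + 3 = n \<or> mo + 2 = n"
      "neg_simple (even_mode \<beta> me)" "degree (even_mode \<beta> me) + (s - 1) = n - 3"
      "\<And>z. poly (even_mode \<beta> me) z = 0 \<Longrightarrow> poly (odd_mode \<beta> mo) z = 0 \<Longrightarrow> False" for me
  proof -
    let ?E = "{z. poly (even_mode \<beta> me) z = 0}" and ?O = "{z. poly (odd_mode \<beta> mo) z = 0}"
    have un: "{z. poly (even_mode \<beta> me) z = 0 \<or> poly (odd_mode \<beta> mo) z = 0} = ?E \<union> ?O" by auto
    have fin: "finite ?E" "finite ?O" using neg_simple_roots(2) od e(4) by auto
    have "card (?E \<union> ?O) = card ?E + card ?O" using fin e(6) by (intro card_Un_disjoint) auto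
    also have "\<dots> = n - 3" using neg_simple_roots(3)[OF od] neg_simple_roots(3)[OF e(4)] dod e(5) by simp
    finally show thesis using goal_rule[of me mo] e mo fin neg_simple_roots(4)[OF od] neg_simple_roots(4)[OF e(4)]
      unfolding un by blast
  qed
  have deg_even: "degree (even_mode \<beta> (2 * r)) = r" for r
  proof (rule antisym)
    show "degree (even_mode \<beta> (2 * r)) \<le> r"
    proof (rule degree_le, intro allI impI)
      fix i assume "r < i"
      then have "pochhammer (- real (2 * r + 1)) (2 * i) = 0" unfolding pochhammer_of_nat_eq_0_iff by simp
      then show "coeff (even_mode \<beta> (2 * r)) i = 0" unfolding coeff_even_mode by simp
    qed
    have "pochhammer (real (2 * r) + 2 * \<beta>) (2 * r) > 0" "pochhammer \<beta> (2 * r) > 0"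
      using \<beta> by (auto intro!: pochhammer_pos add_nonneg_pos)
    moreover have "pochhammer (- real (2 * r + 1)) (2 * r) \<noteq> 0"
      unfolding pochhammer_of_nat_eq_0_iff by simp
    ultimately show "r \<le> degree (even_mode \<beta> (2 * r))" by (intro le_degree) (unfold coeff_even_mode, simp)
  qed
  show thesis
  proof (cases "even n")
    case True
    then have n': "n = 2 * s + 2" using n by (auto simp: s_def elim!: evenE)
    have ev: "even_mode \<beta> (2 * s) = Polynomial.smult (4 / (A * (A + 1))) (shifted_euler (- (A / 2)) g1)"
    proof (rule poly_eqI)
      fix k
      have "pochhammer (A + 2) (2 * k) = (A + 2 * real k) * (A + 1 + 2 * real k) * pochhammer A (2 * k) / (A * (A + 1))"
        using pochhammer_shift_two'[of A "2 * k"] A by simp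
      moreover have "real (2 * s) + 2 * \<beta> = A + 2" by (simp add: A_def N_def)
      moreover have "real (2 * s + 1) = real N" by (simp add: N_def)
      ultimately have *: "coeff (even_mode \<beta> (2 * s)) k = pochhammer (- real N) (2 * k) *
          ((A + 2 * real k) * (A + 1 + 2 * real k) * pochhammer A (2 * k) / (A * (A + 1))) / pochhammer \<beta> (2 * k)"
        by (simp only: coeff_even_mode)
      show "coeff (even_mode \<beta> (2 * s)) k = coeff (Polynomial.smult (4 / (A * (A + 1))) (shifted_euler (- (A / 2)) g1)) k"
      proof -
        have e: "4 * ((real k + A / 2) * (real k + (A + 1) / 2)) = (A + 2 * real k) * (A + 1 + 2 * real k)"
          by (simp add: field_simps)
        have "coeff (Polynomial.smult (4 / (A * (A + 1))) (shifted_euler (- (A / 2)) g1)) k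
            = (4 * ((real k + A / 2) * (real k + (A + 1) / 2))) * coeff P k / (A * (A + 1))"
          by (simp add: g1_def)
        then show ?thesis unfolding e cP *
          by (simp only: times_divide_eq_left times_divide_eq_right divide_divide_eq_left mult_ac)
      qed
    qed
    show thesis
    proof (rule main[of "2 * s"])
      show "neg_simple (even_mode \<beta> (2 * s))" unfolding ev using g1 A
        by (intro neg_simple_smult neg_simple_shifted_euler) auto
      show False if "poly (even_mode \<beta> (2 * s)) z = 0" "poly (odd_mode \<beta> mo) z = 0" for z
        using shifted_euler_no_common_root[OF g1(1), of "- (A / 2)" "real s" z] that A s unfolding ev od1 by auto
    qed (use n' s in \<open>auto simp: deg_even mo_def\<close>)
  next
    case False
    then have n': "n = 2 * s + 1" using n by (auto simp: s_def elim!: oddE)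
    then have s2: "s \<ge> 2" using n by auto
    have ev: "even_mode \<beta> (2 * (s - 1)) = Polynomial.smult (4 / (real N * (real N - 1))) (shifted_euler (real N / 2) g2)"
    proof (rule poly_eqI)
      fix k
      have N1: "real N > 1" using s by (simp add: N_def)
      have "(- real N + real (2 * k)) * (- real N + 1 + real (2 * k)) = (real N - 2 * real k) * (real N - 1 - 2 * real k)"
        "- real N * (- real N + 1) = real N * (real N - 1)" by (simp_all add: algebra_simps)
      then have "pochhammer (- real N + 2) (2 * k) = (real N - 2 * real k) * (real N - 1 - 2 * real k) * pochhammer (- real N) (2 * k) / (real N * (real N - 1))"
        using pochhammer_shift_two'[of "- real N" "2 * k"] N1 by (simp only: mult_eq_0_iff) simp
      moreover have "real (2 * (s - 1)) + 2 * \<beta> = A" using s by (simp add: A_def N_def of_nat_diff)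
      moreover have "- real (2 * (s - 1) + 1) = - real N + 2" using s by (simp add: N_def of_nat_diff)
      ultimately have *: "coeff (even_mode \<beta> (2 * (s - 1))) k =
          ((real N - 2 * real k) * (real N - 1 - 2 * real k) * pochhammer (- real N) (2 * k) / (real N * (real N - 1)))
          * pochhammer A (2 * k) / pochhammer \<beta> (2 * k)"
        by (simp only: coeff_even_mode)
      show "coeff (even_mode \<beta> (2 * (s - 1))) k = coeff (Polynomial.smult (4 / (real N * (real N - 1))) (shifted_euler (real N / 2) g2)) k"
      proof -
        have e: "4 * ((real k - real N / 2) * (real k - (real N - 1) / 2)) = (real N - 2 * real k) * (real N - 1 - 2 * real k)"
          by (simp add: field_simps)
        have "coeff (Polynomial.smult (4 / (real N * (real N - 1))) (shifted_euler (real N / 2) g2)) k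
            = (4 * ((real k - real N / 2) * (real k - (real N - 1) / 2))) * coeff P k / (real N * (real N - 1))"
          by (simp add: g2_def rs)
        then show ?thesis unfolding e cP *
          by (simp only: times_divide_eq_left times_divide_eq_right divide_divide_eq_left mult_ac)
      qed
    qed
    show thesis
    proof (rule main[of "2 * (s - 1)"])
      show "neg_simple (even_mode \<beta> (2 * (s - 1)))" unfolding ev using g2 s
        by (intro neg_simple_smult neg_simple_shifted_euler) (auto simp: N_def)
      show False if "poly (even_mode \<beta> (2 * (s - 1))) z = 0" "poly (odd_mode \<beta> mo) z = 0" for z
      proof -
        have "real N > 1" using s by (simp add: N_def)
        then have "real N / 2 \<noteq> - ((A + 1) / 2)" "real N * (real N - 1) \<noteq> 0"
          using A by (auto simp: field_simps)
        then show False
          using shifted_euler_no_common_root[OF g2(1), of "real N / 2" "- ((A + 1) / 2)" z] that unfolding ev od2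
          by (auto simp: divide_eq_0_iff)
      qed
    qed (use n' s2 in \<open>auto simp: deg_even mo_def\<close>)
  qed
qed

section \<open>Eigenfunctions of both parities\<close>

text \<open>
The hypergeometric polynomial \<open>2F1(- N, b; c; t)\<close>. With \<open>b = N + 2 c - 1\<close> it is, up to a factor, the
Gegenbauer polynomial of degree \<open>N\<close> and index \<open>c - 1/2\<close> in the variable \<open>1 - 2 t\<close>.
\<close>

definition hyp :: "nat \<Rightarrow> real \<Rightarrow> real \<Rightarrow> real poly" where
  "hyp N b c = (\<Sum>j\<le>N. monom (pochhammer (- real N) j * pochhammer b j / (fact j * pochhammer c j)) j)"

lemma coeff_hyp: "coeff (hyp N b c) j = pochhammer (- real N) j * pochhammer b j / (fact j * pochhammer c j)"
proof (cases "j \<le> N")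
  case False
  then have "pochhammer (- real N) j = 0" by (simp add: pochhammer_of_nat_eq_0_iff)
  with False show ?thesis by (simp add: hyp_def coeff_sum)
qed (simp add: hyp_def coeff_sum)

lemma degree_hyp_le: "degree (hyp N b c) \<le> N"
  by (rule degree_le) (simp add: coeff_hyp pochhammer_of_nat_eq_0_iff)

lemma pochhammer_nonzero:
  assumes "c > -1" "c \<noteq> (0::real)"
  shows "pochhammer c j \<noteq> 0"
proof
  assume "pochhammer c j = 0"
  then obtain i where i: "i < j" "c = - real i" by (auto simp: pochhammer_eq_0_iff)
  then have "real i < 1" using assms(1) by simp
  then show False using i assms by auto
qed

lemma pderiv_hyp:
  assumes "c > -1" "c \<noteq> 0"
  shows "pderiv (hyp (Suc N) b c) = Polynomial.smult (- (real N + 1) * b / c) (hyp N (b + 1) (c + 1))"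
proof (rule poly_eqI)
  fix j
  have nz: "pochhammer (c + 1) j \<noteq> 0" using pochhammer_nonzero[OF assms, of "Suc j"] by (simp add: pochhammer_rec)
  have e1: "pochhammer (- real (Suc N)) (Suc j) = - (real N + 1) * pochhammer (- real N) j"
    by (simp add: pochhammer_rec)
  have e2: "pochhammer b (Suc j) = b * pochhammer (b + 1) j" "pochhammer c (Suc j) = c * pochhammer (c + 1) j"
    by (simp_all add: pochhammer_rec)
  define q where "q = real (Suc j)"
  have q: "q \<noteq> 0" by (simp add: q_def)
  show "coeff (pderiv (hyp (Suc N) b c)) j = coeff (Polynomial.smult (- (real N + 1) * b / c) (hyp N (b + 1) (c + 1))) j"
    using assms nz q by (simp only: coeff_pderiv coeff_hyp coeff_smult fact_Suc e1 e2 q_def[symmetric]) (simp add: field_simps)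
qed

lemma poly_hyp_0: "poly (hyp N b c) 0 = 1"
  by (simp add: poly_0_coeff_0 coeff_hyp)

lemma poly_hyp_1:
  assumes "c > -1" "c \<noteq> 0"
  shows "poly (hyp N b c) 1 = pochhammer (c - b) N / pochhammer c N"
proof -
  have "poly (hyp N b c) 1 = (\<Sum>j=0..N. pochhammer b j * pochhammer (- real N) j / (of_nat (fact j) * pochhammer c j))"
    unfolding hyp_def poly_sum poly_monom atMost_atLeast0 by (intro sum.cong) (auto simp: mult.commute)
  also have "\<dots> = pochhammer (c - b) N / pochhammer c N"
  proof (rule Vandermonde_pochhammer)
    show "\<forall>i\<in>{0..<N}. c \<noteq> - of_nat i"
    proof
      fix i assume "i \<in> {0..<N}"
      show "c \<noteq> - of_nat i" using assms by (cases i) auto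
    qed
  qed
  finally show ?thesis .
qed

lemma jac_hyp:
  assumes "a > 0" "c > 0"
  shows "jac a c (hyp N b a) = Beta a c * pochhammer (a + c - b) N / pochhammer (a + c) N"
proof -
  have nz: "pochhammer a j \<noteq> 0" for j using assms by (intro less_imp_neq[symmetric] pochhammer_pos) auto
  have "jac a c (hyp N b a) = (\<Sum>j\<le>N. pochhammer (- real N) j * pochhammer b j
      / (fact j * pochhammer a j) * (Beta a c * pochhammer a j / pochhammer (a + c) j))"
    unfolding hyp_def using assms by (simp add: jac_sum jac_monom Beta_add_nat)
  also have "\<dots> = Beta a c * (\<Sum>j=0..N. pochhammer b j * pochhammer (- real N) j
      / (of_nat (fact j) * pochhammer (a + c) j))"
    unfolding sum_distrib_left atMost_atLeast0 using nz by (intro sum.cong) (auto simp: field_simps)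
  also have "(\<Sum>j=0..N. pochhammer b j * pochhammer (- real N) j
      / (of_nat (fact j) * pochhammer (a + c) j)) = pochhammer (a + c - b) N / pochhammer (a + c) N"
    using assms by (intro Vandermonde_pochhammer) auto
  finally show ?thesis by simp
qed

text \<open>
Against \<open>(1 - t)^i\<close> the Chu-Vandermonde value contains the factor \<open>(i + 1 - m)_m\<close>, which is zero for
\<open>i < m\<close>.
\<close>

lemma hyp_orthogonal:
  assumes a: "a > 0" and Q: "degree Q < m"
  shows "jac a a (hyp m (real m + 2 * a - 1) a * Q) = 0"
proof -
  let ?H = "hyp m (real m + 2 * a - 1) a"
  have V: "jac a a (?H * [:1, -1:] ^ i) = 0" if "i < m" for i
  proof -
    have "pochhammer (a + (a + real i) - (real m + 2 * a - 1)) m = 0"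
      using that by (subst pochhammer_eq_0_iff) (auto intro!: exI[of _ "m - Suc i"] simp: of_nat_diff)
    then show ?thesis unfolding jac_shift_right_power using jac_hyp[of a "a + real i" m "real m + 2 * a - 1"] a by simp
  qed
  have "jac a a (?H * monom 1 k) = 0" if "k < m" for k
    using that a by (subst jac_mult_monom) (auto simp: V intro!: sum.neutral)
  then show ?thesis using Q a by (subst jac_mult_coeffs[of a a Q "degree Q"]) (auto intro!: sum.neutral)
qed

lemma pderiv_reflect: "pderiv (pcompose p [:1, -1:]) = - pcompose (pderiv p) [:1, -1 :: 'a :: field_char_0:]"
  by (simp add: pderiv_pcompose pderiv_pCons)

lemma pderiv_zero_const:
  assumes "pderiv (p :: 'a :: field_char_0 poly) = 0"
  shows "poly p x = poly p y"
proof -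
  have "degree p = 0" using assms by (simp add: pderiv_eq_0_iff)
  then obtain c where "p = [:c:]" by (rule degree_eq_zeroE)
  then show ?thesis by simp
qed

text \<open>
By induction on the degree: differentiation lowers \<open>N\<close> and raises \<open>c\<close>, so the derivative of the
difference of both sides vanishes, and the values at \<open>t = 0\<close> agree by the Chu-Vandermonde identity.
\<close>

lemma reflect_hyp:
  assumes "c > -1" "c \<noteq> 0"
  shows "pcompose (hyp N (real N + 2 * c - 1) c) [:1, -1:] = Polynomial.smult ((-1) ^ N) (hyp N (real N + 2 * c - 1) c)"
  using assms
proof (induction N arbitrary: c)
  case 0
  have "hyp 0 b c = [:1:]" for b by (simp add: hyp_def monom_0)
  then show ?case by simp
next
  case (Suc N)
  define H h \<kappa> where "H = hyp (Suc N) (real (Suc N) + 2 * c - 1) c" and "h = hyp N (real N + 2 * (c + 1) - 1) (c + 1)"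
    and "\<kappa> = - (real N + 1) * (real (Suc N) + 2 * c - 1) / c"
  have H': "pderiv H = Polynomial.smult \<kappa> h"
    using pderiv_hyp[OF Suc.prems, of N "real (Suc N) + 2 * c - 1"] unfolding H_def h_def \<kappa>_def by (simp add: algebra_simps)
  have IH: "pcompose h [:1, -1:] = Polynomial.smult ((-1) ^ N) h"
    unfolding h_def using Suc.prems by (intro Suc.IH) auto
  define D where "D = pcompose H [:1, -1:] - Polynomial.smult ((-1) ^ Suc N) H"
  have D': "pderiv D = 0"
  proof -
    have "pderiv D = - pcompose (pderiv H) [:1, -1:] - Polynomial.smult ((-1) ^ Suc N) (pderiv H)"
      by (simp only: D_def pderiv_diff pderiv_smult pderiv_reflect)
    also have "\<dots> = 0" unfolding H' by (simp add: pcompose_smult IH mult.commute)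
    finally show ?thesis .
  qed
  have "poly H 1 = (-1) ^ Suc N"
  proof -
    have "pochhammer (c - (real (Suc N) + 2 * c - 1)) (Suc N) = (-1) ^ Suc N * pochhammer c (Suc N)"
      using pochhammer_minus'[of "- c" "Suc N"] by (simp add: algebra_simps)
    then show ?thesis unfolding H_def poly_hyp_1[OF Suc.prems] using pochhammer_nonzero[OF Suc.prems, of "Suc N"] by simp
  qed
  moreover have "poly H 0 = 1" by (simp add: H_def poly_hyp_0)
  ultimately have D0: "poly D 0 = 0" by (simp add: D_def poly_pcompose)
  have "D = 0" using pderiv_zero_const[OF D', of _ 0] D0 by (intro poly_ext) simp
  then show ?case unfolding D_def H_def by simp
qed

lemma smult_sum_gen: "Polynomial.smult c (sum f A) = (\<Sum>x\<in>A. Polynomial.smult c (f x))"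
  by (induction A rule: infinite_finite_induct) (simp_all add: smult_add_right)

text \<open>
The partial sum of the Neumann series of \<open>(1 - z D\<^sup>2)\<close> inverse; it is exact on polynomials of degree at
most \<open>N\<close>.
\<close>

definition neumann :: "'a \<Rightarrow> nat \<Rightarrow> 'a poly \<Rightarrow> 'a :: field_char_0 poly" where
  "neumann z N G = (\<Sum>k\<le>N. Polynomial.smult (z ^ k) ((pderiv ^^ (2 * k)) G))"

lemma neumann_equation:
  assumes "degree G \<le> N"
  shows "neumann z N G - Polynomial.smult z (pderiv (pderiv (neumann z N G))) = G"
proof -
  define f where "f = (\<lambda>k. Polynomial.smult (z ^ k) ((pderiv ^^ (2 * k)) G))"
  have S: "neumann z N G = (\<Sum>k\<le>N. f k)" by (simp add: neumann_def f_def)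
  have "Polynomial.smult z (pderiv (pderiv (f k))) = f (Suc k)" for k
    by (simp add: f_def pderiv_smult)
  then have "Polynomial.smult z (pderiv (pderiv (neumann z N G))) = (\<Sum>k\<le>N. f (Suc k))"
    unfolding S pderiv_sum_gen by (simp add: smult_sum_gen)
  moreover have "f (Suc N) = 0"
  proof -
    have "(pderiv ^^ (2 * Suc N)) G = 0"
      by (rule poly_eqI) (use assms in \<open>simp only: coeff_higher_pderiv\<close>, simp add: coeff_eq_0)
    then show ?thesis by (simp add: f_def)
  qed
  moreover have "f 0 = G" by (simp add: f_def)
  ultimately show ?thesis unfolding S using sum_telescope[of f N] by (simp add: sum_subtractf)
qed

lemma degree_higher_pderiv_le: "degree ((pderiv ^^ j) G) \<le> degree (G :: 'a :: field_char_0 poly)"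
  by (simp add: degree_higher_pderiv)

lemma degree_neumann_le: "degree (neumann z N G) \<le> degree G"
  unfolding neumann_def
  by (intro degree_sum_le order.trans[OF degree_smult_le degree_higher_pderiv_le]) auto

lemma poly_higher_pderiv_0: "poly ((pderiv ^^ j) G) 0 = fact j * coeff (G :: 'a :: field_char_0 poly) j"
  by (simp add: poly_0_coeff_0 coeff_higher_pderiv pochhammer_fact)

lemma reflect_higher_pderiv:
  fixes G :: "'a :: field_char_0 poly"
  assumes "pcompose G [:1, -1:] = Polynomial.smult s G"
  shows "pcompose ((pderiv ^^ j) G) [:1, -1:] = Polynomial.smult ((-1) ^ j * s) ((pderiv ^^ j) G)"
proof (induction j)
  case (Suc j)
  have "- pcompose (pderiv ((pderiv ^^ j) G)) [:1, -1:] = Polynomial.smult ((-1) ^ j * s) (pderiv ((pderiv ^^ j) G))"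
    using arg_cong[OF Suc, of pderiv] by (simp only: pderiv_reflect pderiv_smult)
  then have "pcompose (pderiv ((pderiv ^^ j) G)) [:1, -1:] = - Polynomial.smult ((-1) ^ j * s) (pderiv ((pderiv ^^ j) G))"
    by (metis minus_minus)
  then show ?case by simp
qed (use assms in simp)

lemma reflect_neumann:
  fixes G :: "'a :: field_char_0 poly"
  assumes "pcompose G [:1, -1:] = Polynomial.smult s G"
  shows "pcompose (neumann z N G) [:1, -1:] = Polynomial.smult s (neumann z N G)"
  unfolding neumann_def
  by (simp add: pcompose_sum pcompose_smult reflect_higher_pderiv[OF assms] smult_sum_gen mult.commute)

lemma antiderivative:
  fixes F :: "'a :: field_char_0 poly"
  assumes "degree F \<le> M"
  obtains U where "pderiv U = F" "poly U 0 = 0" "degree U \<le> Suc M"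
proof
  let ?U = "\<Sum>i\<le>M. monom (coeff F i / of_nat (Suc i)) (Suc i)"
  have "pderiv (monom (coeff F i / of_nat (Suc i)) (Suc i)) = monom (coeff F i) i" for i
    by (simp add: pderiv_monom del: of_nat_Suc)
  then show "pderiv ?U = F" unfolding pderiv_sum_gen using poly_as_sum_of_monoms'[OF assms] by simp
  show "poly ?U 0 = 0" by (simp add: poly_sum poly_monom)
  show "degree ?U \<le> Suc M" by (intro degree_sum_le) (auto intro: order.trans[OF degree_monom_le])
qed

lemma mode_coeff_even:
  "fact (2 * k) * coeff (hyp (m + 1) (real m + 2 * \<beta>) \<beta>) (2 * k) = coeff (even_mode \<beta> m) k"
  unfolding coeff_hyp coeff_even_mode by simp

lemma degree_even_mode_le: "degree (even_mode \<beta> m) \<le> m + 1"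
  unfolding even_mode_def by (intro degree_sum_le) (auto intro: order.trans[OF degree_monom_le])

lemma degree_odd_mode_le: "degree (odd_mode \<beta> m) \<le> m + 1"
  unfolding odd_mode_def by (intro degree_sum_le) (auto intro: order.trans[OF degree_monom_le])

lemma coeff_cp: "coeff (cp p) k = of_real (coeff p k)"
  by (simp add: coeff_map_poly)

lemma cp_minus: "cp (- p) = - cp p"
  by (simp add: poly_eq_iff coeff_map_poly)

lemma cp_pcompose_reflect: "cp (pcompose p [:1, -1:]) = pcompose (cp p) [:1, -1:]"
proof (induction p)
  case (pCons a p)
  then show ?case by (simp add: pcompose_pCons cp_add cp_mult cp_pCons cp_minus)
qed simp

text \<open>
Properties of \<open>G\<close>, whose derivative is a multiple of the Gegenbauer polynomial of degree \<open>m\<close>. Starting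
from \<open>G\<close> instead of its derivative is what makes the first boundary condition a hypergeometric polynomial
in \<open>z\<close>.
\<close>

lemma generator:
  fixes \<beta> :: real
  assumes \<beta>: "\<beta> > -1" "\<beta> \<noteq> 0" and m: "real m + 2 * \<beta> > 0"
  defines "G \<equiv> hyp (m + 1) (real m + 2 * \<beta>) \<beta>"
  shows "degree G \<le> m + 1" "pcompose G [:1, -1:] = Polynomial.smult ((-1) ^ (m + 1)) G"
    "pderiv G \<noteq> 0" "degree Q < m \<Longrightarrow> jac (\<beta> + 1) (\<beta> + 1) (pderiv G * Q) = 0"
proof -
  show "degree G \<le> m + 1" unfolding G_def by (rule degree_hyp_le)
  have e: "real m + 2 * \<beta> = real (m + 1) + 2 * \<beta> - 1" by simp
  show "pcompose G [:1, -1:] = Polynomial.smult ((-1) ^ (m + 1)) G"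
    unfolding G_def e by (rule reflect_hyp[OF \<beta>])
  define \<kappa> where "\<kappa> = - (real m + 1) * (real m + 2 * \<beta>) / \<beta>"
  have \<kappa>: "\<kappa> \<noteq> 0" using m \<beta> by (simp add: \<kappa>_def add_nonneg_eq_0_iff)
  have e2: "real m + 2 * \<beta> + 1 = real m + 2 * (\<beta> + 1) - 1" by simp
  have d: "pderiv G = Polynomial.smult \<kappa> (hyp m (real m + 2 * (\<beta> + 1) - 1) (\<beta> + 1))"
    using pderiv_hyp[OF \<beta>, of m "real m + 2 * \<beta>"] unfolding G_def \<kappa>_def e2 by simp
  have "poly (hyp m (real m + 2 * (\<beta> + 1) - 1) (\<beta> + 1)) 0 \<noteq> 0" by (simp add: poly_hyp_0)
  then have "hyp m (real m + 2 * (\<beta> + 1) - 1) (\<beta> + 1) \<noteq> 0" by auto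
  then show "pderiv G \<noteq> 0" unfolding d using \<kappa> by simp
  show "jac (\<beta> + 1) (\<beta> + 1) (pderiv G * Q) = 0" if "degree Q < m"
    unfolding d mult_smult_left jac_smult using hyp_orthogonal[OF _ that, of "\<beta> + 1"] \<beta> by simp
qed

text \<open>
For even \<open>m\<close> the function \<open>F = U'\<close> is odd about \<open>t = 1/2\<close>. Hence its integral vanishes, and its vanishing at
one end point implies that at the other. The only condition left is \<open>F(0) = 0\<close>.
\<close>

lemma even_eigenfunction:
  fixes z :: complex
  assumes \<beta>: "\<beta> > -1" "\<beta> \<noteq> 0" and m: "even m" "real m + 2 * \<beta> > 0"
    and z: "poly (cp (even_mode \<beta> m)) z = 0"
  obtains U g where "degree U \<le> m + 2" "U \<noteq> 0" "poly U 0 = 0" "poly U 1 = 0"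
    "poly (pderiv U) 0 = 0" "poly (pderiv U) 1 = 0"
    "pderiv (pderiv U) - Polynomial.smult z (pderiv (pderiv (pderiv (pderiv U)))) = cp g"
    "\<And>Q. degree Q < m \<Longrightarrow> jac (\<beta> + 1) (\<beta> + 1) (g * Q) = 0"
proof -
  define G where "G = hyp (m + 1) (real m + 2 * \<beta>) \<beta>"
  note G = generator[OF \<beta> m(2), folded G_def]
  define F where "F = neumann z (m + 1) (cp G)"
  have F_eq: "F - Polynomial.smult z (pderiv (pderiv F)) = cp G"
    unfolding F_def by (rule neumann_equation) (use G(1) in simp)
  have "pcompose (cp G) [:1, -1:] = Polynomial.smult (-1) (cp G)"
    using arg_cong[OF G(2), of cp] m(1) by (simp add: cp_pcompose_reflect cp_smult cp_minus)
  then have F_refl: "pcompose F [:1, -1:] = - F" unfolding F_def using reflect_neumann[of "cp G" "-1" z "m + 1"] by simp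
  have F0: "poly F 0 = 0"
  proof -
    have "poly F 0 = (\<Sum>k\<le>m + 1. of_real (fact (2 * k) * coeff G (2 * k)) * z ^ k)"
      unfolding F_def neumann_def poly_sum poly_smult poly_higher_pderiv_0 coeff_cp
      by (intro sum.cong refl) (simp add: mult_ac)
    also have "\<dots> = (\<Sum>k\<le>m + 1. coeff (cp (even_mode \<beta> m)) k * z ^ k)"
      unfolding G_def mode_coeff_even coeff_cp ..
    also have "\<dots> = poly (cp (even_mode \<beta> m)) z"
      by (rule poly_eq_sum_atMost[symmetric]) (use degree_even_mode_le in simp)
    finally show ?thesis using z by simp
  qed
  have F1: "poly F 1 = 0" using arg_cong[OF F_refl, of "\<lambda>p. poly p 0"] F0 by (simp add: poly_pcompose)
  have "degree F \<le> m + 1" unfolding F_def using degree_neumann_le[of z "m + 1" "cp G"] G(1) by simp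
  then obtain U where U: "pderiv U = F" "poly U 0 = 0" "degree U \<le> Suc (m + 1)" by (rule antiderivative)
  have "pderiv (pcompose U [:1, -1:] - U) = 0" by (simp add: pderiv_diff pderiv_reflect U F_refl)
  from pderiv_zero_const[OF this, of 0 1] have U1: "poly U 1 = 0" using U(2) by (simp add: poly_pcompose)
  have res: "pderiv (pderiv U) - Polynomial.smult z (pderiv (pderiv (pderiv (pderiv U)))) = cp (pderiv G)"
    using arg_cong[OF F_eq, of pderiv] by (simp add: U(1) pderiv_diff pderiv_smult cp_pderiv)
  have "U \<noteq> 0"
  proof
    assume "U = 0"
    then have "cp (pderiv G) = 0" using res by simp
    then show False using G(3) by simp
  qed
  then show thesis using that[of U "pderiv G"] U U1 F0 F1 res G(4) by simp
qed

text \<open>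
Generically \<open>G\<close> has a hypergeometric primitive with parameter \<open>\<beta> - 1\<close>, whose end values are known by
parity. For \<open>\<beta> = 1\<close> that parameter would be \<open>0\<close>, and the integral is a Chu-Vandermonde sum that vanishes.
\<close>

lemma integral_generator:
  assumes \<beta>: "\<beta> > 0" and m: "odd m"
  shows "(real m + 2) * (real m + 2 * \<beta> - 1) * jac 1 1 (hyp (m + 1) (real m + 2 * \<beta>) \<beta>) = 2 * (\<beta> - 1)"
proof (cases "\<beta> = 1")
  case True
  have "pochhammer (1 + 1 - (real m + 2)) (m + 1) = 0"
    by (subst pochhammer_eq_0_iff) (auto intro!: exI[of _ m])
  then have "jac 1 1 (hyp (m + 1) (real m + 2) 1) = 0" using jac_hyp[of 1 1 "m + 1" "real m + 2"] by simp
  then show ?thesis using True by simp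
next
  case False
  have c: "\<beta> - 1 > -1" "\<beta> - 1 \<noteq> 0" using \<beta> False by auto
  define H where "H = hyp (m + 2) (real (m + 2) + 2 * (\<beta> - 1) - 1) (\<beta> - 1)"
  define I where "I = jac 1 1 (hyp (m + 1) (real m + 2 * \<beta>) \<beta>)"
  have e: "real (m + 2) + 2 * (\<beta> - 1) - 1 + 1 = real m + 2 * \<beta>" "real (m + 2) + 2 * (\<beta> - 1) - 1 = real m + 2 * \<beta> - 1" by simp_all
  have d: "pderiv H = Polynomial.smult (- (real (m + 1) + 1) * (real m + 2 * \<beta> - 1) / (\<beta> - 1)) (hyp (m + 1) (real m + 2 * \<beta>) \<beta>)"
    using pderiv_hyp[OF c, of "m + 1" "real (m + 2) + 2 * (\<beta> - 1) - 1"] unfolding H_def e by simp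
  have "poly H 1 = (-1) ^ (m + 2) * poly H 0"
    using arg_cong[OF reflect_hyp[OF c, of "m + 2"], of "\<lambda>p. poly p 0"] unfolding H_def[symmetric] by (simp add: poly_pcompose)
  then have "poly H 1 = -1" "poly H 0 = 1" using m by (simp_all add: H_def poly_hyp_0)
  then have "jac 1 1 (pderiv H) = -2" by (simp add: jac_derivative)
  then have "(- (real (m + 1) + 1) * (real m + 2 * \<beta> - 1) / (\<beta> - 1)) * I = -2" unfolding d jac_smult I_def .
  then show ?thesis using c(2) unfolding I_def[symmetric] by (simp add: field_simps)
qed

text \<open>
For \<open>k \<ge> 1\<close> the integral of \<open>D^(2k) G\<close> is the increment of \<open>D^(2k-1) G\<close>, that is, by parity, minus twice its
value at \<open>0\<close>. The two neighbouring hypergeometric coefficients combine to a product because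
\<open>(y - 2 - m) (m + 2 \<beta> + y - 1) + 2 (\<beta> + y - 1) = - (m + 1 - y) (m + 2 \<beta> + y)\<close> with \<open>y = 2 k\<close>.
\<close>

lemma odd_mode_coeff_integral:
  assumes \<beta>: "\<beta> > 0" and m: "odd m"
  defines "G \<equiv> hyp (m + 1) (real m + 2 * \<beta>) \<beta>"
  shows "(real m + 2) * (real m + 2 * \<beta> - 1) * (poly ((pderiv ^^ (2 * k)) G) 0 - jac 1 1 ((pderiv ^^ (2 * k)) G))
    = coeff (odd_mode \<beta> m) k"
proof -
  have m1: "m \<ge> 1" using m by (cases m) auto
  show ?thesis
  proof (cases k)
    case 0
    have "coeff G 0 = 1" by (simp add: G_def coeff_hyp)
    moreover have "(real m + 2) * (real m + 2 * \<beta> - 1) * jac 1 1 G = 2 * (\<beta> - 1)"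
      unfolding G_def by (rule integral_generator[OF \<beta> m])
    ultimately show ?thesis by (simp add: 0 coeff_odd_mode[OF m1] poly_0_coeff_0 right_diff_distrib) (simp add: algebra_simps)
  next
    case (Suc j)
    have k2: "2 * k = Suc (Suc (2 * j))" by (simp add: Suc)
    define P Q Y where "P = pochhammer (- (real m + 1)) (Suc (2 * j))" and "Q = pochhammer (real m + 2 * \<beta>) (Suc (2 * j))"
      and "Y = pochhammer \<beta> (Suc (2 * j))"
    define y where "y = real (2 * j)"
    have Y: "Y > 0" "\<beta> + y + 1 > 0" using \<beta> by (auto simp: Y_def y_def intro: pochhammer_pos)
    have N: "- real (m + 1) = - (real m + 1)" by simp
    have odd_der: "fact (Suc (2 * j)) * coeff G (Suc (2 * j)) = P * Q / Y"
      unfolding G_def coeff_hyp P_def Q_def Y_def N by (simp del: fact_Suc)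
    have "fact (Suc (Suc (2 * j))) * coeff G (Suc (Suc (2 * j))) =
      pochhammer (- (real m + 1)) (Suc (Suc (2 * j))) * pochhammer (real m + 2 * \<beta>) (Suc (Suc (2 * j))) / pochhammer \<beta> (Suc (Suc (2 * j)))"
      unfolding G_def coeff_hyp N by (simp del: fact_Suc)
    also have "\<dots> = (P * (- (real m + 1) + real (Suc (2 * j)))) * (Q * (real m + 2 * \<beta> + real (Suc (2 * j)))) / (Y * (\<beta> + real (Suc (2 * j))))"
      unfolding P_def Q_def Y_def by (simp only: pochhammer_Suc[of _ "Suc (2 * j)"])
    also have "\<dots> = (P * (y - real m)) * (Q * (real m + 2 * \<beta> + y + 1)) / (Y * (\<beta> + y + 1))"
      by (simp add: y_def algebra_simps)
    finally have even_der: "poly ((pderiv ^^ (2 * k)) G) 0 = (P * (y - real m)) * (Q * (real m + 2 * \<beta> + y + 1)) / (Y * (\<beta> + y + 1))"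
      unfolding k2 poly_higher_pderiv_0 .
    have refl: "pcompose G [:1, -1:] = Polynomial.smult 1 G"
      using reflect_hyp[of \<beta> "m + 1"] \<beta> m unfolding G_def by (simp add: algebra_simps)
    have "poly ((pderiv ^^ Suc (2 * j)) G) 1 = - poly ((pderiv ^^ Suc (2 * j)) G) 0"
      using arg_cong[OF reflect_higher_pderiv[OF refl, of "Suc (2 * j)"], of "\<lambda>p. poly p 0"]
      by (simp add: poly_pcompose del: funpow.simps)
    then have "jac 1 1 (pderiv ((pderiv ^^ Suc (2 * j)) G)) = - 2 * poly ((pderiv ^^ Suc (2 * j)) G) 0"
      unfolding jac_derivative by simp
    then have int: "jac 1 1 ((pderiv ^^ (2 * k)) G) = - 2 * (P * Q / Y)"
      unfolding k2 poly_higher_pderiv_0 odd_der by simp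
    have c1: "pochhammer (- real (m + 2)) (2 * k) = - (real m + 2) * P"
      unfolding k2 P_def by (subst pochhammer_rec) (simp add: algebra_simps)
    have c2: "pochhammer (real m + 2 * \<beta> - 1) (2 * k) = (real m + 2 * \<beta> - 1) * Q"
      unfolding k2 Q_def by (subst pochhammer_rec) (simp add: algebra_simps)
    have c3: "pochhammer \<beta> (2 * k) = Y * (\<beta> + y + 1)"
      unfolding k2 Y_def by (subst pochhammer_Suc) (simp add: y_def algebra_simps)
    have c4: "real m + 1 - 2 * real k = real m - y - 1" "real m + 2 * \<beta> + 2 * real k = real m + 2 * \<beta> + y + 2"
      by (simp_all add: Suc y_def)
    have "(real m + 2) * (real m + 2 * \<beta> - 1) * ((P * (y - real m)) * (Q * (real m + 2 * \<beta> + y + 1)) / (Y * (\<beta> + y + 1)) - (- 2 * (P * Q / Y)))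
      = (- (real m + 2) * P) * ((real m + 2 * \<beta> - 1) * Q) * (real m - y - 1) * (real m + 2 * \<beta> + y + 2) / (Y * (\<beta> + y + 1))"
    proof -
      have "(P * (y - real m)) * (Q * (real m + 2 * \<beta> + y + 1)) / (Y * (\<beta> + y + 1)) - (- 2 * (P * Q / Y))
        = P * Q * ((y - real m) * (real m + 2 * \<beta> + y + 1) + 2 * (\<beta> + y + 1)) / (Y * (\<beta> + y + 1))"
        using Y by (simp add: divide_simps) (simp add: algebra_simps)
      also have "(y - real m) * (real m + 2 * \<beta> + y + 1) + 2 * (\<beta> + y + 1) = - ((real m - y - 1) * (real m + 2 * \<beta> + y + 2))"
        by (simp add: algebra_simps)
      finally have f: "(P * (y - real m)) * (Q * (real m + 2 * \<beta> + y + 1)) / (Y * (\<beta> + y + 1)) - (- 2 * (P * Q / Y))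
        = P * Q * (- ((real m - y - 1) * (real m + 2 * \<beta> + y + 2))) / (Y * (\<beta> + y + 1))" .
      define u where "u = real m + 2"
      show ?thesis unfolding f u_def[symmetric] by (simp add: mult_ac)
    qed
    then show ?thesis unfolding even_der int coeff_odd_mode[OF m1] c1 c2 c3 c4 .
  qed
qed

text \<open>
For odd \<open>m\<close> the function \<open>F\<close> is even about \<open>t = 1/2\<close>. Subtracting the constant \<open>F(0)\<close> leaves the residual
unchanged and takes care of both derivative conditions; the condition left is that \<open>U\<close> returns to \<open>0\<close>, i.e.
that the integral of \<open>F\<close> equals \<open>F(0)\<close>.
\<close>

lemma odd_eigenfunction:
  fixes z :: real
  assumes \<beta>: "\<beta> > 0" and m: "odd m" and z: "poly (odd_mode \<beta> m) z = 0"
  obtains U g where "degree U \<le> m + 2" "U \<noteq> 0" "poly U 0 = 0" "poly U 1 = 0"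
    "poly (pderiv U) 0 = 0" "poly (pderiv U) 1 = 0"
    "pderiv (pderiv U) - Polynomial.smult z (pderiv (pderiv (pderiv (pderiv U)))) = (g :: real poly)"
    "\<And>Q. degree Q < m \<Longrightarrow> jac (\<beta> + 1) (\<beta> + 1) (g * Q) = 0"
proof -
  have m1: "real m \<ge> 1" using m by (cases m) auto
  define G where "G = hyp (m + 1) (real m + 2 * \<beta>) \<beta>"
  have \<beta>': "\<beta> > -1" "\<beta> \<noteq> 0" "real m + 2 * \<beta> > 0" using \<beta> by auto
  note G = generator[OF \<beta>', folded G_def]
  define F where "F = neumann z (m + 1) G"
  have F_eq: "F - Polynomial.smult z (pderiv (pderiv F)) = G"
    unfolding F_def by (rule neumann_equation) (use G(1) in simp)
  have F_refl: "pcompose F [:1, -1:] = F" unfolding F_def using reflect_neumann[OF G(2), of z "m + 1"] m by simp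
  have F1: "poly F 1 = poly F 0" using arg_cong[OF F_refl, of "\<lambda>p. poly p 0"] by (simp add: poly_pcompose)
  have F0: "jac 1 1 F = poly F 0"
  proof -
    define e i where "e = (\<lambda>k. poly ((pderiv ^^ (2 * k)) G) 0)" and "i = (\<lambda>k. jac 1 1 ((pderiv ^^ (2 * k)) G))"
    have "poly F 0 - jac 1 1 F = (\<Sum>k\<le>m + 1. z ^ k * e k) - (\<Sum>k\<le>m + 1. z ^ k * i k)"
      unfolding F_def neumann_def poly_sum by (simp only: jac_sum zero_less_one jac_smult poly_smult e_def i_def)
    also have "\<dots> = (\<Sum>k\<le>m + 1. z ^ k * (e k - i k))" by (simp only: sum_subtractf right_diff_distrib)
    finally have "(real m + 2) * (real m + 2 * \<beta> - 1) * (poly F 0 - jac 1 1 F)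
      = (\<Sum>k\<le>m + 1. (real m + 2) * (real m + 2 * \<beta> - 1) * (z ^ k * (e k - i k)))"
      by (simp only: sum_distrib_left)
    also have "\<dots> = (\<Sum>k\<le>m + 1. z ^ k * ((real m + 2) * (real m + 2 * \<beta> - 1) * (poly ((pderiv ^^ (2 * k)) G) 0 - jac 1 1 ((pderiv ^^ (2 * k)) G))))"
      unfolding e_def i_def by (intro sum.cong refl) (simp only: mult_ac)
    also have "\<dots> = (\<Sum>k\<le>m + 1. coeff (odd_mode \<beta> m) k * z ^ k)"
      unfolding G_def odd_mode_coeff_integral[OF \<beta> m] by (simp add: mult.commute)
    also have "\<dots> = poly (odd_mode \<beta> m) z"
      by (rule poly_eq_sum_atMost[symmetric, OF degree_odd_mode_le])
    finally have "(real m + 2) * (real m + 2 * \<beta> - 1) * (poly F 0 - jac 1 1 F) = 0" using z by simp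
    moreover have "real m + 2 > 0" "real m + 2 * \<beta> - 1 > 0" using m1 \<beta> by auto
    ultimately show ?thesis by simp
  qed
  have "degree F \<le> m + 1" unfolding F_def using degree_neumann_le[of z "m + 1" G] G(1) by simp
  then obtain A where A: "pderiv A = F" "poly A 0 = 0" "degree A \<le> Suc (m + 1)" by (rule antiderivative)
  define U where "U = A - [:0, poly F 0:]"
  have U': "pderiv U = F - [:poly F 0:]" by (simp add: U_def pderiv_diff A pderiv_pCons)
  have "poly A 1 = poly F 0" using jac_derivative[of A] A F0 by simp
  then have U01: "poly U 0 = 0" "poly U 1 = 0" using A by (simp_all add: U_def)
  have res: "pderiv (pderiv U) - Polynomial.smult z (pderiv (pderiv (pderiv (pderiv U)))) = pderiv G"
    using arg_cong[OF F_eq, of pderiv] by (simp add: U' pderiv_diff pderiv_smult)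
  have "U \<noteq> 0"
  proof
    assume "U = 0"
    then have "pderiv G = 0" using res by simp
    then show False using G(3) by simp
  qed
  moreover have "degree U \<le> m + 2" unfolding U_def using A(3) by (intro degree_diff_le) auto
  ultimately show thesis using that[of U "pderiv G"] U01 F1 res G(4) by (simp add: U')
qed

section \<open>A positive root for negative parameter\<close>

text \<open>
All coefficients after the constant term \<open>1\<close> are non-positive, and the linear one is negative, so the
polynomial has become non-positive at \<open>- 1 / c\<close>, where \<open>c\<close> is the linear coefficient.
\<close>

lemma even_mode_positive_root:
  assumes \<beta>: "-1 < \<beta>" "\<beta> < 0" and m: "m \<ge> 2"
  obtains z where "z > 0" "poly (even_mode \<beta> m) z = 0"
proof -
  let ?c = "coeff (even_mode \<beta> m)"
  have B: "real m + 2 * \<beta> > 0" proof -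
    have "real m \<ge> 2" using m by simp
    then show ?thesis using \<beta> by linarith
  qed
  have den: "pochhammer \<beta> (2 * k) < 0" if "k \<ge> 1" for k
  proof -
    have "2 * k = Suc (2 * k - 1)" using that by simp
    then have "pochhammer \<beta> (2 * k) = \<beta> * pochhammer (\<beta> + 1) (2 * k - 1)" by (metis pochhammer_rec)
    moreover have "pochhammer (\<beta> + 1) (2 * k - 1) > 0" using \<beta> by (intro pochhammer_pos) auto
    ultimately show ?thesis using \<beta> by (simp add: mult_neg_pos)
  qed
  have num: "pochhammer (- real (m + 1)) (2 * k) > 0" if "2 * k \<le> m + 1" for k
  proof -
    have "pochhammer (- real (m + 1)) (2 * k) = pochhammer (real (m + 1) - real (2 * k) + 1) (2 * k)"
      by (subst pochhammer_minus) simp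
    moreover have "real (m + 1) - real (2 * k) + 1 > 0" using that by linarith
    ultimately show ?thesis by (metis pochhammer_pos)
  qed
  have posB: "pochhammer (real m + 2 * \<beta>) j > 0" for j using B by (intro pochhammer_pos)
  have neg: "?c k \<le> 0" if "k \<ge> 1" for k
  proof (cases "2 * k \<le> m + 1")
    case True
    have "0 \<le> pochhammer (- real (m + 1)) (2 * k) * pochhammer (real m + 2 * \<beta>) (2 * k)"
      using num[OF True] posB[of "2 * k"] by (intro mult_nonneg_nonneg) auto
    then show ?thesis unfolding coeff_even_mode using den[OF that] by (intro divide_nonneg_neg)
  next
    case False
    then have "pochhammer (- real (m + 1)) (2 * k) = 0" unfolding pochhammer_of_nat_eq_0_iff by simp
    then show ?thesis unfolding coeff_even_mode by simp
  qed
  have c1: "?c 1 < 0"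
  proof -
    have "0 < pochhammer (- real (m + 1)) (2 * 1) * pochhammer (real m + 2 * \<beta>) (2 * 1)"
      using num[of 1] posB[of "2 * 1"] m by (intro mult_pos_pos) auto
    then show ?thesis unfolding coeff_even_mode using den[of 1] by (intro divide_pos_neg) auto
  qed
  have c0: "?c 0 = 1" by (simp add: coeff_even_mode)
  have upper: "poly (even_mode \<beta> m) z \<le> 1 + ?c 1 * z" if "z \<ge> 0" for z
  proof -
    have "poly (even_mode \<beta> m) z = (\<Sum>k\<le>m + 1. ?c k * z ^ k)"
      by (rule poly_eq_sum_atMost[OF degree_even_mode_le])
    also have "\<dots> = (\<Sum>k\<in>{0, 1}. ?c k * z ^ k) + (\<Sum>k\<in>{..m + 1} - {0, 1}. ?c k * z ^ k)"
      by (subst sum.subset_diff[of "{0, 1}"]) auto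
    also have "(\<Sum>k\<in>{..m + 1} - {0, 1}. ?c k * z ^ k) \<le> 0"
      using that neg by (intro sum_nonpos mult_nonpos_nonneg) auto
    finally show ?thesis using c0 by simp
  qed
  have "poly (even_mode \<beta> m) (- 1 / ?c 1) \<le> 0"
    using upper[of "- 1 / ?c 1"] c1 by (simp add: field_simps)
  moreover have "0 \<le> poly (even_mode \<beta> m) 0" using c0 by (simp add: poly_0_coeff_0)
  ultimately obtain z where z: "0 \<le> z" "poly (even_mode \<beta> m) z = 0"
    using IVT2'[of "poly (even_mode \<beta> m)" "- 1 / ?c 1" 0 0] c1
      continuous_on_poly[OF continuous_on_id, of "{0..- 1 / ?c 1}" "even_mode \<beta> m"] by (auto simp: divide_nonpos_neg)
  moreover have "z \<noteq> 0" using z(2) c0 by (auto simp: poly_0_coeff_0)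
  ultimately show thesis using that[of z] by simp
qed

section \<open>The weighted integral in the coordinate t\<close>

lemma jac_coeffs_atMost:
  assumes "a > 0" "b > 0" "degree h \<le> M"
  shows "jac a b h = (\<Sum>k\<le>M. coeff h k * Beta (a + real k) b)"
  unfolding jac_coeffs[OF assms(1,2)] using assms(3) by (intro sum.mono_neutral_left) (auto simp: coeff_eq_0)

lemma has_bochner_integral_beta_kernel:
  assumes a: "a > (0::real)"
  shows "has_bochner_integral lborel
    (\<lambda>t. indicator {0<..<1} t *\<^sub>R (t ^ k * (t powr (a - 1) * (1 - t) powr (a - 1)))) (Beta (a + real k) a)"
proof -
  let ?f = "\<lambda>t. t powr (a + real k - 1) * (1 - t) powr (a - 1)"
  have int: "set_integrable lborel {0<..<1} ?f"
    by (rule set_integrable_subset[OF integrable_Beta]) (use a in auto)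
  have "(?f has_integral Beta (a + real k) a) {0<..<1}"
    using has_integral_Beta_real[of "a + real k" a] a by (simp add: has_integral_Icc_iff_Ioo)
  then have "(LINT t:{0<..<1}|lborel. ?f t) = Beta (a + real k) a"
    using set_borel_integral_eq_integral(2)[OF int] by (simp add: integral_unique)
  with int have "has_bochner_integral lborel (\<lambda>t. indicator {0<..<1} t *\<^sub>R ?f t) (Beta (a + real k) a)"
    unfolding set_integrable_def set_lebesgue_integral_def by (simp add: has_bochner_integral_iff)
  moreover have eq: "(\<lambda>t. indicator {0<..<1} t *\<^sub>R ?f t) = (\<lambda>t. indicator {0<..<1} t *\<^sub>R (t ^ k * (t powr (a - 1) * (1 - t) powr (a - 1))))"
  proof (rule ext)
    fix t
    show "indicator {0<..<1} t *\<^sub>R ?f t = indicator {0<..<1} t *\<^sub>R (t ^ k * (t powr (a - 1) * (1 - t) powr (a - 1)))"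
  proof (cases "0 < t")
    case True
    have "t powr (a + real k - 1) = t powr (real k + (a - 1))" by (simp add: algebra_simps)
    also have "\<dots> = t ^ k * t powr (a - 1)" unfolding powr_add using True by (simp add: powr_realpow)
    finally show ?thesis by simp
  qed simp
  qed
  ultimately show ?thesis by (simp only: eq)
qed

text \<open>
After the substitution \<open>x = 1 - 2 t\<close> the integral over each monomial in \<open>t\<close> is a Beta function. This makes
integrability and linearity evident.
\<close>

lemma weighted_integral_Beta:
  assumes \<gamma>: "\<gamma> > - 1 / 2" and M: "degree (pcompose p [:1, -2:]) \<le> M"
  shows "weighted_integral \<gamma> p = of_real (2 * 4 powr (\<gamma> - 1 / 2)) *
    (\<Sum>k\<le>M. coeff (pcompose p [:1, -2:]) k * of_real (Beta (\<gamma> + 1 / 2 + real k) (\<gamma> + 1 / 2)))"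
proof -
  define a where "a = \<gamma> + 1 / 2"
  have a: "a > 0" "a - 1 = \<gamma> - 1 / 2" using \<gamma> by (auto simp: a_def)
  define T where "T = pcompose p [:1, -2:]"
  define K where "K = 4 powr (\<gamma> - 1 / 2)"
  define ker where "ker = (\<lambda>t::real. t powr (a - 1) * (1 - t) powr (a - 1))"
  define F where "F = (\<lambda>x::real. indicator {-1<..<1} x *\<^sub>R (poly p (of_real x) * of_real (gegenbauer_weight \<gamma> x)))"
  have F: "F (1 + (- 2) * t) = of_real K * (\<Sum>k\<le>M. coeff T k * of_real (indicator {0<..<1} t *\<^sub>R (t ^ k * ker t)))" for t
  proof (cases "0 < t \<and> t < 1")
    case True
    have "1 - (1 + (- 2) * t)\<^sup>2 = 4 * (t * (1 - t))" by (simp add: power2_eq_square algebra_simps)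
    then have w: "gegenbauer_weight \<gamma> (1 + (- 2) * t) = K * ker t"
      unfolding gegenbauer_weight_def K_def ker_def a(2) using True by (simp add: powr_mult)
    have "poly p (of_real (1 + (- 2) * t)) = poly T (of_real t)" by (simp add: T_def poly_pcompose algebra_simps)
    also have "\<dots> = (\<Sum>k\<le>M. coeff T k * of_real t ^ k)"
      by (rule poly_eq_sum_atMost) (use M in \<open>simp add: T_def\<close>)
    finally have pt: "poly p (of_real (1 + (- 2) * t)) = (\<Sum>k\<le>M. coeff T k * of_real t ^ k)" .
    have "indicator {-1<..<1} (1 + (- 2) * t) = (1 :: real)" "indicator {0<..<1} t = (1::real)" using True by auto
    then show ?thesis unfolding F_def w pt by (simp add: sum_distrib_left sum_distrib_right mult_ac)
  next
    case False
    then have "indicator {-1<..<1} (1 + (- 2) * t) = (0 :: real)" "indicator {0<..<1} t = (0::real)" by auto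
    then show ?thesis unfolding F_def by simp
  qed
  have "has_bochner_integral lborel (\<lambda>t. of_real K * (\<Sum>k\<le>M. coeff T k * of_real (indicator {0<..<1} t *\<^sub>R (t ^ k * ker t))))
     (complex_of_real K * (\<Sum>k\<le>M. coeff T k * of_real (Beta (a + real k) a)))"
    unfolding ker_def
    by (intro has_bochner_integral_mult_right has_bochner_integral_sum has_bochner_integral_of_real
          has_bochner_integral_beta_kernel a(1))
  then have "(\<integral>t. F (1 + (- 2) * t) \<partial>lborel) = complex_of_real K * (\<Sum>k\<le>M. coeff T k * of_real (Beta (a + real k) a))"
    unfolding F by (rule has_bochner_integral_integral_eq)
  moreover have "weighted_integral \<gamma> p = (\<integral>x. F x \<partial>lborel)"
    unfolding weighted_integral_def set_lebesgue_integral_def F_def ..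
  moreover have "(\<integral>x. F x \<partial>lborel) = \<bar>- 2\<bar> *\<^sub>R (\<integral>t. F (1 + (- 2) * t) \<partial>lborel)"
    by (rule lborel_integral_real_affine) simp
  ultimately show ?thesis unfolding T_def[symmetric] a_def[symmetric] K_def[symmetric]
    by (simp add: scaleR_conv_of_real mult.assoc)
qed

lemma weighted_integral_add:
  assumes \<gamma>: "\<gamma> > - 1 / 2"
  shows "weighted_integral \<gamma> (p + q) = weighted_integral \<gamma> p + weighted_integral \<gamma> q"
proof -
  define M where "M = max (degree (pcompose p [:1, -2:])) (degree (pcompose q [:1, -2:]))"
  have "degree (pcompose (p + q) [:1, -2:]) \<le> M" unfolding pcompose_add M_def by (rule degree_add_le) auto
  then show ?thesis
    using weighted_integral_Beta[OF \<gamma>, of p M] weighted_integral_Beta[OF \<gamma>, of q M] weighted_integral_Beta[OF \<gamma>, of "p + q" M]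
    by (simp add: M_def pcompose_add distrib_left distrib_right sum.distrib)
qed

lemma weighted_integral_smult:
  assumes \<gamma>: "\<gamma> > - 1 / 2"
  shows "weighted_integral \<gamma> (Polynomial.smult c p) = c * weighted_integral \<gamma> p"
proof -
  have d: "degree (pcompose (Polynomial.smult c p) [:1, -2:]) \<le> degree (pcompose p [:1, -2:])"
    unfolding pcompose_smult by (rule degree_smult_le)
  show ?thesis
    unfolding weighted_integral_Beta[OF \<gamma> d] weighted_integral_Beta[OF \<gamma> order.refl, of p]
    by (simp add: pcompose_smult sum_distrib_left mult_ac)
qed

lemma weighted_integral_sum:
  assumes \<gamma>: "\<gamma> > - 1 / 2"
  shows "weighted_integral \<gamma> (sum f A) = (\<Sum>x\<in>A. weighted_integral \<gamma> (f x))"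
proof -
  have "weighted_integral \<gamma> 0 = 0" using weighted_integral_smult[OF \<gamma>, of 0 0] by simp
  then show ?thesis by (induction A rule: infinite_finite_induct) (simp_all add: weighted_integral_add[OF \<gamma>])
qed

lemma coeff_map_Re: "coeff (map_poly Re p) k = Re (coeff p k)" by (simp add: coeff_map_poly)
lemma coeff_map_Im: "coeff (map_poly Im p) k = Im (coeff p k)" by (simp add: coeff_map_poly)

lemma degree_map_Re: "degree (map_poly Re p) \<le> degree p"
  by (rule degree_le) (simp add: coeff_map_Re coeff_eq_0)
lemma degree_map_Im: "degree (map_poly Im p) \<le> degree p"
  by (rule degree_le) (simp add: coeff_map_Im coeff_eq_0)

text \<open>
Real and imaginary parts are separated so that positivity arguments for real polynomials apply.
\<close>

lemma weighted_integral_jac: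
  assumes \<gamma>: "\<gamma> > - 1 / 2"
  shows "weighted_integral \<gamma> p = of_real (2 * 4 powr (\<gamma> - 1 / 2)) *
    Complex (jac (\<gamma> + 1 / 2) (\<gamma> + 1 / 2) (map_poly Re (pcompose p [:1, -2:])))
            (jac (\<gamma> + 1 / 2) (\<gamma> + 1 / 2) (map_poly Im (pcompose p [:1, -2:])))"
proof -
  have a: "\<gamma> + 1 / 2 > 0" using \<gamma> by simp
  show ?thesis
    unfolding weighted_integral_Beta[OF \<gamma> order.refl] jac_coeffs_atMost[OF a a degree_map_Re] jac_coeffs_atMost[OF a a degree_map_Im]
    by (intro arg_cong2[of _ _ _ _ "(*)"] refl complex_eqI) (simp_all add: coeff_map_Re coeff_map_Im)
qed

lemma map_Re_cp_mult: "map_poly Re (cp g * h) = g * map_poly Re h"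
  by (rule poly_eqI) (simp add: coeff_map_Re coeff_mult coeff_map_poly)
lemma map_Im_cp_mult: "map_poly Im (cp g * h) = g * map_poly Im h"
  by (rule poly_eqI) (simp add: coeff_map_Im coeff_mult coeff_map_poly)

lemma affine_inverse:
  "pcompose (pcompose p [:1 / 2, - 1 / 2:]) [:1, -2:] = (p :: complex poly)"
  "pcompose (pcompose p [:1, -2:]) [:1 / 2, - 1 / 2:] = (p :: complex poly)"
proof -
  have "pcompose [:1 / 2, - 1 / 2:] [:1, -2:] = [:0, 1 :: complex:]" "pcompose [:1, -2:] [:1 / 2, - 1 / 2:] = [:0, 1 :: complex:]"
    by (simp_all add: pcompose_pCons)
  then show "pcompose (pcompose p [:1 / 2, - 1 / 2:]) [:1, -2:] = p" "pcompose (pcompose p [:1, -2:]) [:1 / 2, - 1 / 2:] = p"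
    by (simp_all add: pcompose_assoc[symmetric])
qed

text \<open>
Test with the polynomial that is the complex conjugate of \<open>p\<close> on the real line.
\<close>

lemma weighted_integral_definite:
  assumes \<gamma>: "\<gamma> > - 1 / 2" and orth: "\<And>q. degree q \<le> degree p \<Longrightarrow> weighted_integral \<gamma> (p * q) = 0"
  shows "p = 0"
proof -
  define h where "h = pcompose p [:1, -2:]"
  define r s where "r = map_poly Re h" and "s = map_poly Im h"
  define q where "q = pcompose (map_poly cnj h) [:1 / 2, - 1 / 2:]"
  have h: "h = cp r + Polynomial.smult \<i> (cp s)"
    by (rule poly_eqI) (simp add: r_def s_def coeff_map_poly complex_eq_iff)
  have ch: "map_poly cnj h = cp r - Polynomial.smult \<i> (cp s)"
    by (rule poly_eqI) (simp add: r_def s_def coeff_map_poly complex_eq_iff)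
  have "h * map_poly cnj h = (cp r + Polynomial.smult \<i> (cp s)) * (cp r - Polynomial.smult \<i> (cp s))"
    by (simp only: ch h[symmetric])
  also have "\<dots> = cp (r * r + s * s)"
    unfolding cp_add cp_mult by (rule poly_ext) (simp add: algebra_simps)
  finally have prod: "pcompose (p * q) [:1, -2:] = cp (r * r + s * s)"
    unfolding pcompose_mult q_def affine_inverse h_def[symmetric] .
  have "degree q \<le> degree p"
  proof -
    have "degree q \<le> degree (map_poly cnj h) * 1" unfolding q_def by (rule order.trans[OF degree_pcompose_le]) simp
    also have "\<dots> \<le> degree h" unfolding mult_1_right by (rule degree_le) (simp add: coeff_map_poly coeff_eq_0)
    also have "\<dots> \<le> degree p" unfolding h_def by (rule order.trans[OF degree_pcompose_le]) simp
    finally show ?thesis .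
  qed
  then have "weighted_integral \<gamma> (p * q) = 0" by (rule orth)
  moreover have "map_poly Re (cp (r * r + s * s)) = r * r + s * s" by (rule poly_eqI) (simp add: coeff_map_poly)
  ultimately have j0: "jac (\<gamma> + 1 / 2) (\<gamma> + 1 / 2) (r * r + s * s) = 0"
    unfolding weighted_integral_jac[OF \<gamma>] prod by (simp add: complex_eq_iff)
  have "r * r + s * s = 0"
  proof (rule ccontr)
    assume nz: "r * r + s * s \<noteq> 0"
    have "0 < jac (\<gamma> + 1 / 2) (\<gamma> + 1 / 2) (r * r + s * s)"
      by (rule jac_pos) (use \<gamma> nz in auto)
    then show False using j0 by simp
  qed
  then have e: "poly r x * poly r x + poly s x * poly s x = 0" for x
    by (metis poly_0 poly_add poly_mult)
  have "r = 0" "s = 0" by (rule poly_ext, use e in \<open>simp add: add_nonneg_eq_0_iff\<close>)+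
  then have "h = 0" by (simp add: h)
  then show "p = 0" using affine_inverse(2)[of p] by (simp add: h_def)
qed

lemma pderiv_affine: "pderiv (pcompose V [:1 / 2, - 1 / 2:]) = Polynomial.smult (- 1 / 2) (pcompose (pderiv V) [:1 / 2, - 1 / 2 :: complex:])"
  by (simp add: pderiv_pcompose pderiv_pCons)

text \<open>
The eigenvalue condition in the coordinate \<open>t\<close>. Since \<open>d/dx = - 1/2 d/dt\<close>, the operator \<open>\<lambda> D\<^sup>2 - D^4\<close> becomes
\<open>\<lambda> / 4\<close> times \<open>d\<^sup>2/dt\<^sup>2 - z d^4/dt^4\<close> with \<open>z = 1 / (4 \<lambda>)\<close>.
\<close>

lemma tau_eigenvalueI:
  fixes U :: "complex poly" and g :: "real poly"
  assumes \<gamma>: "\<gamma> > - 1 / 2" and z: "z \<noteq> 0"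
    and U: "degree U \<le> n" "U \<noteq> 0" "poly U 0 = 0" "poly U 1 = 0" "poly (pderiv U) 0 = 0" "poly (pderiv U) 1 = 0"
    and res: "pderiv (pderiv U) - Polynomial.smult z (pderiv (pderiv (pderiv (pderiv U)))) = cp g"
    and orth: "\<And>Q. degree Q \<le> n - 4 \<Longrightarrow> jac (\<gamma> + 1 / 2) (\<gamma> + 1 / 2) (g * Q) = 0"
  shows "tau_eigenvalue \<gamma> n (1 / (4 * z))"
proof -
  let ?L = "[:1 / 2, - 1 / 2 :: complex:]"
  define u where "u = pcompose U ?L"
  have "degree u \<le> n" unfolding u_def using U(1) by (intro order.trans[OF degree_pcompose_le]) simp
  moreover have "u \<noteq> 0" using U(2) affine_inverse(1)[of U] by (auto simp: u_def)
  moreover have "pderiv u = Polynomial.smult (- 1 / 2) (pcompose (pderiv U) ?L)" unfolding u_def by (rule pderiv_affine)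
  ultimately have u: "u \<in> trial_space n" "u \<noteq> 0"
    using U by (auto simp: trial_space_def u_def poly_pcompose)
  define X Y where "X = pcompose (pderiv (pderiv U)) ?L" and "Y = pcompose (pderiv (pderiv (pderiv (pderiv U)))) ?L"
  have two: "pderiv (pderiv (pcompose V ?L)) = Polynomial.smult (1 / 4) (pcompose (pderiv (pderiv V)) ?L)" for V
  proof -
    have "pderiv (pderiv (pcompose V ?L)) = Polynomial.smult (- 1 / 2 * (- 1 / 2)) (pcompose (pderiv (pderiv V)) ?L)"
      by (simp only: pderiv_affine pderiv_smult smult_smult)
    also have "- 1 / 2 * (- 1 / 2) = (1 / 4 :: complex)" by simp
    finally show ?thesis .
  qed
  have d2: "(pderiv ^^ 2) u = Polynomial.smult (1 / 4) X"
    unfolding X_def by (simp only: two[symmetric] u_def numeral_2_eq_2 funpow.simps o_apply id_apply)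
  have "(pderiv ^^ 4) u = pderiv (pderiv ((pderiv ^^ 2) u))" by (simp add: eval_nat_numeral)
  also have "\<dots> = Polynomial.smult (1 / 4 * (1 / 4)) Y"
    unfolding d2 X_def Y_def by (simp only: pderiv_smult two smult_smult)
  finally have d4: "(pderiv ^^ 4) u = Polynomial.smult (1 / 16) Y" by simp
  have "Polynomial.smult (1 / (4 * z)) ((pderiv ^^ 2) u) - (pderiv ^^ 4) u =
      Polynomial.smult (1 / (16 * z)) (pcompose (pderiv (pderiv U) - Polynomial.smult z (pderiv (pderiv (pderiv (pderiv U))))) ?L)"
    unfolding d2 d4 pcompose_diff pcompose_smult X_def[symmetric] Y_def[symmetric] using z by (simp add: smult_diff_right)
  then have r: "Polynomial.smult (1 / (4 * z)) ((pderiv ^^ 2) u) - (pderiv ^^ 4) u = Polynomial.smult (1 / (16 * z)) (pcompose (cp g) ?L)"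
    unfolding res .
  have "weighted_integral \<gamma> ((Polynomial.smult (1 / (4 * z)) ((pderiv ^^ 2) u) - (pderiv ^^ 4) u) * q) = 0" if q: "q \<in> test_space n" for q
  proof -
    define Q where "Q = pcompose q [:1, -2:]"
    have "degree Q \<le> n - 4" unfolding Q_def using q by (intro order.trans[OF degree_pcompose_le]) (simp add: test_space_def)
    then have dQ: "degree (map_poly Re Q) \<le> n - 4" "degree (map_poly Im Q) \<le> n - 4"
      using degree_map_Re[of Q] degree_map_Im[of Q] by simp_all
    have "pcompose (pcompose (cp g) ?L * q) [:1, -2:] = cp g * Q"
      unfolding pcompose_mult affine_inverse Q_def ..
    then have "weighted_integral \<gamma> (pcompose (cp g) ?L * q) = 0"
      unfolding weighted_integral_jac[OF \<gamma>] by (simp add: map_Re_cp_mult map_Im_cp_mult orth dQ complex_eq_iff)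
    then show ?thesis unfolding r mult_smult_left weighted_integral_smult[OF \<gamma>] by simp
  qed
  then show ?thesis unfolding tau_eigenvalue_def using u by blast
qed

section \<open>The characteristic polynomial\<close>

definition tau_pencil :: "real \<Rightarrow> nat \<Rightarrow> (nat \<Rightarrow> complex poly) \<Rightarrow> (nat \<Rightarrow> complex poly) \<Rightarrow> complex \<Rightarrow> complex mat" where
  "tau_pencil \<gamma> n \<phi> \<psi> l = mat (n - 3) (n - 3)
     (\<lambda>(i, j). weighted_integral \<gamma> (((pderiv ^^ 4) (\<phi> j) - Polynomial.smult l ((pderiv ^^ 2) (\<phi> j))) * \<psi> i))"

lemma poly_tau_char_poly:
  assumes \<gamma>: "\<gamma> > - 1 / 2"
  shows "poly (tau_char_poly \<gamma> n \<phi> \<psi>) l = det (tau_pencil \<gamma> n \<phi> \<psi> l)"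
proof -
  interpret h: comm_ring_hom "\<lambda>p. poly p l" by unfold_locales auto
  let ?X = "map_mat (\<lambda>a. [:a:]) (tau_matrix 4 \<gamma> n \<phi> \<psi>) - [:0, 1:] \<cdot>\<^sub>m map_mat (\<lambda>b. [:b:]) (tau_matrix 2 \<gamma> n \<phi> \<psi>)"
  have lin: "weighted_integral \<gamma> ((p - Polynomial.smult l q) * r) = weighted_integral \<gamma> (p * r) - l * weighted_integral \<gamma> (q * r)" for p q r
  proof -
    have "(p - Polynomial.smult l q) * r = p * r + Polynomial.smult (- l) (q * r)" by (simp add: algebra_simps)
    then show ?thesis by (simp only: weighted_integral_add[OF \<gamma>] weighted_integral_smult[OF \<gamma>]) simp
  qed
  have "map_mat (\<lambda>p. poly p l) ?X = tau_pencil \<gamma> n \<phi> \<psi> l"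
    by (rule eq_matI) (auto simp: tau_matrix_def tau_pencil_def lin)
  then show ?thesis unfolding tau_char_poly_def using h.hom_det[of ?X] by simp
qed

lemma degree_tau_char_poly: "degree (tau_char_poly \<gamma> n \<phi> \<psi>) \<le> n - 3"
proof -
  have "degree (tau_char_poly \<gamma> n \<phi> \<psi>) \<le> 1 * (n - 3)"
    unfolding tau_char_poly_def
    by (rule degree_det_le) (auto simp: tau_matrix_def intro!: degree_diff_le order.trans[OF degree_mult_le] order.trans[OF degree_pCons_le])
  then show ?thesis by simp
qed

lemma pderiv_funpow_sum: "(pderiv ^^ k) (\<Sum>j\<in>A. Polynomial.smult (v j) (f j)) = (\<Sum>j\<in>A. Polynomial.smult (v j) ((pderiv ^^ k) (f j :: complex poly)))"
proof (induction k)
  case (Suc k)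
  then show ?case by (simp add: pderiv_sum_gen pderiv_smult)
qed simp

lemma tau_pencil_mult:
  assumes \<gamma>: "\<gamma> > - 1 / 2" and i: "i < n - 3" and v: "dim_vec v = n - 3"
  shows "vec_index (tau_pencil \<gamma> n \<phi> \<psi> l *\<^sub>v v) i = weighted_integral \<gamma>
     (((pderiv ^^ 4) (\<Sum>j<n - 3. Polynomial.smult (vec_index v j) (\<phi> j))
       - Polynomial.smult l ((pderiv ^^ 2) (\<Sum>j<n - 3. Polynomial.smult (vec_index v j) (\<phi> j)))) * \<psi> i)"
proof -
  have "((pderiv ^^ 4) (\<Sum>j<n - 3. Polynomial.smult (vec_index v j) (\<phi> j))
       - Polynomial.smult l ((pderiv ^^ 2) (\<Sum>j<n - 3. Polynomial.smult (vec_index v j) (\<phi> j)))) * \<psi> i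
     = (\<Sum>j<n - 3. Polynomial.smult (vec_index v j) (((pderiv ^^ 4) (\<phi> j) - Polynomial.smult l ((pderiv ^^ 2) (\<phi> j))) * \<psi> i))"
    unfolding pderiv_funpow_sum
    by (rule poly_ext) (simp add: poly_sum sum_distrib_left sum_distrib_right sum_subtractf algebra_simps)
  then have "weighted_integral \<gamma> (((pderiv ^^ 4) (\<Sum>j<n - 3. Polynomial.smult (vec_index v j) (\<phi> j))
       - Polynomial.smult l ((pderiv ^^ 2) (\<Sum>j<n - 3. Polynomial.smult (vec_index v j) (\<phi> j)))) * \<psi> i)
     = (\<Sum>j<n - 3. vec_index v j * weighted_integral \<gamma> (((pderiv ^^ 4) (\<phi> j) - Polynomial.smult l ((pderiv ^^ 2) (\<phi> j))) * \<psi> i))"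
    by (simp only: weighted_integral_sum[OF \<gamma>] weighted_integral_smult[OF \<gamma>])
  moreover have "vec_index (tau_pencil \<gamma> n \<phi> \<psi> l *\<^sub>v v) i
     = (\<Sum>j<n - 3. weighted_integral \<gamma> (((pderiv ^^ 4) (\<phi> j) - Polynomial.smult l ((pderiv ^^ 2) (\<phi> j))) * \<psi> i) * vec_index v j)"
    using i v by (simp add: tau_pencil_def scalar_prod_def lessThan_atLeast0)
  ultimately show ?thesis by (simp add: mult.commute)
qed

text \<open>
The coefficient vector of an eigenfunction lies in the kernel of the pencil. Bases enter only through
spanning and independence, so that the monomial bases and arbitrary ones are treated alike.
\<close>

lemma tau_eigenvalue_char_poly_root:
  assumes \<gamma>: "\<gamma> > - 1 / 2" and l: "tau_eigenvalue \<gamma> n l"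
    and \<phi>: "\<And>u. u \<in> trial_space n \<Longrightarrow> \<exists>v. u = (\<Sum>j<n - 3. Polynomial.smult (v j) (\<phi> j))"
    and \<psi>: "\<And>i. i < n - 3 \<Longrightarrow> \<psi> i \<in> test_space n"
  shows "poly (tau_char_poly \<gamma> n \<phi> \<psi>) l = 0"
proof -
  obtain u where u: "u \<in> trial_space n" "u \<noteq> 0"
    "\<And>q. q \<in> test_space n \<Longrightarrow> weighted_integral \<gamma> ((Polynomial.smult l ((pderiv ^^ 2) u) - (pderiv ^^ 4) u) * q) = 0"
    using l unfolding tau_eigenvalue_def by blast
  obtain v where v: "u = (\<Sum>j<n - 3. Polynomial.smult (v j) (\<phi> j))" using \<phi>[OF u(1)] by blast
  define w where "w = Matrix.vec (n - 3) v"
  have uw: "u = (\<Sum>j<n - 3. Polynomial.smult (vec_index w j) (\<phi> j))" unfolding v by (intro sum.cong) (auto simp: w_def)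
  have "w \<noteq> 0\<^sub>v (n - 3)"
  proof
    assume "w = 0\<^sub>v (n - 3)"
    then have "u = 0" unfolding uw by (intro sum.neutral) auto
    with u(2) show False by simp
  qed
  moreover have "tau_pencil \<gamma> n \<phi> \<psi> l *\<^sub>v w = 0\<^sub>v (n - 3)"
  proof (rule eq_vecI)
    fix i assume "i < dim_vec (0\<^sub>v (n - 3) :: complex Matrix.vec)"
    then have i: "i < n - 3" by simp
    have "((pderiv ^^ 4) u - Polynomial.smult l ((pderiv ^^ 2) u)) * \<psi> i
       = Polynomial.smult (- 1) ((Polynomial.smult l ((pderiv ^^ 2) u) - (pderiv ^^ 4) u) * \<psi> i)" by (simp add: algebra_simps)
    then show "vec_index (tau_pencil \<gamma> n \<phi> \<psi> l *\<^sub>v w) i = vec_index (0\<^sub>v (n - 3)) i"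
      using tau_pencil_mult[OF \<gamma> i, of w \<phi> \<psi> l] u(3)[OF \<psi>[OF i]] i
      unfolding uw[symmetric] by (simp only: weighted_integral_smult[OF \<gamma>]) (simp add: w_def)
  qed (simp add: tau_pencil_def)
  moreover have "w \<in> carrier_vec (n - 3)" "tau_pencil \<gamma> n \<phi> \<psi> l \<in> carrier_mat (n - 3) (n - 3)"
    by (simp_all add: w_def tau_pencil_def)
  ultimately have "det (tau_pencil \<gamma> n \<phi> \<psi> l) = 0" using det_0_iff_vec_prod_zero by blast
  then show ?thesis by (simp add: poly_tau_char_poly[OF \<gamma>])
qed

text \<open>
A cubic with double zeros at both \<open>1\<close> and \<open>- 1\<close> vanishes.
\<close>

lemma cubic_trial_zero:
  assumes u: "u \<in> trial_space n" and d: "(pderiv ^^ 4) u = 0"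
  shows "u = 0"
proof -
  have c: "coeff u (k + 4) = 0" for k
  proof -
    have "pochhammer (of_nat (Suc k)) 4 * coeff u (k + 4) = 0" using arg_cong[OF d, of "\<lambda>p. coeff p k"] by (simp only: coeff_higher_pderiv coeff_0)
    moreover have "pochhammer (of_nat (Suc k) :: complex) 4 \<noteq> 0"
    proof
      assume "pochhammer (of_nat (Suc k) :: complex) 4 = 0"
      then obtain i where "(of_nat (Suc k) :: complex) = - of_nat i" by (auto simp: pochhammer_eq_0_iff)
      then have "(of_nat (Suc k + i) :: complex) = 0" by (simp only: of_nat_add; simp)
      then show False by (simp only: of_nat_eq_0_iff; simp)
    qed
    ultimately show ?thesis by simp
  qed
  have "u = [:coeff u 0, coeff u 1, coeff u 2, coeff u 3:]"
  proof (rule poly_eqI)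
    fix k
    show "coeff u k = coeff [:coeff u 0, coeff u 1, coeff u 2, coeff u 3:] k"
    proof (cases "k \<ge> 4")
      case True
      then obtain j where "k = j + 4" by (metis add.commute le_Suc_ex)
      then show ?thesis using c[of j] by (simp add: eval_nat_numeral)
    next
      case False
      then have "k = 0 \<or> k = 1 \<or> k = 2 \<or> k = 3" by auto
      then show ?thesis by (auto simp: eval_nat_numeral)
    qed
  qed
  then obtain a b c d where ue: "u = [:a, b, c, d:]" by blast
  have e: "a + b + c + d = 0" "a - b + c - d = 0" "b + 2 * c + 3 * d = 0" "b - 2 * c + 3 * d = 0"
    using u unfolding trial_space_def ue by (simp_all add: pderiv_pCons algebra_simps)
  have two: "x = 0" if "2 * x = 0" for x :: complex using that by simp
  have ac: "a + c = 0" by (rule two) (use arg_cong2[OF e(1,2), of "(+)"] in \<open>simp add: algebra_simps\<close>)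
  have bd: "b + d = 0" by (rule two) (use arg_cong2[OF e(1,2), of "(-)"] in \<open>simp add: algebra_simps\<close>)
  have c0: "c = 0" by (rule two, rule two) (use arg_cong2[OF e(3,4), of "(-)"] in \<open>simp add: algebra_simps\<close>)
  have bd3: "b + 3 * d = 0" by (rule two) (use arg_cong2[OF e(3,4), of "(+)"] in \<open>simp add: algebra_simps\<close>)
  have "d = 0" by (rule two) (use arg_cong2[OF bd3 bd, of "(-)"] in \<open>simp add: algebra_simps\<close>)
  with ac bd c0 have "a = 0" "b = 0" "c = 0" "d = 0" by simp_all
  then show ?thesis unfolding ue by simp
qed

text \<open>
The value at \<open>0\<close> is not zero: otherwise some nonzero trial function \<open>u\<close> would have \<open>D^4 u\<close> orthogonal to all
test functions. But \<open>D^4 u\<close> is itself of degree at most \<open>n - 4\<close>, so it would vanish.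
\<close>

lemma tau_char_poly_nonzero:
  assumes \<gamma>: "\<gamma> > - 1 / 2" and n: "n \<ge> 4"
    and \<phi>: "\<And>j. j < n - 3 \<Longrightarrow> \<phi> j \<in> trial_space n"
      "\<And>v j. (\<Sum>j<n - 3. Polynomial.smult (v j) (\<phi> j)) = 0 \<Longrightarrow> j < n - 3 \<Longrightarrow> v j = 0"
    and \<psi>: "\<And>q. q \<in> test_space n \<Longrightarrow> \<exists>v. q = (\<Sum>i<n - 3. Polynomial.smult (v i) (\<psi> i))"
  shows "tau_char_poly \<gamma> n \<phi> \<psi> \<noteq> 0"
proof
  assume "tau_char_poly \<gamma> n \<phi> \<psi> = 0"
  then have "det (tau_pencil \<gamma> n \<phi> \<psi> 0) = 0" using poly_tau_char_poly[OF \<gamma>, of n \<phi> \<psi> 0] by simp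
  moreover have "tau_pencil \<gamma> n \<phi> \<psi> 0 \<in> carrier_mat (n - 3) (n - 3)" by (simp add: tau_pencil_def)
  ultimately obtain w where w: "w \<in> carrier_vec (n - 3)" "w \<noteq> 0\<^sub>v (n - 3)" "tau_pencil \<gamma> n \<phi> \<psi> 0 *\<^sub>v w = 0\<^sub>v (n - 3)"
    using det_0_iff_vec_prod_zero by blast
  define u where "u = (\<Sum>j<n - 3. Polynomial.smult (vec_index w j) (\<phi> j))"
  have u: "u \<in> trial_space n"
  proof -
    have "(\<Sum>j\<in>A. Polynomial.smult (vec_index w j) (\<phi> j)) \<in> trial_space n" if "A \<subseteq> {..<n - 3}" "finite A" for A
      using that(2,1)
    proof (induction A rule: finite_induct)
      case (insert x A)
      then have "\<phi> x \<in> trial_space n" using \<phi>(1) by auto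
      then show ?case using insert
        by (auto simp: trial_space_def pderiv_add pderiv_smult intro!: degree_add_le order.trans[OF degree_smult_le])
    qed (simp add: trial_space_def)
    then show ?thesis by (simp add: u_def)
  qed
  have orth: "weighted_integral \<gamma> ((pderiv ^^ 4) u * \<psi> i) = 0" if i: "i < n - 3" for i
    using tau_pencil_mult[OF \<gamma> i, of w \<phi> \<psi> 0] w i unfolding u_def[symmetric] by simp
  have "(pderiv ^^ 4) u = 0"
  proof (rule weighted_integral_definite[OF \<gamma>])
    fix q :: "complex poly" assume q: "degree q \<le> degree ((pderiv ^^ 4) u)"
    have "degree ((pderiv ^^ 4) u) \<le> n - 4" using u by (auto simp: degree_higher_pderiv trial_space_def)
    with q have "q \<in> test_space n" by (simp add: test_space_def)
    then obtain v where v: "q = (\<Sum>i<n - 3. Polynomial.smult (v i) (\<psi> i))" using \<psi> by blast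
    show "weighted_integral \<gamma> ((pderiv ^^ 4) u * q) = 0"
      unfolding v sum_distrib_left mult_smult_right weighted_integral_sum[OF \<gamma>] weighted_integral_smult[OF \<gamma>]
      using orth by (intro sum.neutral) auto
  qed
  then have "u = 0" by (rule cubic_trial_zero[OF u])
  then have "vec_index w j = 0" if "j < n - 3" for j using \<phi>(2)[of "vec_index w" j] that by (simp add: u_def)
  then have "w = 0\<^sub>v (n - 3)" using w(1) by (intro eq_vecI) auto
  with w(2) show False by simp
qed

lemma module_poly: "Modules.module (Polynomial.smult :: complex \<Rightarrow> complex poly \<Rightarrow> complex poly)"
  by (unfold_locales) (simp_all add: smult_add_right smult_add_left)

lemma basis_family_properties:
  assumes "basis_family m b V"
  shows "j < m \<Longrightarrow> b j \<in> V"
    "u \<in> V \<Longrightarrow> \<exists>v. u = (\<Sum>j<m. Polynomial.smult (v j) (b j))"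
    "(\<Sum>j<m. Polynomial.smult (v j) (b j)) = 0 \<Longrightarrow> j < m \<Longrightarrow> v j = 0"
proof -
  note M = module_poly
  have inj: "inj_on b {..<m}" and ind: "\<not> Modules.module.dependent Polynomial.smult (b ` {..<m})"
    and sp: "Modules.module.span Polynomial.smult (b ` {..<m}) = V" using assms by (auto simp: basis_family_def)
  show "b j \<in> V" if "j < m" unfolding sp[symmetric] using that by (intro module.span_base[OF M]) auto
  show "\<exists>v. u = (\<Sum>j<m. Polynomial.smult (v j) (b j))" if "u \<in> V"
  proof -
    have "u \<in> range (\<lambda>c. \<Sum>x\<in>b ` {..<m}. Polynomial.smult (c x) x)"
      using that module.span_finite[OF M, of "b ` {..<m}"] sp by simp
    then obtain c where "u = (\<Sum>x\<in>b ` {..<m}. Polynomial.smult (c x) x)" by blast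
    then have "u = (\<Sum>j<m. Polynomial.smult (c (b j)) (b j))" using sum.reindex[OF inj] by simp
    then show ?thesis by (intro exI[of _ "\<lambda>j. c (b j)"])
  qed
  show "v j = 0" if s: "(\<Sum>j<m. Polynomial.smult (v j) (b j)) = 0" and j: "j < m"
  proof -
    define c where "c = (\<lambda>x. v (the_inv_into {..<m} b x))"
    have cb: "c (b i) = v i" if "i < m" for i using that by (simp add: c_def the_inv_into_f_f[OF inj])
    have "(\<Sum>x\<in>b ` {..<m}. Polynomial.smult (c x) x) = (\<Sum>j<m. Polynomial.smult (c (b j)) (b j))"
      using sum.reindex[OF inj] by simp
    also have "\<dots> = 0" unfolding s[symmetric] by (intro sum.cong) (auto simp: cb)
    finally have "c (b j) = 0" using module.independentD[OF M ind, of "b ` {..<m}" c "b j"] j by simp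
    then show ?thesis using cb[OF j] by simp
  qed
qed

lemma poly_pderiv_linear_mult:
  "poly (pderiv ([:- c, 1:] * v)) x = (x - c) * poly (pderiv v) x + poly v (x :: complex)"
  by (simp only: pderiv_mult poly_add poly_mult) (simp add: pderiv_pCons)

lemma double_root_factor:
  fixes u :: "complex poly"
  assumes "poly u c = 0" "poly (pderiv u) c = 0"
  obtains w where "u = [:- c, 1:] * ([:- c, 1:] * w)"
proof -
  obtain v where v: "u = [:- c, 1:] * v" using assms(1) unfolding poly_eq_0_iff_dvd by (elim dvdE)
  have "poly v c = 0" using assms(2) unfolding v poly_pderiv_linear_mult by simp
  then obtain w where "v = [:- c, 1:] * w" unfolding poly_eq_0_iff_dvd by (elim dvdE)
  then show thesis using v that by blast
qed

text \<open>
The polynomial \<open>(1 - x\<^sup>2)\<^sup>2\<close>, which divides every trial function.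
\<close>

definition trial_factor :: "complex poly" where "trial_factor = ([:-1, 1:] * [:-1, 1:]) * ([:1, 1:] * [:1, 1:])"

lemma trial_space_factor:
  assumes "u \<in> trial_space n"
  obtains r where "u = trial_factor * r"
proof -
  have u: "poly u 1 = 0" "poly (pderiv u) 1 = 0" "poly u (-1) = 0" "poly (pderiv u) (-1) = 0"
    using assms by (auto simp: trial_space_def)
  obtain w where w: "u = [:- 1, 1:] * ([:- 1, 1:] * w)" using double_root_factor[OF u(1,2)] by metis
  have w1: "poly w (-1) = 0" using u(3) unfolding w by simp
  have "poly (pderiv w) (-1) = 0" using u(4) w1 unfolding w poly_pderiv_linear_mult by simp
  from double_root_factor[OF w1 this] obtain r where "w = [:1, 1:] * ([:1, 1:] * r)" by (metis minus_minus)
  then show thesis using that[of r] unfolding w trial_factor_def by (simp only: mult.assoc)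
qed

lemma trial_factor_nonzero: "trial_factor \<noteq> 0" "degree trial_factor = 4"
  by (simp_all add: trial_factor_def degree_mult_eq)

lemma standard_trial_span:
  assumes n: "n \<ge> 4" and u: "u \<in> trial_space n"
  shows "\<exists>v. u = (\<Sum>j<n - 3. Polynomial.smult (v j) (monom 1 j * trial_factor))"
proof -
  obtain r where r: "u = trial_factor * r" using trial_space_factor[OF u] .
  have "degree r \<le> n - 4"
  proof (cases "r = 0")
    case False
    then have "degree u = 4 + degree r" unfolding r using trial_factor_nonzero by (simp add: degree_mult_eq)
    then show ?thesis using u by (auto simp: trial_space_def)
  qed simp
  then have "r = (\<Sum>j\<le>n - 4. monom (coeff r j) j)" by (rule poly_as_sum_of_monoms'[symmetric])
  also have "{..n - 4} = {..<n - 3}" using n by auto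
  finally have ru: "r = (\<Sum>j<n - 3. monom (coeff r j) j)" .
  have "u = r * trial_factor" unfolding r by (rule mult.commute)
  also have "\<dots> = (\<Sum>j<n - 3. monom (coeff r j) j) * trial_factor" using ru by (rule arg_cong[of _ _ "\<lambda>x. x * trial_factor"])
  also have "\<dots> = (\<Sum>j<n - 3. monom (coeff r j) j * trial_factor)" by (rule sum_distrib_right)
  also have "\<dots> = (\<Sum>j<n - 3. Polynomial.smult (coeff r j) (monom 1 j * trial_factor))"
    by (intro sum.cong refl) (simp add: smult_monom flip: mult_smult_left)
  finally show ?thesis by blast
qed

lemma sum_smult_monom_eq_0:
  assumes "(\<Sum>j<k. Polynomial.smult (v j) (monom 1 j)) = (0 :: complex poly)" "j < k"
  shows "v j = 0"
proof -
  have "coeff (\<Sum>j<k. Polynomial.smult (v j) (monom 1 j)) j = v j"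
    using assms(2) by (simp add: coeff_sum if_distrib[of "\<lambda>x. _ * x"] sum.delta' cong: if_cong)
  then show ?thesis using assms(1) by simp
qed

lemma standard_trial_independent:
  assumes "(\<Sum>j<k. Polynomial.smult (v j) (monom 1 j * trial_factor)) = 0" "j < k"
  shows "v j = 0"
proof -
  have "(\<Sum>j<k. Polynomial.smult (v j) (monom 1 j)) * trial_factor = 0" using assms(1) by (simp add: sum_distrib_right)
  then have "(\<Sum>j<k. Polynomial.smult (v j) (monom 1 j)) = 0" using trial_factor_nonzero by simp
  then show ?thesis using assms(2) by (rule sum_smult_monom_eq_0)
qed

lemma standard_trial_mem:
  assumes "j < n - 3"
  shows "monom 1 j * trial_factor \<in> trial_space n"
proof -
  have "degree (monom 1 j * trial_factor) \<le> n"
    using assms trial_factor_nonzero by (intro order.trans[OF degree_mult_le]) (simp add: degree_monom_eq)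
  moreover have "poly trial_factor 1 = 0" "poly trial_factor (-1) = 0" "poly (pderiv trial_factor) 1 = 0" "poly (pderiv trial_factor) (-1) = 0"
    by (simp_all add: trial_factor_def pderiv_mult pderiv_pCons)
  ultimately show ?thesis by (simp add: trial_space_def pderiv_mult)
qed

lemma standard_test_span:
  assumes n: "n \<ge> 4" and q: "q \<in> test_space n"
  shows "\<exists>v. q = (\<Sum>j<n - 3. Polynomial.smult (v j) (monom 1 j))"
proof -
  have "degree q \<le> n - 4" using q by (simp add: test_space_def)
  then have "q = (\<Sum>j\<le>n - 4. monom (coeff q j) j)" by (rule poly_as_sum_of_monoms'[symmetric])
  also have "{..n - 4} = {..<n - 3}" using n by auto
  finally have "q = (\<Sum>j<n - 3. Polynomial.smult (coeff q j) (monom 1 j))" by (simp add: smult_monom)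
  then show ?thesis by blast
qed

text \<open>
A double root or a root outside \<open>S\<close> would leave no room for the \<open>k\<close> roots in \<open>S\<close>.
\<close>

lemma full_root_set:
  fixes p :: "complex poly"
  assumes p: "p \<noteq> 0" "degree p \<le> k" and S: "finite S" "card S = k" "\<And>x. x \<in> S \<Longrightarrow> poly p x = 0"
  shows "rsquarefree p" "poly p x = 0 \<Longrightarrow> x \<in> S"
proof -
  have bound: "card T \<le> degree q" if "q \<noteq> 0" "\<And>x. x \<in> T \<Longrightarrow> poly q x = 0" for T and q :: "complex poly"
  proof -
    have "card T \<le> card {x. poly q x = 0}" using that by (intro card_mono poly_roots_finite) auto
    then show ?thesis using card_poly_roots_bound[OF that(1)] by simp
  qed
  show "x \<in> S" if "poly p x = 0"
  proof (rule ccontr)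
    assume "x \<notin> S"
    then have "card (insert x S) = Suc k" using S by simp
    moreover have "card (insert x S) \<le> degree p" using S(3) that by (intro bound[OF p(1)]) auto
    ultimately show False using p(2) by simp
  qed
  have "order a p \<le> 1" for a
  proof (rule ccontr)
    assume "\<not> order a p \<le> 1"
    then have "[:- a, 1:] ^ 2 dvd p" by (intro dvd_trans[OF le_imp_power_dvd order_1]) simp
    then obtain q where q: "p = [:- a, 1:] ^ 2 * q" by (elim dvdE)
    have q0: "q \<noteq> 0" using p q by auto
    have "degree p = 2 + degree q" unfolding q using q0 by (simp add: degree_mult_eq degree_power_eq)
    moreover have "card (S - {a}) \<le> degree q" using S(3) unfolding q by (intro bound[OF q0]) auto
    moreover have "k \<le> Suc (card (S - {a}))" using S by (metis card_Suc_Diff1 card_mono Diff_empty Diff_insert0 le_SucI order.refl)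
    ultimately show False using p(2) by simp
  qed
  then show "rsquarefree p" unfolding rsquarefree_def using p(1) by (metis One_nat_def le_Suc_eq le_zero_eq)
qed

text \<open>
The monomial bases show that there are no eigenvalues outside \<open>S\<close>; for arbitrary bases the same count
shows that the roots are simple.
\<close>

theorem tau_spectrum:
  assumes \<gamma>: "\<gamma> > - 1 / 2" and n: "n \<ge> 4"
    and S: "finite S" "card S = n - 3" "\<And>l. l \<in> S \<Longrightarrow> tau_eigenvalue \<gamma> n l"
  shows "tau_eigenvalue \<gamma> n l \<Longrightarrow> l \<in> S" "tau_eigenvalues_distinct \<gamma> n"
proof -
  let ?\<phi> = "\<lambda>j. monom 1 j * trial_factor" and ?\<psi> = "\<lambda>j. monom (1 :: complex) j"
  have root: "poly (tau_char_poly \<gamma> n ?\<phi> ?\<psi>) l = 0" if "tau_eigenvalue \<gamma> n l" for l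
  proof (rule tau_eigenvalue_char_poly_root[OF \<gamma> that])
    show "\<exists>v. u = (\<Sum>j<n - 3. Polynomial.smult (v j) (monom 1 j * trial_factor))" if "u \<in> trial_space n" for u
      by (rule standard_trial_span[OF n that])
    show "monom 1 i \<in> test_space n" if "i < n - 3" for i using that by (simp add: test_space_def degree_monom_eq)
  qed
  have "tau_char_poly \<gamma> n ?\<phi> ?\<psi> \<noteq> 0"
  proof (rule tau_char_poly_nonzero[OF \<gamma> n])
    show "monom 1 j * trial_factor \<in> trial_space n" if "j < n - 3" for j by (rule standard_trial_mem[OF that])
    show "v j = 0" if "(\<Sum>j<n - 3. Polynomial.smult (v j) (monom 1 j * trial_factor)) = 0" "j < n - 3" for v j
      by (rule standard_trial_independent[OF that])
    show "\<exists>v. q = (\<Sum>i<n - 3. Polynomial.smult (v i) (monom 1 i))" if "q \<in> test_space n" for q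
      by (rule standard_test_span[OF n that])
  qed
  from full_root_set(2)[OF this degree_tau_char_poly S(1,2)] root S(3)
  show "tau_eigenvalue \<gamma> n l \<Longrightarrow> l \<in> S" by blast
  show "tau_eigenvalues_distinct \<gamma> n"
    unfolding tau_eigenvalues_distinct_def
  proof (intro allI impI)
    fix \<phi> \<psi> assume b: "basis_family (n - 3) \<phi> (trial_space n)" "basis_family (n - 3) \<psi> (test_space n)"
    note P = basis_family_properties[OF b(1)] and Q = basis_family_properties[OF b(2)]
    have "tau_char_poly \<gamma> n \<phi> \<psi> \<noteq> 0" 
    proof (rule tau_char_poly_nonzero[OF \<gamma> n])
      show "\<phi> j \<in> trial_space n" if "j < n - 3" for j by (rule P(1)[OF that])
      show "v j = 0" if "(\<Sum>j<n - 3. Polynomial.smult (v j) (\<phi> j)) = 0" "j < n - 3" for v j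
        using that by (rule P(3))
      show "\<exists>v. q = (\<Sum>i<n - 3. Polynomial.smult (v i) (\<psi> i))" if "q \<in> test_space n" for q by (rule Q(2)[OF that])
    qed
    moreover have "poly (tau_char_poly \<gamma> n \<phi> \<psi>) l = 0" if "l \<in> S" for l
    proof (rule tau_eigenvalue_char_poly_root[OF \<gamma> S(3)[OF that]])
      show "\<exists>v. u = (\<Sum>j<n - 3. Polynomial.smult (v j) (\<phi> j))" if "u \<in> trial_space n" for u by (rule P(2)[OF that])
      show "\<psi> i \<in> test_space n" if "i < n - 3" for i by (rule Q(1)[OF that])
    qed
    ultimately show "rsquarefree (tau_char_poly \<gamma> n \<phi> \<psi>)"
      by (intro full_root_set(1)[OF _ degree_tau_char_poly S(1,2)])
  qed
qed

section \<open>The limit of the rescaled even modes\<close>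

lemma pochhammer_2k_ge:
  assumes "\<beta> \<ge> (1::real)"
  shows "pochhammer \<beta> (2 * k) \<ge> fact k"
proof -
  have "fact j \<le> pochhammer \<beta> j" for j
  proof (induction j)
    case (Suc j)
    have "fact (Suc j) = fact j * (1 + real j)" by simp
    also have "\<dots> \<le> pochhammer \<beta> j * (\<beta> + real j)"
      using Suc assms order.trans[OF fact_ge_zero Suc] by (intro mult_mono) auto
    finally show ?case by (simp add: pochhammer_Suc)
  qed simp
  from this[of "2 * k"] have "fact (2 * k) \<le> pochhammer \<beta> (2 * k)" .
  moreover have "fact k \<le> (fact (2 * k) :: real)" by (rule fact_mono) simp
  ultimately show ?thesis by linarith
qed

text \<open>
The Mittag-Leffler function \<open>\<Gamma>(\<beta>) E_(2,\<beta>)\<close>, the limit of the rescaled even modes.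
\<close>

definition ml :: "real \<Rightarrow> real \<Rightarrow> real" where
  "ml \<beta> \<zeta> = (\<Sum>k. inverse (pochhammer \<beta> (2 * k)) * \<zeta> ^ k)"

lemma ml_coeff_bound:
  assumes "\<beta> \<ge> (1::real)"
  shows "0 < inverse (pochhammer \<beta> (2 * k))" "inverse (pochhammer \<beta> (2 * k)) \<le> inverse (fact k)"
  using pochhammer_2k_ge[OF assms, of k] by (auto intro!: le_imp_inverse_le pochhammer_pos less_le_trans[OF fact_gt_zero] simp: assms)

lemma ml_summable:
  assumes "\<beta> \<ge> (1::real)"
  shows "summable (\<lambda>k. inverse (pochhammer \<beta> (2 * k)) * \<zeta> ^ k)"
proof (rule summable_comparison_test')
  show "summable (\<lambda>k. inverse (fact k) * \<bar>\<zeta>\<bar> ^ k)" by (rule summable_exp)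
  show "norm (inverse (pochhammer \<beta> (2 * k)) * \<zeta> ^ k) \<le> inverse (fact k) * \<bar>\<zeta>\<bar> ^ k" if "k \<ge> 0" for k
    using ml_coeff_bound[OF assms, of k] by (simp add: abs_mult power_abs mult_right_mono)
qed

lemma isCont_ml: "\<beta> \<ge> 1 \<Longrightarrow> isCont (ml \<beta>) \<zeta>"
  unfolding ml_def by (rule isCont_powser_converges_everywhere) (rule ml_summable)

text \<open>
The factor \<open>t powr (1 - 1)\<close> keeps the integrand in the form used for integrals against Jacobi weights. It
is \<open>1\<close> except at \<open>t = 0\<close>, where it is \<open>0\<close>.
\<close>

definition cosint :: "real \<Rightarrow> real \<Rightarrow> real" where
  "cosint b x = integral {0..1} (\<lambda>t. (1 - cos (x * t)) * (t powr (1 - 1) * (1 - t) powr (b - 1)))"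

lemma one_minus_cos_sums: "(\<lambda>k. (-1) ^ k * y ^ (2 * (k + 1)) / fact (2 * (k + 1))) sums (1 - cos (y::real))"
proof -
  have "(\<lambda>n. (-1) ^ n * y ^ (2 * n) / fact (2 * n)) sums cos y"
    using cos_paired[of y] by (simp add: mult.commute)
  then have "(\<lambda>n. (-1) ^ Suc n * y ^ (2 * Suc n) / fact (2 * Suc n)) sums (cos y - 1)"
    using sums_split_initial_segment[of "\<lambda>n. (-1) ^ n * y ^ (2 * n) / fact (2 * n)" "cos y" 1] by simp
  from sums_minus[OF this] show ?thesis by simp
qed

text \<open>
Integrate the cosine series term by term, by dominated convergence with the bound \<open>exp \<bar>x\<bar>\<close>; the Beta
integrals produce \<open>(b)_(2k+3) = (b)_3 (b + 3)_(2k)\<close>.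
\<close>

lemma cosint_eq_ml:
  assumes b: "b > 0"
  shows "cosint b x = x\<^sup>2 / pochhammer b 3 * ml (b + 3) (- (x\<^sup>2))"
    and "(\<lambda>t. (1 - cos (x * t)) * (t powr (1 - 1) * (1 - t) powr (b - 1))) integrable_on {0..1}"
proof -
  define w where "w = (\<lambda>t::real. t powr (1 - 1) * (1 - t) powr (b - 1))"
  define c where "c = (\<lambda>k. (-1) ^ k * x ^ (2 * (k + 1)) / fact (2 * (k + 1)))"
  define Q where "Q = (\<lambda>K. \<Sum>k<K. monom (c k) (2 * (k + 1)))"
  have polyQ: "poly (Q K) t = (\<Sum>k<K. (-1) ^ k * (x * t) ^ (2 * (k + 1)) / fact (2 * (k + 1)))" for K t
    unfolding Q_def c_def by (simp add: poly_sum poly_monom power_mult_distrib mult_ac del: fact_Suc power_Suc)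
  define M where "M = exp \<bar>x\<bar>"
  have bound: "\<bar>poly (Q K) t\<bar> \<le> M" if "t \<in> {0..1}" for K t
  proof -
    have "\<bar>poly (Q K) t\<bar> \<le> (\<Sum>k<K. \<bar>x\<bar> ^ (2 * (k + 1)) / fact (2 * (k + 1)))"
      unfolding polyQ
    proof (rule order.trans[OF sum_abs sum_mono])
      fix k
      have "\<bar>x * t\<bar> \<le> \<bar>x\<bar>" using that by (simp add: abs_mult mult_left_le)
      then have "\<bar>x * t\<bar> ^ (2 * (k + 1)) \<le> \<bar>x\<bar> ^ (2 * (k + 1))" by (intro power_mono) auto
      then show "\<bar>(-1) ^ k * (x * t) ^ (2 * (k + 1)) / fact (2 * (k + 1))\<bar> \<le> \<bar>x\<bar> ^ (2 * (k + 1)) / fact (2 * (k + 1))"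
        by (simp only: abs_mult abs_divide power_abs abs_minus_cancel abs_one power_one mult_1_left abs_of_nonneg fact_ge_zero) (intro divide_right_mono fact_ge_zero)
    qed
    also have "\<dots> = (\<Sum>j\<in>(\<lambda>k. 2 * (k + 1)) ` {..<K}. inverse (fact j) * \<bar>x\<bar> ^ j)"
      by (subst sum.reindex) (auto simp: inj_on_def divide_inverse mult.commute)
    also have "\<dots> \<le> (\<Sum>j. inverse (fact j) * \<bar>x\<bar> ^ j)"
      by (intro sum_le_suminf summable_exp) auto
    also have "\<dots> = M" unfolding M_def exp_def by simp
    finally show ?thesis .
  qed
  have wint: "w integrable_on {0..1}" unfolding w_def using b by (intro integrable_Beta') auto
  have w0: "w t \<ge> 0" for t by (simp add: w_def)
  have conv: "(\<lambda>K. poly (Q K) t * w t) \<longlonglongrightarrow> (1 - cos (x * t)) * w t" for t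
    unfolding polyQ using one_minus_cos_sums[of "x * t"] by (intro tendsto_mult tendsto_const) (simp add: sums_def)
  have int: "(\<lambda>t. poly (Q K) t * w t) integrable_on {0..1}" for K
    unfolding w_def using b by (intro jac_integrable) auto
  have le: "norm (poly (Q K) t * w t) \<le> M * w t" if "t \<in> {0..1}" for K t
    using bound[OF that, of K] w0[of t] by (simp add: abs_mult mult_right_mono)
  have hint: "(\<lambda>t. M * w t) integrable_on {0..1}" by (rule integrable_on_mult_right[OF wint])
  note dc = dominated_convergence[of "\<lambda>K t. poly (Q K) t * w t" "{0..1}" "\<lambda>t. M * w t" "\<lambda>t. (1 - cos (x * t)) * w t", OF int hint le conv]
  show "(\<lambda>t. (1 - cos (x * t)) * (t powr (1 - 1) * (1 - t) powr (b - 1))) integrable_on {0..1}"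
    using dc(1) unfolding w_def .
  have lim: "(\<lambda>K. jac 1 b (Q K)) \<longlonglongrightarrow> cosint b x"
    using dc(2) unfolding w_def jac_def cosint_def .
  have val: "jac 1 b (Q K) = x\<^sup>2 / pochhammer b 3 * (\<Sum>k<K. inverse (pochhammer (b + 3) (2 * k)) * (- (x\<^sup>2)) ^ k)" for K
  proof -
    have "jac 1 b (monom (c k) (2 * (k + 1))) = x\<^sup>2 / pochhammer b 3 * (inverse (pochhammer (b + 3) (2 * k)) * (- (x\<^sup>2)) ^ k)" for k
    proof -
      have "Beta (1 + real (2 * (k + 1))) b = Beta 1 b * fact (2 * (k + 1)) / pochhammer (1 + b) (2 * (k + 1))"
        using Beta_add_nat[of 1 b "2 * (k + 1)"] b by (simp only: pochhammer_fact)
      moreover have "Beta 1 b = 1 / b"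
      proof -
        have "b \<notin> \<int>\<^sub>\<le>\<^sub>0" using b by (auto dest: nonpos_Ints_nonpos)
        then have "Gamma (b + 1) = b * Gamma b" by (rule Gamma_plus1)
        moreover have "Gamma b > 0" using b by (rule Gamma_real_pos)
        ultimately show ?thesis by (simp add: Beta_def add.commute)
      qed
      moreover have "b * pochhammer (1 + b) (2 * (k + 1)) = pochhammer b 3 * pochhammer (b + 3) (2 * k)"
        using pochhammer_rec[of b "2 * (k + 1)"] pochhammer_product'[of b 3 "2 * k"] by (simp add: add.commute eval_nat_numeral)
      ultimately have B: "Beta (1 + real (2 * (k + 1))) b = fact (2 * (k + 1)) / (pochhammer b 3 * pochhammer (b + 3) (2 * k))"
        by (simp only: times_divide_eq_left mult_1_left divide_divide_eq_left)
      have "x ^ (2 * (k + 1)) = x\<^sup>2 * (x\<^sup>2) ^ k" by (simp only: power_mult) simp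
      then have "c k = ((-1) ^ k * (x\<^sup>2 * (x\<^sup>2) ^ k)) / fact (2 * (k + 1))" by (simp only: c_def)
      moreover have "(- (x\<^sup>2)) ^ k = (-1) ^ k * (x\<^sup>2) ^ k" by (rule power_minus)
      moreover have "fact (2 * (k + 1)) \<noteq> (0::real)" by (rule fact_nonzero)
      ultimately show ?thesis using b
        by (subst jac_monom) (simp_all only: B zero_less_one, simp add: divide_inverse mult_ac del: fact_Suc)
    qed
    then show ?thesis unfolding Q_def using b by (simp add: jac_sum sum_distrib_left)
  qed
  have "(\<lambda>K. \<Sum>k<K. inverse (pochhammer (b + 3) (2 * k)) * (- (x\<^sup>2)) ^ k) \<longlonglongrightarrow> ml (b + 3) (- (x\<^sup>2))"
    unfolding ml_def using b by (intro summable_LIMSEQ ml_summable) auto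
  then have "(\<lambda>K. jac 1 b (Q K)) \<longlonglongrightarrow> x\<^sup>2 / pochhammer b 3 * ml (b + 3) (- (x\<^sup>2))"
    unfolding val by (intro tendsto_mult tendsto_const)
  with lim show "cosint b x = x\<^sup>2 / pochhammer b 3 * ml (b + 3) (- (x\<^sup>2))" by (rule LIMSEQ_unique)
qed

text \<open>
Only the part of the integral over \<open>[1/4, 3/4]\<close> is kept, where the weight is bounded below for \<open>b\<close> on either
side of \<open>1\<close>.
\<close>

lemma cosint_lower:
  assumes b: "b > 0" and \<kappa>: "0 < \<kappa>" "\<And>t. 1 / 4 \<le> t \<Longrightarrow> t \<le> 3 / 4 \<Longrightarrow> \<kappa> \<le> (1 - t) powr (b - 1)" and x: "x > 0"
  shows "\<kappa> * (1 / 2 - (sin (3 * x / 4) - sin (x / 4)) / x) \<le> cosint b x"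
proof -
  let ?g = "\<lambda>t. (1 - cos (x * t)) * (t powr (1 - 1) * (1 - t) powr (b - 1))"
  have hi0: "((\<lambda>t. \<kappa> * (1 - cos (x * t))) has_integral \<kappa> * (3 / 4 - sin (x * (3 / 4)) / x) - \<kappa> * (1 / 4 - sin (x * (1 / 4)) / x)) {1 / 4..3 / 4}"
    using x by (intro fundamental_theorem_of_calculus)
      (auto simp flip: has_real_derivative_iff_has_vector_derivative intro!: derivative_eq_intros)
  have hi: "((\<lambda>t. \<kappa> * (1 - cos (x * t))) has_integral \<kappa> * (1 / 2 - (sin (3 * x / 4) - sin (x / 4)) / x)) {1 / 4..3 / 4}"
  proof -
    have "\<kappa> * (3 / 4 - sin (x * (3 / 4)) / x) - \<kappa> * (1 / 4 - sin (x * (1 / 4)) / x) = \<kappa> * (1 / 2 - (sin (3 * x / 4) - sin (x / 4)) / x)"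
      using x by (simp add: field_simps)
    with hi0 show ?thesis by (simp only:)
  qed
  have gi: "?g integrable_on {1 / 4..3 / 4}"
    by (rule integrable_subinterval_real[OF cosint_eq_ml(2)[OF b]]) auto
  have "\<kappa> * (1 / 2 - (sin (3 * x / 4) - sin (x / 4)) / x) = integral {1 / 4..3 / 4} (\<lambda>t. \<kappa> * (1 - cos (x * t)))"
    by (rule integral_unique[OF hi, symmetric])
  also have "\<dots> \<le> integral {1 / 4..3 / 4} ?g"
  proof (rule integral_le)
    show "(\<lambda>t. \<kappa> * (1 - cos (x * t))) integrable_on {1 / 4..3 / 4}" using hi by blast
    fix t :: real assume t: "t \<in> {1 / 4..3 / 4}"
    have "\<kappa> * (1 - cos (x * t)) \<le> (1 - t) powr (b - 1) * (1 - cos (x * t))"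
      using \<kappa>(2)[of t] t by (intro mult_right_mono) auto
    then show "\<kappa> * (1 - cos (x * t)) \<le> ?g t" using t by (simp add: mult.commute)
  qed (rule gi)
  also have "\<dots> \<le> integral {0..1} ?g"
    by (rule integral_subset_le[OF _ gi cosint_eq_ml(2)[OF b]]) auto
  finally show ?thesis unfolding cosint_def .
qed

text \<open>
Strict positivity uses \<open>\<bar>sin (x / 4)\<bar> < x / 4\<close>. For \<open>x \<ge> 8\<close> the oscillating part of the lower bound is at most
half of the constant part, so the bound is uniform in \<open>x\<close>.
\<close>

lemma cosint_pos:
  assumes b: "b > 0" and x: "x > 0"
  shows "cosint b x > 0" "\<exists>\<kappa>>0. \<forall>x\<ge>8. \<kappa> \<le> cosint b x"
proof -
  define \<kappa> where "\<kappa> = min ((1 / 4) powr (b - 1)) ((3 / 4 :: real) powr (b - 1))"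
  have \<kappa>: "\<kappa> > 0" by (simp add: \<kappa>_def)
  have \<kappa>': "\<kappa> \<le> (1 - t) powr (b - 1)" if "1 / 4 \<le> t" "t \<le> 3 / 4" for t
  proof (cases "b \<ge> 1")
    case True
    have "(1 / 4) powr (b - 1) \<le> (1 - t) powr (b - 1)" using that True by (intro powr_mono2) auto
    then show ?thesis by (simp add: \<kappa>_def)
  next
    case False
    have "(3 / 4) powr (b - 1) \<le> (1 - t) powr (b - 1)" using that False by (intro powr_mono2') auto
    then show ?thesis by (simp add: \<kappa>_def)
  qed
  have low: "\<kappa> * (1 / 2 - (sin (3 * x / 4) - sin (x / 4)) / x) \<le> cosint b x" if "x > 0" for x
    using cosint_lower[OF b \<kappa> \<kappa>' that] by simp
  have "sin (3 * x / 4) - sin (x / 4) < x / 2"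
  proof -
    have "sin (3 * x / 4) - sin (x / 4) = 2 * sin (x / 4) * cos (x / 2)"
      using sin_diff_sin[of "3 * x / 4" "x / 4"] by (simp add: field_simps)
    also have "\<dots> \<le> 2 * \<bar>sin (x / 4)\<bar> * 1"
    proof -
      have "2 * sin (x / 4) * cos (x / 2) \<le> \<bar>2 * sin (x / 4) * cos (x / 2)\<bar>" by simp
      also have "\<dots> = 2 * \<bar>sin (x / 4)\<bar> * \<bar>cos (x / 2)\<bar>" by (simp add: abs_mult)
      also have "\<dots> \<le> 2 * \<bar>sin (x / 4)\<bar> * 1" by (intro mult_left_mono) auto
      finally show ?thesis .
    qed
    also have "2 * \<bar>sin (x / 4)\<bar> * 1 < x / 2"
    proof -
      have "sin (x / 4) < x / 4"
      proof (cases "x / 4 < pi / 2")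
        case True
        show ?thesis
        proof -
          have "\<exists>z. 0 < z \<and> z < x / 4 \<and> sin (x / 4) - sin 0 = (x / 4 - 0) * cos z"
            using x by (intro MVT2) (auto intro!: derivative_eq_intros)
          then obtain z where z: "0 < z" "z < x / 4" "sin (x / 4) = x / 4 * cos z" by auto
          have "cos z < cos 0" using z True pi_gt_zero by (intro cos_monotone_0_pi) auto
          then have "x / 4 * cos z < x / 4 * 1" using x by (intro mult_strict_left_mono) auto
          then show ?thesis unfolding z(3) by simp
        qed
      next
        case False
        then have "x / 4 > 1" using pi_gt3 by linarith
        then show ?thesis using sin_le_one[of "x / 4"] by linarith
      qed
      moreover have "- sin (x / 4) < x / 4"
      proof (cases "x / 4 < pi")
        case True
        then have "sin (x / 4) > 0" using x by (intro sin_gt_zero) auto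
        then show ?thesis using x by linarith
      next
        case False
        then have "x / 4 > 1" using pi_gt3 by linarith
        moreover have "- sin (x / 4) \<le> 1" using sin_ge_minus_one[of "x / 4"] by linarith
        ultimately show ?thesis by linarith
      qed
      ultimately show ?thesis by (simp add: abs_if)
    qed
    finally show ?thesis .
  qed
  then have "0 < 1 / 2 - (sin (3 * x / 4) - sin (x / 4)) / x" using x by (simp add: field_simps)
  then have "0 < \<kappa> * (1 / 2 - (sin (3 * x / 4) - sin (x / 4)) / x)" using \<kappa> by simp
  with low[OF x] show "cosint b x > 0" by linarith
  have "\<kappa> / 4 \<le> cosint b x" if "x \<ge> 8" for x
  proof -
    have "sin (3 * x / 4) - sin (x / 4) \<le> 2"
      using sin_le_one[of "3 * x / 4"] sin_ge_minus_one[of "x / 4"] by linarith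
    also have "2 \<le> x / 4" using that by simp
    finally have "(sin (3 * x / 4) - sin (x / 4)) / x \<le> 1 / 4" using that by (simp add: field_simps)
    then have "\<kappa> * (1 / 4) \<le> \<kappa> * (1 / 2 - (sin (3 * x / 4) - sin (x / 4)) / x)" using \<kappa> by (intro mult_left_mono) auto
    moreover have "\<kappa> * (1 / 2 - (sin (3 * x / 4) - sin (x / 4)) / x) \<le> cosint b x" using that by (intro low) auto
    ultimately show ?thesis by linarith
  qed
  then show "\<exists>\<kappa>>0. \<forall>x\<ge>8. \<kappa> \<le> cosint b x" using \<kappa> by (intro exI[of _ "\<kappa> / 4"]) auto
qed

text \<open>
This is where \<open>\<beta> > 3\<close> enters: the integrand with weight exponent \<open>\<beta> - 4 > - 1\<close> is nonnegative.
\<close>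

lemma ml_pos:
  assumes \<beta>: "\<beta> > 3" and s: "s \<ge> 0"
  shows "ml \<beta> (- s) > 0"
proof (cases "s = 0")
  case True
  have "ml \<beta> 0 = (\<Sum>k. inverse (pochhammer \<beta> (2 * k)) * 0 ^ k)" by (simp add: ml_def)
  also have "\<dots> = 1" by (subst powser_zero) simp
  finally show ?thesis using True by simp
next
  case False
  define x where "x = sqrt s"
  have x: "x > 0" "x\<^sup>2 = s" using False s by (auto simp: x_def)
  have p: "pochhammer (\<beta> - 3) 3 > 0" using \<beta> by (intro pochhammer_pos) auto
  have "0 < x\<^sup>2 / pochhammer (\<beta> - 3) 3 * ml \<beta> (- (x\<^sup>2))"
    using cosint_pos(1)[of "\<beta> - 3" x] cosint_eq_ml(1)[of "\<beta> - 3" x] \<beta> x by simp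
  then have "0 < s / pochhammer (\<beta> - 3) 3 * ml \<beta> (- s)" unfolding x(2) .
  moreover have "0 < s / pochhammer (\<beta> - 3) 3" using p False s by simp
  ultimately show ?thesis by (rule zero_less_mult_pos)
qed

text \<open>
On the negative axis the function decays no faster than \<open>1 / T\<close>.
\<close>

lemma ml_beats_exponential:
  assumes \<beta>: "\<beta> > 3" and c: "c > 0"
  obtains T where "T > 0" "2 * exp (- c * T) < ml \<beta> (- T)"
proof -
  obtain \<kappa> where \<kappa>: "\<kappa> > 0" "\<And>x. x \<ge> 8 \<Longrightarrow> \<kappa> \<le> cosint (\<beta> - 3) x" using cosint_pos(2)[of "\<beta> - 3" 1] \<beta> by auto
  define p where "p = pochhammer (\<beta> - 3) 3"
  have p: "p > 0" unfolding p_def using \<beta> by (intro pochhammer_pos) auto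
  have "((\<lambda>T. T * exp (- c * T)) \<longlongrightarrow> 0) at_top"
    using c by real_asymp
  then have "eventually (\<lambda>T. T * exp (- c * T) < p * \<kappa> / 2) at_top"
    using p \<kappa>(1) by (intro order_tendstoD(2)) auto
  moreover have "eventually (\<lambda>T::real. T \<ge> 64) at_top" by (rule eventually_ge_at_top)
  ultimately obtain T where T: "T * exp (- c * T) < p * \<kappa> / 2" "T \<ge> 64"
    using eventually_happens[OF eventually_conj, of _ at_top] by fastforce
  define x where "x = sqrt T"
  have "sqrt 64 \<le> x" unfolding x_def using T(2) by (rule real_sqrt_le_mono)
  moreover have "sqrt 64 = (8::real)" by (rule real_sqrt_unique) auto
  ultimately have x: "x \<ge> 8" "x\<^sup>2 = T" using T(2) by (auto simp: x_def)
  have "\<kappa> \<le> T / p * ml \<beta> (- T)"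
    using \<kappa>(2)[OF x(1)] cosint_eq_ml(1)[of "\<beta> - 3" x] \<beta> x(2) by (simp add: p_def)
  then have "p * \<kappa> \<le> T * ml \<beta> (- T)" using p by (simp add: field_simps)
  with T(1) have "T * (2 * exp (- c * T)) < T * ml \<beta> (- T)" by (simp add: mult_ac)
  then have "2 * exp (- c * T) < ml \<beta> (- T)" using T(2) by simp
  then show thesis using that[of T] T(2) by simp
qed

lemma real_rooted_factorization:
  fixes p :: "real poly"
  assumes "\<And>z. poly (cp p) z = 0 \<Longrightarrow> Im z = 0" "poly p 0 = 1"
  obtains Y where "p = (\<Prod>y\<in>#Y. [:1, y:])"
proof -
  have "\<exists>Y. p = Polynomial.smult (poly p 0) (\<Prod>y\<in>#Y. [:1, y:])"
    if "\<And>z. poly (cp p) z = 0 \<Longrightarrow> Im z = 0" "poly p 0 \<noteq> 0" for p :: "real poly"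
    using that
  proof (induction "degree p" arbitrary: p)
    case 0
    then obtain a where "p = [:a:]" by (metis degree_eq_zeroE)
    then show ?case by (intro exI[of _ "{#}"]) simp
  next
    case (Suc n)
    have "degree (cp p) \<noteq> 0" using Suc.hyps(2) by simp
    then have "\<not> constant (poly (cp p))" by (simp add: constant_degree)
    then obtain z where z: "poly (cp p) z = 0" using fundamental_theorem_of_algebra by blast
    define x where "x = Re z"
    have zx: "z = of_real x" using Suc.prems(1)[OF z] by (simp add: x_def complex_eq_iff)
    have "poly p x = 0" using z unfolding zx poly_cp_real by simp
    then obtain q where q: "p = [:- x, 1:] * q" unfolding poly_eq_0_iff_dvd by (elim dvdE)
    have x0: "x \<noteq> 0" "poly q 0 \<noteq> 0" using Suc.prems(2) unfolding q by auto
    have "q \<noteq> 0" using x0 by auto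
    then have "degree p = Suc (degree q)" unfolding q by (simp add: degree_mult_eq del: mult_pCons_left)
    then have "n = degree q" using Suc.hyps(2) by simp
    moreover have "Im w = 0" if "poly (cp q) w = 0" for w
      by (rule Suc.prems(1)) (simp add: q cp_mult that del: mult_pCons_left)
    ultimately obtain Y where Y: "q = Polynomial.smult (poly q 0) (\<Prod>y\<in>#Y. [:1, y:])"
      using Suc.hyps(1)[of q] x0(2) by blast
    have lin: "[:- x, 1:] = Polynomial.smult (- x) [:1, - 1 / x:]" using x0 by simp
    have "p = Polynomial.smult (- x * poly q 0) ([:1, - 1 / x:] * (\<Prod>y\<in>#Y. [:1, y:]))"
      unfolding q lin by (subst Y) (simp only: mult_smult_left mult_smult_right smult_smult mult.commute)
    moreover have "poly p 0 = - x * poly q 0" unfolding q by simp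
    ultimately show ?case by (intro exI[of _ "add_mset (- 1 / x) Y"]) (simp only: image_mset_add_mset prod_mset.add_mset)
  qed
  from this[of p] assms that show thesis by auto
qed

text \<open>
Each factor satisfies \<open>1 - s y \<le> exp (- s y)\<close>, and the linear coefficient of the product is the sum of the \<open>y\<close>.
\<close>

lemma product_exp_bound:
  assumes "\<And>y. y \<in># Y \<Longrightarrow> 0 \<le> (y::real) \<and> s * y \<le> 1"
  shows "0 \<le> poly (\<Prod>y\<in>#Y. [:1, y:]) (- s) \<and> poly (\<Prod>y\<in>#Y. [:1, y:]) (- s) \<le> exp (- s * coeff (\<Prod>y\<in>#Y. [:1, y:]) 1)
    \<and> coeff (\<Prod>y\<in>#Y. [:1, y:]) 0 = 1"
  using assms
proof (induction Y)
  case (add y Y)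
  let ?P = "\<Prod>y\<in>#Y. [:1, y:]"
  have IH: "0 \<le> poly ?P (- s)" "poly ?P (- s) \<le> exp (- s * coeff ?P 1)" "coeff ?P 0 = 1" using add by auto
  have y: "0 \<le> y" "s * y \<le> 1" using add.prems by auto
  have c: "coeff (\<Prod>y\<in>#add_mset y Y. [:1, y:]) 1 = coeff ?P 1 + y" using IH(3) by simp
  have v: "poly (\<Prod>y\<in>#add_mset y Y. [:1, y:]) (- s) = (1 - s * y) * poly ?P (- s)" by (simp add: algebra_simps)
  have "1 - s * y \<le> exp (- (s * y))" using exp_ge_add_one_self[of "- (s * y)"] by simp
  then have "(1 - s * y) * poly ?P (- s) \<le> exp (- (s * y)) * exp (- s * coeff ?P 1)"
    using IH y by (intro mult_mono) auto
  also have "\<dots> = exp (- s * (coeff ?P 1 + y))" by (simp add: exp_add[symmetric] algebra_simps)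
  finally show ?case unfolding c v using IH y by simp
qed simp

text \<open>
Each product \<open>(m + 1 - i) (m + 2 \<beta> + i)\<close> from the two numerator symbols equals \<open>M - i (i + 2 \<beta> - 1)\<close> with
\<open>M = (m + 1) (m + 2 \<beta>)\<close>. Dividing by \<open>M\<close> gives these factors, which tend to \<open>1\<close>.
\<close>

definition mode_factor :: "real \<Rightarrow> nat \<Rightarrow> nat \<Rightarrow> real" where
  "mode_factor \<beta> m k = (\<Prod>i<2 * k. 1 - real i * (real i + 2 * \<beta> - 1) / ((real m + 1) * (real m + 2 * \<beta>)))"

lemma even_mode_scaled:
  assumes \<beta>: "\<beta> > 1"
  shows "coeff (even_mode \<beta> m) k = ((real m + 1) * (real m + 2 * \<beta>)) ^ (2 * k) * mode_factor \<beta> m k * inverse (pochhammer \<beta> (2 * k))"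
proof -
  let ?M = "(real m + 1) * (real m + 2 * \<beta>)"
  have M0: "real m + 2 * \<beta> > 0" using \<beta> by (intro add_nonneg_pos) auto
    then have M: "?M > 0" by simp
  have "pochhammer (- real (m + 1)) (2 * k) * pochhammer (real m + 2 * \<beta>) (2 * k)
     = (\<Prod>i<2 * k. (- real (m + 1) + real i) * (real m + 2 * \<beta> + real i))"
    by (simp add: pochhammer_prod prod.distrib atLeast0LessThan)
  also have "\<dots> = (\<Prod>i<2 * k. (- ?M) * (1 - real i * (real i + 2 * \<beta> - 1) / ?M))"
  proof (intro prod.cong refl)
    fix i
    have "(- M) * (1 - w / M) = - M + w" if "M > 0" for M w :: real using that by (simp add: field_simps)
    from this[OF M] show "(- real (m + 1) + real i) * (real m + 2 * \<beta> + real i) = (- ?M) * (1 - real i * (real i + 2 * \<beta> - 1) / ?M)"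
      by (simp only:) (simp add: algebra_simps)
  qed
  also have "\<dots> = ?M ^ (2 * k) * mode_factor \<beta> m k" unfolding mode_factor_def prod.distrib by (simp add: power_mult)
  finally show ?thesis unfolding coeff_even_mode by (simp only: divide_inverse)
qed

text \<open>
For \<open>2 k > m + 1\<close> the factor with \<open>i = m + 1\<close> is zero, so no negative factor matters.
\<close>

lemma mode_factor_bounds:
  assumes \<beta>: "\<beta> > 1"
  shows "0 \<le> mode_factor \<beta> m k" "mode_factor \<beta> m k \<le> 1"
proof -
  let ?M = "(real m + 1) * (real m + 2 * \<beta>)"
  have M0: "real m + 2 * \<beta> > 0" using \<beta> by (intro add_nonneg_pos) auto
    then have M: "?M > 0" by simp
  have nn: "0 \<le> real i * (real i + 2 * \<beta> - 1)" for i using \<beta> by (intro mult_nonneg_nonneg) auto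
  have "0 \<le> mode_factor \<beta> m k \<and> mode_factor \<beta> m k \<le> 1"
  proof (cases "2 * k \<le> m + 1")
    case True
    have "0 \<le> 1 - real i * (real i + 2 * \<beta> - 1) / ?M \<and> 1 - real i * (real i + 2 * \<beta> - 1) / ?M \<le> 1" if "i < 2 * k" for i
    proof -
      have "real i \<le> real m + 1" using that True by linarith
      then have "real i * (real i + 2 * \<beta> - 1) \<le> ?M" using \<beta> by (intro mult_mono) auto
      then show ?thesis using M nn[of i] by simp
    qed
    then show ?thesis unfolding mode_factor_def by (intro conjI prod_nonneg prod_le_1) auto
  next
    case False
    have "1 - real (m + 1) * (real (m + 1) + 2 * \<beta> - 1) / ?M = 0"
    proof -
      have "real (m + 1) * (real (m + 1) + 2 * \<beta> - 1) = ?M" by simp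
      then show ?thesis using M M0 by (simp only:) simp
    qed
    then have "mode_factor \<beta> m k = 0" unfolding mode_factor_def using False by (intro prod_zero) (auto intro!: bexI[of _ "m + 1"])
    then show ?thesis by simp
  qed
  then show "0 \<le> mode_factor \<beta> m k" "mode_factor \<beta> m k \<le> 1" by auto
qed

lemma mode_factor_tendsto: "(\<lambda>m. mode_factor \<beta> m k) \<longlonglongrightarrow> 1"
proof -
  have "(\<lambda>m. 1 - real i * (real i + 2 * \<beta> - 1) / ((real m + 1) * (real m + 2 * \<beta>))) \<longlonglongrightarrow> 1" for i
    by real_asymp
  then have "(\<lambda>m. mode_factor \<beta> m k) \<longlonglongrightarrow> (\<Prod>i<2 * k. 1)" unfolding mode_factor_def by (intro tendsto_prod)
  then show ?thesis by simp
qed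

text \<open>
The coefficients are dominated by those of the limit and converge to them, so Tannery's theorem applied at
\<open>T\<close> bounds the error on the whole interval \<open>[- T, 0]\<close>.
\<close>

lemma mode_uniform_limit:
  assumes \<beta>: "\<beta> > 1" and T: "T \<ge> 0" and e: "e > 0"
  shows "eventually (\<lambda>m. \<forall>\<sigma>. 0 \<le> \<sigma> \<and> \<sigma> \<le> T \<longrightarrow>
     \<bar>poly (even_mode \<beta> m) (- \<sigma> / ((real m + 1) * (real m + 2 * \<beta>))\<^sup>2) - ml \<beta> (- \<sigma>)\<bar> < e) sequentially"
proof -
  let ?c = "\<lambda>k. inverse (pochhammer \<beta> (2 * k))"
  have \<beta>1: "\<beta> \<ge> 1" using \<beta> by simp
  have c0: "?c k > 0" for k by (rule ml_coeff_bound(1)[OF \<beta>1])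
  have sumT: "summable (\<lambda>k. ?c k * T ^ k)" by (rule ml_summable[OF \<beta>1])
  have tan: "(\<lambda>m. \<Sum>k. ?c k * T ^ k * (1 - mode_factor \<beta> m k)) \<longlonglongrightarrow> (\<Sum>k. 0)"
  proof -
    have "(\<forall>\<^sub>F m in sequentially. summable (\<lambda>k. norm (?c k * T ^ k * (1 - mode_factor \<beta> m k)))) \<and>
          summable (\<lambda>k. norm (0::real)) \<and>
          ((\<lambda>m. \<Sum>k. ?c k * T ^ k * (1 - mode_factor \<beta> m k)) \<longlongrightarrow> (\<Sum>k. 0)) sequentially"
    proof (rule tannerys_theorem[where M = "\<lambda>k. ?c k * T ^ k"])
      show "(\<lambda>m. ?c k * T ^ k * (1 - mode_factor \<beta> m k)) \<longlonglongrightarrow> 0" for k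
      proof -
        have "(\<lambda>m. ?c k * T ^ k * (1 - mode_factor \<beta> m k)) \<longlonglongrightarrow> ?c k * T ^ k * (1 - 1)"
          by (intro tendsto_mult tendsto_diff tendsto_const mode_factor_tendsto)
        then show ?thesis by simp
      qed
      have "norm (?c k * T ^ k * (1 - mode_factor \<beta> m k)) \<le> ?c k * T ^ k" for k m
      proof -
        have "\<bar>1 - mode_factor \<beta> m k\<bar> \<le> 1" using mode_factor_bounds[OF \<beta>, of m k] by auto
        then have "?c k * T ^ k * \<bar>1 - mode_factor \<beta> m k\<bar> \<le> ?c k * T ^ k * 1"
          using c0[of k] T by (intro mult_left_mono) auto
        moreover have "norm (?c k * T ^ k * (1 - mode_factor \<beta> m k)) = ?c k * T ^ k * \<bar>1 - mode_factor \<beta> m k\<bar>"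
          using c0[of k] T by (simp add: abs_mult)
        ultimately show ?thesis by simp
      qed
      then show "\<forall>\<^sub>F (k, m) in at_top \<times>\<^sub>F sequentially. norm (?c k * T ^ k * (1 - mode_factor \<beta> m k)) \<le> ?c k * T ^ k"
        by (intro always_eventually) auto
    qed (use sumT in auto)
    then show ?thesis by blast
  qed
  then have "eventually (\<lambda>m. (\<Sum>k. ?c k * T ^ k * (1 - mode_factor \<beta> m k)) < e) sequentially"
    using e by (intro order_tendstoD(2)) auto
  then show ?thesis
  proof (rule eventually_mono, intro allI impI)
    fix m \<sigma> assume small: "(\<Sum>k. ?c k * T ^ k * (1 - mode_factor \<beta> m k)) < e" and \<sigma>: "0 \<le> \<sigma> \<and> \<sigma> \<le> T"
    let ?M = "(real m + 1) * (real m + 2 * \<beta>)"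
    have M0: "real m + 2 * \<beta> > 0" using \<beta> by (intro add_nonneg_pos) auto
    then have M: "?M > 0" by simp
    have mode_term: "coeff (even_mode \<beta> m) k * (- \<sigma> / ?M\<^sup>2) ^ k = ?c k * mode_factor \<beta> m k * (- \<sigma>) ^ k" for k
    proof -
      have "(- \<sigma> / ?M\<^sup>2) ^ k = (- \<sigma>) ^ k / ?M ^ (2 * k)" by (simp only: power_divide power_mult)
      then show ?thesis unfolding even_mode_scaled[OF \<beta>] using M M0 by simp
    qed
    have dom: "summable (\<lambda>k. ?c k * T ^ k * (1 - mode_factor \<beta> m k))"
    proof (rule summable_comparison_test'[OF sumT])
      fix k :: nat assume "k \<ge> 0"
      have "?c k * T ^ k * (1 - mode_factor \<beta> m k) \<le> ?c k * T ^ k * 1"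
        using c0[of k] T mode_factor_bounds[OF \<beta>, of m k] by (intro mult_left_mono) auto
      moreover have "0 \<le> ?c k * T ^ k * (1 - mode_factor \<beta> m k)"
        using c0[of k] T mode_factor_bounds[OF \<beta>, of m k] by (intro mult_nonneg_nonneg) auto
      ultimately show "norm (?c k * T ^ k * (1 - mode_factor \<beta> m k)) \<le> ?c k * T ^ k" by simp
    qed
    have zero: "coeff (even_mode \<beta> m) k = 0" if "k \<notin> {..m}" for k
    proof -
      have "pochhammer (- real (m + 1)) (2 * k) = 0" unfolding pochhammer_of_nat_eq_0_iff using that by simp
      then show ?thesis unfolding coeff_even_mode by simp
    qed
    have "degree (even_mode \<beta> m) \<le> m" using zero by (intro degree_le) auto
    then have "poly (even_mode \<beta> m) (- \<sigma> / ?M\<^sup>2) = (\<Sum>k\<le>m. coeff (even_mode \<beta> m) k * (- \<sigma> / ?M\<^sup>2) ^ k)"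
      by (rule poly_eq_sum_atMost)
    also have "\<dots> = (\<Sum>k. coeff (even_mode \<beta> m) k * (- \<sigma> / ?M\<^sup>2) ^ k)"
      using zero by (intro suminf_finite[symmetric]) auto
    also have "\<dots> = (\<Sum>k. ?c k * mode_factor \<beta> m k * (- \<sigma>) ^ k)" unfolding mode_term ..
    finally have p: "poly (even_mode \<beta> m) (- \<sigma> / ?M\<^sup>2) = (\<Sum>k. ?c k * mode_factor \<beta> m k * (- \<sigma>) ^ k)" .
    have le: "norm (?c k * (1 - mode_factor \<beta> m k) * (- \<sigma>) ^ k) \<le> ?c k * T ^ k * (1 - mode_factor \<beta> m k)" for k
    proof -
      have "\<bar>- \<sigma>\<bar> ^ k \<le> T ^ k" using \<sigma> by (intro power_mono) auto
      moreover have f0: "0 \<le> ?c k * (1 - mode_factor \<beta> m k)"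
        using c0[of k] mode_factor_bounds[OF \<beta>, of m k] by (intro mult_nonneg_nonneg) auto
      ultimately have "?c k * (1 - mode_factor \<beta> m k) * \<bar>- \<sigma>\<bar> ^ k \<le> ?c k * (1 - mode_factor \<beta> m k) * T ^ k"
        by (intro mult_left_mono)
      then show ?thesis using f0 by (simp only: real_norm_def abs_mult[of "_ * _" "_ ^ _"] abs_of_nonneg[OF f0] power_abs) (simp only: mult_ac)
    qed
    have sd: "summable (\<lambda>k. ?c k * (1 - mode_factor \<beta> m k) * (- \<sigma>) ^ k)"
      by (rule summable_comparison_test'[OF dom, of 0]) (rule le)
    have sml: "summable (\<lambda>k. ?c k * (- \<sigma>) ^ k)" by (rule ml_summable[OF \<beta>1])
    have "ml \<beta> (- \<sigma>) - (\<Sum>k. ?c k * (1 - mode_factor \<beta> m k) * (- \<sigma>) ^ k) = (\<Sum>k. ?c k * (- \<sigma>) ^ k - ?c k * (1 - mode_factor \<beta> m k) * (- \<sigma>) ^ k)"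
      unfolding ml_def by (rule suminf_diff[OF sml sd])
    also have "\<dots> = poly (even_mode \<beta> m) (- \<sigma> / ?M\<^sup>2)"
      unfolding p by (intro arg_cong[of _ _ suminf] ext) (simp add: algebra_simps)
    finally have "\<bar>poly (even_mode \<beta> m) (- \<sigma> / ?M\<^sup>2) - ml \<beta> (- \<sigma>)\<bar> = norm (\<Sum>k. ?c k * (1 - mode_factor \<beta> m k) * (- \<sigma>) ^ k)"
      by (simp add: abs_if)
    also have "\<dots> \<le> (\<Sum>k. ?c k * T ^ k * (1 - mode_factor \<beta> m k))"
      by (rule norm_suminf_le[OF le dom])
    finally show "\<bar>poly (even_mode \<beta> m) (- \<sigma> / ?M\<^sup>2) - ml \<beta> (- \<sigma>)\<bar> < e" using small by linarith
  qed
qed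

text \<open>
If all roots were real, they would be negative, as the coefficients are nonnegative. For large \<open>m\<close> the rescaled
polynomial is positive on \<open>[- T, 0]\<close>, so the roots lie to the left of \<open>- T\<close>, and the product bound makes its value
at \<open>- T\<close> exponentially small. But this value is close to that of the limit, which is larger.
\<close>

theorem even_mode_nonreal_root:
  assumes \<beta>: "\<beta> > 3"
  shows "eventually (\<lambda>m. \<exists>z. poly (cp (even_mode \<beta> m)) z = 0 \<and> Im z \<noteq> 0) sequentially"
proof -
  have \<beta>1: "\<beta> \<ge> 1" "\<beta> > 1" using \<beta> by auto
  define c where "c = inverse (pochhammer \<beta> 2) / 2"
  have c: "c > 0" unfolding c_def using \<beta> by (simp add: pochhammer_pos)
  obtain T where T: "T > 0" "2 * exp (- c * T) < ml \<beta> (- T)" using ml_beats_exponential[OF \<beta> c] .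
  have cont: "continuous_on {0..T} (\<lambda>s. ml \<beta> (- s))"
    by (intro continuous_at_imp_continuous_on ballI isCont_o2[OF _ isCont_ml[OF \<beta>1(1)]] continuous_intros)
  \<comment> \<open>Half of the minimum of the limit on \<open>[- T, 0]\<close> is an admissible error at every point.\<close>
  obtain s0 where s0: "s0 \<in> {0..T}" "\<And>s. s \<in> {0..T} \<Longrightarrow> ml \<beta> (- s0) \<le> ml \<beta> (- s)"
    using continuous_attains_inf[OF compact_Icc _ cont] T(1) by auto
  define e where "e = ml \<beta> (- s0) / 2"
  have e: "e > 0" unfolding e_def using ml_pos[OF \<beta>, of s0] s0(1) by simp
  have ev1: "eventually (\<lambda>m. mode_factor \<beta> m 1 > 1 / 2) sequentially"
    using mode_factor_tendsto[of \<beta> 1] by (intro order_tendstoD(1)) auto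
  show ?thesis
    using eventually_conj[OF mode_uniform_limit[OF \<beta>1(2) less_imp_le[OF T(1)] e] ev1]
  proof (rule eventually_mono, elim conjE)
    fix m
    let ?M = "(real m + 1) * (real m + 2 * \<beta>)" and ?E = "even_mode \<beta> m"
    assume close: "\<forall>\<sigma>. 0 \<le> \<sigma> \<and> \<sigma> \<le> T \<longrightarrow> \<bar>poly ?E (- \<sigma> / ?M\<^sup>2) - ml \<beta> (- \<sigma>)\<bar> < e"
      and mf: "mode_factor \<beta> m 1 > 1 / 2"
    have M0: "real m + 2 * \<beta> > 0" using \<beta> by (intro add_nonneg_pos) auto
    then have M: "?M > 0" by simp
    have half: "poly ?E (- \<sigma> / ?M\<^sup>2) > ml \<beta> (- \<sigma>) / 2" if "0 \<le> \<sigma>" "\<sigma> \<le> T" for \<sigma>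
    proof -
      have "e \<le> ml \<beta> (- \<sigma>) / 2" unfolding e_def using s0(2)[of \<sigma>] that by simp
      then show ?thesis using close that by (smt (verit) field_sum_of_halves)
    qed
    have pos: "poly ?E (- \<sigma> / ?M\<^sup>2) > 0" if "0 \<le> \<sigma>" "\<sigma> \<le> T" for \<sigma>
      using half[OF that] ml_pos[OF \<beta> that(1)] by linarith
    show "\<exists>z. poly (cp ?E) z = 0 \<and> Im z \<noteq> 0"
    proof (rule ccontr)
      assume "\<nexists>z. poly (cp ?E) z = 0 \<and> Im z \<noteq> 0"
      then have real: "\<And>z. poly (cp ?E) z = 0 \<Longrightarrow> Im z = 0" by blast
      have E0: "poly ?E 0 = 1" by (simp add: poly_0_coeff_0 coeff_even_mode)
      obtain Y where Y: "?E = (\<Prod>y\<in>#Y. [:1, y:])" using real_rooted_factorization[OF real E0] .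
      have root: "poly ?E (- 1 / y) = 0" if y: "y \<in># Y" "y \<noteq> 0" for y
      proof -
        have prodx: "poly (\<Prod>y\<in>#Y. [:1, y:]) x = (\<Prod>y\<in>#Y. 1 + x * y)" for x
          by (induction Y) (simp_all add: algebra_simps)
        have "0 \<in> (\<lambda>v. 1 + (- 1 / y) * v) ` set_mset Y" using y by (intro image_eqI[of _ _ y]) auto
        then have "0 \<in># image_mset (\<lambda>v. 1 + (- 1 / y) * v) Y" by (simp only: set_image_mset)
        then show ?thesis unfolding Y prodx by (simp only: prod_mset_zero_iff)
      qed
      have cnn: "coeff ?E k \<ge> 0" for k
        unfolding even_mode_scaled[OF \<beta>1(2)] using mode_factor_bounds[OF \<beta>1(2), of m k] ml_coeff_bound(1)[OF \<beta>1(1), of k]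
        by (intro mult_nonneg_nonneg) (auto simp: zero_le_even_power)
      have ynn: "y \<ge> 0" if "y \<in># Y" for y
      proof (rule ccontr)
        assume "\<not> y \<ge> 0"
        then have y: "y < 0" by simp
        define x where "x = - 1 / y"
        have x: "x > 0" using y by (simp add: x_def divide_neg_neg)
        have "1 = coeff ?E 0 * x ^ 0" using E0 by (simp add: poly_0_coeff_0)
        also have "\<dots> \<le> (\<Sum>i\<le>degree ?E. coeff ?E i * x ^ i)"
          using cnn x by (intro member_le_sum) auto
        also have "\<dots> = poly ?E x" by (simp add: poly_altdef)
        finally show False using root[OF that] y by (simp add: x_def)
      qed
      define s where "s = T / ?M\<^sup>2"
      have s: "s > 0" using T(1) M M0 by (simp add: s_def)
      have sy: "s * y \<le> 1" if "y \<in># Y" for y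
      proof (rule ccontr)
        assume "\<not> s * y \<le> 1"
        then have sy: "s * y > 1" by simp
        then have y0: "y > 0" using ynn[OF that] by (cases "y = 0") auto
        define \<sigma> where "\<sigma> = ?M\<^sup>2 / y"
        have M2: "?M\<^sup>2 > 0" using M M0 by simp
        have "\<sigma> \<le> T" using sy y0 M2 unfolding \<sigma>_def s_def by (simp add: field_simps)
        moreover have "0 \<le> \<sigma>" using y0 M2 by (simp add: \<sigma>_def)
        moreover have "- \<sigma> / ?M\<^sup>2 = - 1 / y" unfolding \<sigma>_def using M2 y0 by simp
        ultimately have "poly ?E (- 1 / y) > 0" using pos[of \<sigma>] by simp
        then show False using root[OF that] y0 by simp
      qed
      have "poly ?E (- s) \<le> exp (- s * coeff ?E 1)"
        unfolding Y using product_exp_bound[of Y s] ynn sy by blast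
      also have "s * coeff ?E 1 = T * (mode_factor \<beta> m 1 * inverse (pochhammer \<beta> 2))"
        unfolding s_def even_mode_scaled[OF \<beta>1(2)] using M M0 by simp
      then have "exp (- s * coeff ?E 1) \<le> exp (- c * T)"
      proof -
        have "1 / 2 * inverse (pochhammer \<beta> 2) \<le> mode_factor \<beta> m 1 * inverse (pochhammer \<beta> 2)"
          using mf ml_coeff_bound(1)[OF \<beta>1(1), of 1] by (intro mult_right_mono) auto
        then have "T * c \<le> T * (mode_factor \<beta> m 1 * inverse (pochhammer \<beta> 2))" using T(1) by (intro mult_left_mono) (auto simp: c_def)
        then show ?thesis using \<open>s * coeff ?E 1 = _\<close> by (simp add: mult.commute)
      qed
      finally have "poly ?E (- T / ?M\<^sup>2) \<le> exp (- c * T)" by (simp add: s_def)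
      moreover have "exp (- c * T) < ml \<beta> (- T) / 2" using T(2) by simp
      ultimately show False using half[of T] T(1) by linarith
    qed
  qed
qed

section \<open>The spectrum of the tau approximation\<close>

lemma cp_diff: "cp (p - q) = cp p - cp q"
  by (simp add: poly_eq_iff coeff_map_poly)

lemma poly_even_mode_0: "poly (even_mode \<beta> m) 0 = 1"
  by (simp add: poly_0_coeff_0 coeff_even_mode)

lemma tau_eigenvalue_even_mode:
  assumes \<gamma>: "\<gamma> > - 1 / 2" "\<gamma> \<noteq> 1 / 2" and n: "n \<ge> 4"
    and m: "even m" "m + 2 = n \<or> m + 3 = n" and z: "poly (cp (even_mode (\<gamma> - 1 / 2) m)) z = 0"
  shows "tau_eigenvalue \<gamma> n (1 / (4 * z))"
proof -
  define \<beta> where "\<beta> = \<gamma> - 1 / 2"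
  have \<beta>: "\<beta> > -1" "\<beta> \<noteq> 0" "\<gamma> + 1 / 2 = \<beta> + 1" using \<gamma> by (auto simp: \<beta>_def)
  have "m \<ge> 2" using n m by (auto elim!: evenE)
  then have "real m \<ge> 2" by simp
  then have B: "real m + 2 * \<beta> > 0" using \<beta> by linarith
  have z0: "z \<noteq> 0"
  proof
    assume "z = 0"
    then have "poly (even_mode \<beta> m) 0 = 0" using z poly_cp_real[of "even_mode \<beta> m" 0] by (simp add: \<beta>_def)
    then show False by (simp add: poly_even_mode_0)
  qed
  obtain U g where U: "degree U \<le> m + 2" "U \<noteq> 0" "poly U 0 = 0" "poly U 1 = 0"
    "poly (pderiv U) 0 = 0" "poly (pderiv U) 1 = 0"
    "pderiv (pderiv U) - Polynomial.smult z (pderiv (pderiv (pderiv (pderiv U)))) = cp g"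
    "\<And>Q. degree Q < m \<Longrightarrow> jac (\<beta> + 1) (\<beta> + 1) (g * Q) = 0"
    using even_eigenfunction[OF \<beta>(1,2) m(1) B z[folded \<beta>_def]] by blast
  have dU: "degree U \<le> n" using U(1) m by auto
  have orth: "jac (\<gamma> + 1 / 2) (\<gamma> + 1 / 2) (g * Q) = 0" if "degree Q \<le> n - 4" for Q
    unfolding \<beta>(3) using that m n by (intro U(8)) auto
  show ?thesis by (rule tau_eigenvalueI[OF \<gamma>(1) z0 dU U(2-7) orth])
qed

lemma tau_eigenvalue_odd_mode:
  assumes \<gamma>: "\<gamma> > 1 / 2" and n: "n \<ge> 4"
    and m: "odd m" "m + 2 = n \<or> m + 3 = n" and z: "poly (odd_mode (\<gamma> - 1 / 2) m) z = 0" "z \<noteq> 0"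
  shows "tau_eigenvalue \<gamma> n (1 / (4 * of_real z))"
proof -
  define \<beta> where "\<beta> = \<gamma> - 1 / 2"
  have \<beta>: "\<beta> > 0" "\<gamma> + 1 / 2 = \<beta> + 1" using \<gamma> by (auto simp: \<beta>_def)
  obtain U g where U: "degree U \<le> m + 2" "U \<noteq> 0" "poly U 0 = 0" "poly U 1 = 0"
    "poly (pderiv U) 0 = 0" "poly (pderiv U) 1 = 0"
    "pderiv (pderiv U) - Polynomial.smult z (pderiv (pderiv (pderiv (pderiv U)))) = g"
    "\<And>Q. degree Q < m \<Longrightarrow> jac (\<beta> + 1) (\<beta> + 1) (g * Q) = 0"
    using odd_eigenfunction[OF \<beta>(1) m(1) z(1)[folded \<beta>_def]] by blast
  show ?thesis
  proof (rule tau_eigenvalueI)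
    show "degree (cp U) \<le> n" "cp U \<noteq> 0" using U(1,2) m by auto
    show "poly (cp U) 0 = 0" "poly (cp U) 1 = 0" "poly (pderiv (cp U)) 0 = 0" "poly (pderiv (cp U)) 1 = 0"
      using poly_cp_real[of U 0] poly_cp_real[of U 1] poly_cp_real[of "pderiv U" 0] poly_cp_real[of "pderiv U" 1] U
      by (simp_all add: cp_pderiv)
    show "pderiv (pderiv (cp U)) - Polynomial.smult (complex_of_real z) (pderiv (pderiv (pderiv (pderiv (cp U))))) = cp g"
      unfolding U(7)[symmetric] by (simp add: cp_diff cp_smult cp_pderiv)
    show "jac (\<gamma> + 1 / 2) (\<gamma> + 1 / 2) (g * Q) = 0" if "degree Q \<le> n - 4" for Q
      unfolding \<beta>(2) using that m n by (intro U(8)) auto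
  qed (use \<gamma> z in auto)
qed

text \<open>
Among the two residual degrees \<open>n - 3\<close> and \<open>n - 2\<close> exactly one is even.
\<close>

lemma even_mode_index:
  assumes "n \<ge> (4 :: nat)"
  obtains m where "even m" "m \<ge> 2" "m + 2 = n \<or> m + 3 = n"
proof (cases "even n")
  case True
  then show thesis using assms that[of "n - 2"] by auto
next
  case False
  then have "n \<noteq> 4" by auto
  with assms have "n \<ge> 5" by simp
  then show thesis using False that[of "n - 3"] by auto
qed

lemma tau_spectrum_negative:
  assumes \<gamma>: "1 / 2 < \<gamma>" "\<gamma> \<le> 7 / 2" and n: "n \<ge> 4"
  shows "tau_eigenvalue \<gamma> n l \<Longrightarrow> l \<in> \<real> \<and> Re l < 0" "tau_eigenvalues_distinct \<gamma> n"
proof -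
  define \<beta> where "\<beta> = \<gamma> - 1 / 2"
  have \<beta>: "0 < \<beta>" "\<beta> \<le> 3" using \<gamma> by (auto simp: \<beta>_def)
  define R where "R = (\<lambda>me mo. {z. poly (even_mode \<beta> me) z = 0 \<or> poly (odd_mode \<beta> mo) z = 0})"
  have "\<exists>me mo. even me \<and> odd mo \<and> (me + 3 = n \<or> me + 2 = n) \<and> (mo + 3 = n \<or> mo + 2 = n) \<and>
      finite (R me mo) \<and> card (R me mo) = n - 3 \<and> (\<forall>z\<in>R me mo. z < 0)"
  proof (rule mode_roots[OF \<beta> n])
    fix me mo
    assume p: "even me" "odd mo" "me + 3 = n \<or> me + 2 = n" "mo + 3 = n \<or> mo + 2 = n"
      and f: "finite {z. poly (even_mode \<beta> me) z = 0 \<or> poly (odd_mode \<beta> mo) z = 0}"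
        "card {z. poly (even_mode \<beta> me) z = 0 \<or> poly (odd_mode \<beta> mo) z = 0} = n - 3"
      and neg: "\<And>z. poly (even_mode \<beta> me) z = 0 \<or> poly (odd_mode \<beta> mo) z = 0 \<Longrightarrow> z < 0"
    have "finite (R me mo)" "card (R me mo) = n - 3" unfolding R_def by (fact f)+
    moreover have "\<forall>z\<in>R me mo. z < 0" unfolding R_def using neg by simp
    ultimately show ?thesis using p by blast
  qed
  then obtain me mo where m: "even me" "odd mo" "me + 3 = n \<or> me + 2 = n" "mo + 3 = n \<or> mo + 2 = n"
    and Z: "finite (R me mo)" "card (R me mo) = n - 3" "\<forall>z\<in>R me mo. z < 0"
    by blast
  define S where "S = (\<lambda>z. 1 / (4 * complex_of_real z)) ` R me mo"
  have "inj_on (\<lambda>z. 1 / (4 * complex_of_real z)) (R me mo)"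
    by (rule inj_onI) simp
  then have S: "finite S" "card S = n - 3" using Z(1,2) by (simp_all add: S_def card_image)
  have eig: "tau_eigenvalue \<gamma> n l" if lS: "l \<in> S" for l
  proof -
    obtain z where z: "l = 1 / (4 * complex_of_real z)" "z \<in> R me mo"
      using lS unfolding S_def by blast
    have z_neg: "z < 0" using Z(3) z(2) by blast
    have z_root: "poly (even_mode \<beta> me) z = 0 \<or> poly (odd_mode \<beta> mo) z = 0" using z(2) by (simp add: R_def)
    show ?thesis
    proof (cases "poly (even_mode \<beta> me) z = 0")
      case True
      then have "poly (cp (even_mode (\<gamma> - 1 / 2) me)) (of_real z) = 0" by (simp add: poly_cp_real \<beta>_def)
      then show ?thesis unfolding z(1) using m \<gamma> n by (intro tau_eigenvalue_even_mode) auto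
    next
      case False
      then have "poly (odd_mode (\<gamma> - 1 / 2) mo) z = 0" using z_root by (simp add: \<beta>_def)
      then show ?thesis unfolding z(1) using z_neg m \<gamma> n by (intro tau_eigenvalue_odd_mode) auto
    qed
  qed
  have \<gamma>': "\<gamma> > - 1 / 2" using \<gamma> by simp
  show "tau_eigenvalues_distinct \<gamma> n" by (rule tau_spectrum(2)[OF \<gamma>' n S eig])
  assume l: "tau_eigenvalue \<gamma> n l"
  have "l \<in> S" by (rule tau_spectrum(1)[OF \<gamma>' n S _ l]) (rule eig)
  then obtain z where z: "l = 1 / (4 * complex_of_real z)" "z < 0" using Z(3) unfolding S_def by blast
  have "l = complex_of_real (1 / (4 * z))" by (simp add: z(1))
  then show "l \<in> \<real> \<and> Re l < 0" using z(2) by (simp add: divide_pos_neg)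
qed

lemma tau_positive_eigenvalue:
  assumes \<gamma>: "- 1 / 2 < \<gamma>" "\<gamma> < 1 / 2" and n: "n \<ge> 4"
  shows "\<exists>r::real. r > 0 \<and> tau_eigenvalue \<gamma> n (of_real r)"
proof -
  obtain m where m: "even m" "m \<ge> 2" "m + 2 = n \<or> m + 3 = n" using even_mode_index[OF n] .
  obtain z where z: "z > 0" "poly (even_mode (\<gamma> - 1 / 2) m) z = 0"
    using even_mode_positive_root[of "\<gamma> - 1 / 2" m] \<gamma> m by auto
  have "tau_eigenvalue \<gamma> n (1 / (4 * complex_of_real z))"
    by (rule tau_eigenvalue_even_mode) (use \<gamma> m n z in \<open>auto simp: poly_cp_real\<close>)
  then show ?thesis using z(1) by (intro exI[of _ "1 / (4 * z)"]) simp
qed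

lemma tau_nonreal_eigenvalue:
  assumes \<gamma>: "\<gamma> > 7 / 2"
  shows "\<exists>N\<ge>4. \<forall>n\<ge>N. \<exists>l. l \<notin> \<real> \<and> tau_eigenvalue \<gamma> n l"
proof -
  obtain M where M: "\<And>m. m \<ge> M \<Longrightarrow> \<exists>z. poly (cp (even_mode (\<gamma> - 1 / 2) m)) z = 0 \<and> Im z \<noteq> 0"
    using even_mode_nonreal_root[of "\<gamma> - 1 / 2"] \<gamma> by (auto simp: eventually_sequentially)
  have "\<exists>l. l \<notin> \<real> \<and> tau_eigenvalue \<gamma> n l" if n: "n \<ge> M + 4" for n
  proof -
    have n4: "n \<ge> 4" using n by simp
    obtain m where m: "even m" "m \<ge> 2" "m + 2 = n \<or> m + 3 = n" using even_mode_index[OF n4] .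
    then have "m \<ge> M" using n by auto
    then obtain z where z: "poly (cp (even_mode (\<gamma> - 1 / 2) m)) z = 0" "Im z \<noteq> 0" using M by blast
    have "tau_eigenvalue \<gamma> n (1 / (4 * z))"
      by (rule tau_eigenvalue_even_mode) (use \<gamma> m n4 z in auto)
    moreover have "1 / (4 * z) \<notin> \<real>"
    proof
      assume "1 / (4 * z) \<in> \<real>"
      then have "inverse (4 * (1 / (4 * z))) \<in> \<real>" by (intro Reals_inverse Reals_mult) auto
      then have "z \<in> \<real>" by (simp add: field_simps)
      then show False using z(2) by (simp add: complex_is_Real_iff)
    qed
    ultimately show ?thesis by blast
  qed
  then show ?thesis by (intro exI[of _ "M + 4"]) auto
qed

theorem theorem5p7:
  shows "(\<forall>\<gamma>::real. 1/2 < \<gamma> \<and> \<gamma> \<le> 7/2 \<longrightarrow>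
           (\<forall>n\<ge>4. (\<forall>l. tau_eigenvalue \<gamma> n l \<longrightarrow> l \<in> \<real> \<and> Re l < 0) \<and>
                  tau_eigenvalues_distinct \<gamma> n)) \<and>
         (\<forall>\<gamma>::real. -1/2 < \<gamma> \<and> \<gamma> < 1/2 \<longrightarrow>
           (\<forall>n\<ge>4. \<exists>r::real. r > 0 \<and> tau_eigenvalue \<gamma> n (of_real r))) \<and>
         (\<forall>\<gamma>::real. \<gamma> > 7/2 \<longrightarrow>
           (\<exists>N\<ge>4. \<forall>n\<ge>N. \<exists>l. l \<notin> \<real> \<and> tau_eigenvalue \<gamma> n l))"
proof (intro conjI allI impI)
  fix \<gamma> :: real and n :: nat
  assume \<gamma>: "1 / 2 < \<gamma> \<and> \<gamma> \<le> 7 / 2" and n: "4 \<le> n"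
  show "l \<in> \<real>" "Re l < 0" if "tau_eigenvalue \<gamma> n l" for l
    using tau_spectrum_negative(1)[OF conjunct1[OF \<gamma>] conjunct2[OF \<gamma>] n that] by simp_all
  show "tau_eigenvalues_distinct \<gamma> n"
    by (rule tau_spectrum_negative(2)[OF conjunct1[OF \<gamma>] conjunct2[OF \<gamma>] n])
next
  fix \<gamma> :: real and n :: nat
  assume "- 1 / 2 < \<gamma> \<and> \<gamma> < 1 / 2" "4 \<le> n"
  then show "\<exists>r::real. r > 0 \<and> tau_eigenvalue \<gamma> n (of_real r)"
    by (intro tau_positive_eigenvalue) auto
next
  fix \<gamma> :: real
  assume "\<gamma> > 7 / 2"
  then show "\<exists>N\<ge>4. \<forall>n\<ge>N. \<exists>l. l \<notin> \<real> \<and> tau_eigenvalue \<gamma> n l"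
    by (rule tau_nonreal_eigenvalue)
qed

end
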